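(* Let $p\ge 1$ and $m\ge 1$ be integers, and let $$\mathcal X_{p,m}=\{(A_1,\dots,A_m)\in\mathcal E_p^m: A_1\cdots A_m\in\mathcal E_p\}.$$ The function $\Delta_m:\mathcal X_{p,m}\to\mathbb R$, $$\Delta_m(A_1,\dots,A_m)=\sum_{j=1}^m\rho(A_j)-\rho(A_1\cdots A_m),$$ has image $\{(m-1)p-2K: K=0,1,\dots,(m-1)p\}$, and each of its (nonempty) fibers is path connected. Thus $\mathcal X_{p,m}$ has exactly $(m-1)p+1$ connected components. For $m=2$ and $0\le r\le p$, the component of $\mathcal X_{p,2}$ on which $\Delta_2=2r-p$ has the homotopy type of the complex Grassmannian $\mathrm{Gr}_r(\mathbb C^p)$ of $r$-dimensional complex subspaces of $\mathbb C^p$.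
   Context: $\mathrm U(p)$ is the group of unitary $p\times p$ complex matrices, $I_p$ the identity, and $\mathcal E_p=\{A\in\mathrm U(p):\det(A-I_p)\neq0\}$. For $A\in\mathcal E_p$ write its eigenvalues, with multiplicity, as $e^{i\theta_1},\dots,e^{i\theta_p}$ with $0<\theta_\ell<2\pi$, and set $\rho(A)=p-\frac1\pi\sum_{\ell=1}^p\theta_\ell$. The space $\mathcal X_{p,m}$ has the subspace topology from $\mathrm U(p)^m$. *)

theory Defs
  imports "HOL-Analysis.Analysis" "HOL-Computational_Algebra.Polynomial"
begin

(* p is CARD('n), so p >= 1 is automatic. *)

definition adjoint_matrix :: "complex^'n^'n \<Rightarrow> complex^'n^'n" where
  "adjoint_matrix A = (\<chi> i j. cnj (A $ j $ i))"

definition unitary_group :: "(complex^'n^'n) set" where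
  "unitary_group = {A. adjoint_matrix A ** A = mat 1 \<and> A ** adjoint_matrix A = mat 1}"

definition E_set :: "(complex^'n^'n) set" where
  "E_set = {A \<in> unitary_group. det (A - mat 1) \<noteq> 0}"

definition charpoly :: "complex^'n^'n \<Rightarrow> complex poly" where
  "charpoly A = det (mat [:0, 1:] - map_matrix (\<lambda>a. [:a:]) A)"

(* The multiset of roots of the characteristic polynomial lists the eigenvalues with (algebraic)
   multiplicity.  Arg2pi takes values in [0, 2 pi); on the unit circle without 1 it is the unique
   theta in (0, 2 pi) with exp (i theta) equal to the given number.  Off E_set, rho has no meaning. *)
definition rho :: "complex^'n^'n \<Rightarrow> real" where
  "rho A = real CARD('n) - 1 / pi * (\<Sum>z\<in>#proots (charpoly A). Arg2pi z)"

(* mat_prod A m = A 1 ** A 2 ** ... ** A m *)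
primrec mat_prod :: "(nat \<Rightarrow> complex^'n^'n) \<Rightarrow> nat \<Rightarrow> complex^'n^'n" where
  "mat_prod A 0 = mat 1"
| "mat_prod A (Suc k) = mat_prod A k ** A (Suc k)"

(* m-tuples are functions that are extensional on {1..m}. *)
definition X_set :: "nat \<Rightarrow> (nat \<Rightarrow> complex^'n^'n) set" where
  "X_set m = {A \<in> {1..m} \<rightarrow>\<^sub>E E_set. mat_prod A m \<in> E_set}"

definition X_space :: "nat \<Rightarrow> (nat \<Rightarrow> complex^'n^'n) topology" where
  "X_space m =
     subtopology (product_topology (\<lambda>_. top_of_set unitary_group) {1..m}) (X_set m)"

definition Delta :: "nat \<Rightarrow> (nat \<Rightarrow> complex^'n^'n) \<Rightarrow> real" where
  "Delta m A = (\<Sum>j=1..m. rho (A j)) - rho (mat_prod A m)"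

definition Delta_fiber :: "nat \<Rightarrow> real \<Rightarrow> (nat \<Rightarrow> complex^'n^'n) set" where
  "Delta_fiber m c = {A \<in> X_set m. Delta m A = c}"

definition Gr :: "nat \<Rightarrow> (complex^'n) set set" where
  "Gr r = {V. vec.subspace V \<and> vec.dim V = r}"

definition frames :: "nat \<Rightarrow> (nat \<Rightarrow> complex^'n) set" where
  "frames r = {f \<in> {1..r} \<rightarrow>\<^sub>E UNIV. inj_on f {1..r} \<and> vec.independent (f ` {1..r})}"

definition frame_space :: "nat \<Rightarrow> (nat \<Rightarrow> complex^'n) topology" where
  "frame_space r = subtopology (product_topology (\<lambda>_. euclidean) {1..r}) (frames r)"

definition frame_span :: "nat \<Rightarrow> (nat \<Rightarrow> complex^'n) \<Rightarrow> (complex^'n) set" where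
  "frame_span r f = vec.span (f ` {1..r})"

(* The usual topology of the Grassmannian: the quotient topology along the surjection sending
   a linearly independent r-frame to its span (see openin_Gr_space, quotient_map_Gr_space). *)
definition Gr_space :: "nat \<Rightarrow> (complex^'n) set topology" where
  "Gr_space r = topology (\<lambda>U. U \<subseteq> Gr r \<and>
     openin (frame_space r) {f \<in> frames r. frame_span r f \<in> U})"

lemma topspace_frame_space: "topspace (frame_space r) = frames r"
  by (auto simp: frame_space_def frames_def)

lemma openin_Gr_space:
  "openin (Gr_space r) U \<longleftrightarrow>
     U \<subseteq> Gr r \<and> openin (frame_space r) {f \<in> frames r. frame_span r f \<in> U}"
proof -
  have "istopology (\<lambda>U. U \<subseteq> Gr r \<and>
          openin (frame_space r) {f \<in> frames r. frame_span r f \<in> U})"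
    unfolding istopology_def
  proof (intro conjI allI impI)
    fix S T :: "(complex^'n) set set"
    assume S: "S \<subseteq> Gr r \<and> openin (frame_space r) {f \<in> frames r. frame_span r f \<in> S}"
      and T: "T \<subseteq> Gr r \<and> openin (frame_space r) {f \<in> frames r. frame_span r f \<in> T}"
    have "{f \<in> frames r. frame_span r f \<in> S \<inter> T} =
        {f \<in> frames r. frame_span r f \<in> S} \<inter> {f \<in> frames r. frame_span r f \<in> T}"
      by auto
    then show "openin (frame_space r) {f \<in> frames r. frame_span r f \<in> S \<inter> T}"
      using S T by auto
    show "S \<inter> T \<subseteq> Gr r"
      using S by auto
  next
    fix K :: "(complex^'n) set set set"
    assume K: "\<forall>S\<in>K. S \<subseteq> Gr r \<and> openin (frame_space r) {f \<in> frames r. frame_span r f \<in> S}"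
    have "{f \<in> frames r. frame_span r f \<in> \<Union>K} =
        \<Union>((\<lambda>S. {f \<in> frames r. frame_span r f \<in> S}) ` K)"
      by auto
    also have "openin (frame_space r) \<dots>"
      using K by (intro openin_Union) auto
    finally show "openin (frame_space r) {f \<in> frames r. frame_span r f \<in> \<Union>K}" .
    show "\<Union>K \<subseteq> Gr r"
      using K by auto
  qed
  then show ?thesis
    unfolding Gr_space_def by (subst topology_inverse') auto
qed

lemma frame_span_in_Gr: "f \<in> frames r \<Longrightarrow> frame_span r f \<in> Gr r"
  unfolding Gr_def frame_span_def frames_def mem_Collect_eq
  using vec.dim_span_eq_card_independent[of "f ` {1..r}"] vec.subspace_span[of "f ` {1..r}"]
    card_image[of f "{1..r}"] by simp

lemma frame_span_surj: "frame_span r ` frames r = (Gr r :: (complex^'n) set set)"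
proof
  show "frame_span r ` frames r \<subseteq> (Gr r :: (complex^'n) set set)"
    using frame_span_in_Gr by auto
  show "(Gr r :: (complex^'n) set set) \<subseteq> frame_span r ` frames r"
  proof
    fix V :: "(complex^'n) set"
    assume V: "V \<in> Gr r"
    obtain B where B: "B \<subseteq> V" "vec.independent B" "V \<subseteq> vec.span B" "card B = vec.dim V"
      using vec.basis_exists by blast
    have fin: "finite B"
      using B(2) by (rule vec.finiteI_independent)
    have "card B = r"
      using B(4) V by (simp add: Gr_def)
    then obtain g where g: "bij_betw g {1..r} B"
      using ex_bij_betw_nat_finite_1[OF fin] by auto
    let ?f = "restrict g {1..r}"
    have im: "?f ` {1..r} = B"
      using g by (simp add: bij_betw_def)
    have "?f \<in> frames r"
    proof -
      have "inj_on ?f {1..r}"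
        using g by (simp add: bij_betw_def)
      then show ?thesis
        unfolding frames_def mem_Collect_eq im using B(2) by simp
    qed
    moreover have "frame_span r ?f = V"
      using B(1,3) V vec.span_minimal[of B V] unfolding frame_span_def im Gr_def by auto
    ultimately show "V \<in> frame_span r ` frames r"
      by blast
  qed
qed

lemma topspace_Gr_space: "topspace (Gr_space r) = (Gr r :: (complex^'n) set set)"
proof -
  have "{f \<in> frames r. frame_span r f \<in> (Gr r :: (complex^'n) set set)} =
      topspace (frame_space r)"
    by (auto simp: topspace_frame_space frame_span_in_Gr)
  then have "openin (frame_space r) {f \<in> frames r. frame_span r f \<in> (Gr r :: (complex^'n) set set)}"
    by (simp only: openin_topspace)
  then have "openin (Gr_space r) (Gr r :: (complex^'n) set set)"
    unfolding openin_Gr_space by (intro conjI subset_refl)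
  then have "(Gr r :: (complex^'n) set set) \<subseteq> topspace (Gr_space r)"
    by (rule openin_subset)
  moreover have "topspace (Gr_space r) \<subseteq> (Gr r :: (complex^'n) set set)"
    using openin_topspace[of "Gr_space r"] unfolding openin_Gr_space by (rule conjunct1)
  ultimately show ?thesis
    by (simp only: set_eq_subset)
qed

lemma quotient_map_Gr_space: "quotient_map (frame_space r) (Gr_space r) (frame_span r)"
  unfolding quotient_map_def topspace_frame_space topspace_Gr_space frame_span_surj
  by (auto simp: openin_Gr_space)

end

theory Submission
  imports Defs
begin

text \<open>
  Why the theorem holds.  Write \<open>p\<close> for the size of the matrices.  The Cayley transform identifies \<open>E_set\<close> with the
  vector space of Hermitian matrices, an eigenvalue \<open>x = cot (\<theta> / 2)\<close> of the Hermitian matrix corresponding to the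
  eigenvalue \<open>cis \<theta>\<close> of the unitary one.  In this coordinate \<open>rho\<close> is \<open>2 / pi\<close> times the sum of the arctangents of the
  eigenvalues, and it is continuous (\<open>rho_continuous\<close>).  Since \<open>rho\<close> is determined modulo 2 by the determinant,
  \<open>Delta\<close> takes integer values and is therefore constant along paths.

  If \<open>A\<close> and \<open>B\<close> have Cayley coordinates \<open>H\<close> and \<open>K\<close>, then \<open>A B - 1 = 2 \<i> X (H + K) Y\<close> with the resolvents \<open>X\<close> and \<open>Y\<close> of
  \<open>H\<close> and \<open>K\<close>.  So \<open>A B\<close> is in \<open>E_set\<close> exactly if \<open>H + K\<close> is invertible (\<open>product_in_E_iff\<close>), and the defect
  \<open>rho A + rho B - rho (A B)\<close> is the signature of \<open>H + K\<close> (\<open>rho_product_defect\<close>).  The space of pairs is thus a vector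
  space times the space of invertible Hermitian matrices.  The part of the latter with a given signature is path connected
  (\<open>invertible_hermitian_path_component\<close>), and \<open>S \<mapsto> S / \<bar>S\<bar>\<close> deforms it to the involutions of that signature, that is,
  to the orthogonal projections of rank \<open>r\<close> or the Grassmannian (\<open>pair_fiber_homotopy_equivalent_Gr\<close>).

  For longer products the fibers are treated by induction on the number of factors (\<open>X_set_fiber_path\<close>).  A tuple of
  length \<open>m + 1\<close> whose first \<open>m\<close> factors have their product in \<open>E_set\<close> is given by a tuple \<open>B\<close> of length \<open>m\<close> and an
  invertible Hermitian matrix \<open>S\<close>, which can be moved independently, and \<open>Delta\<close> is the sum of \<open>Delta m B\<close> and the
  signature of \<open>S\<close> (\<open>Delta_append_factor\<close>).  Multiplying the first factor by a small phase joins every tuple to one of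
  this form.  It remains to trade a change of \<open>Delta m B\<close> for one of the signature of \<open>S\<close>.  This happens inside the
  diagonal tuples, where it is a statement about real angles: the sum of the angles in one position may pass a multiple of
  \<open>2 pi\<close> at the last factor or earlier, as long as it ends up between the same two multiples, and this is a convex
  condition (\<open>factor_type_exchange\<close>).  The diagonal tuples also realize all values of \<open>Delta\<close>.
\<close>

section \<open>Adjoints and unitary diagonalization\<close>

definition diag_matrix :: "('n \<Rightarrow> complex) \<Rightarrow> complex^'n^'n" where
  "diag_matrix d = (\<chi> i j. if i = j then d i else 0)"

text \<open>The functional calculus: for a fixed unitary \<open>U\<close>, the map \<open>d \<mapsto> udiag U d\<close> is a ring homomorphism, so
identities between functions of one Hermitian matrix reduce to identities between scalars.\<close>

definition udiag :: "complex^'n^'n \<Rightarrow> ('n \<Rightarrow> complex) \<Rightarrow> complex^'n^'n" where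
  "udiag U d = U ** diag_matrix d ** adjoint_matrix U"

definition hermitian_set :: "(complex^'n^'n) set" where
  "hermitian_set = {H. adjoint_matrix H = H}"

lemma if_mult:
  "(if P then a else b) * (c :: 'a::mult_zero) = (if P then a * c else b * c)"
  "c * (if P then a else b) = (if P then c * a else c * b)"
  by simp_all

lemma adjoint_adjoint [simp]: "adjoint_matrix (adjoint_matrix A) = A"
  by (simp add: adjoint_matrix_def vec_eq_iff)

lemma adjoint_mult: "adjoint_matrix (A ** B) = adjoint_matrix B ** adjoint_matrix A"
  by (simp add: adjoint_matrix_def vec_eq_iff matrix_matrix_mult_def mult.commute)

lemma adjoint_add: "adjoint_matrix (A + B) = adjoint_matrix A + adjoint_matrix B"
  by (simp add: adjoint_matrix_def vec_eq_iff)

lemma adjoint_diff: "adjoint_matrix (A - B) = adjoint_matrix A - adjoint_matrix B"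
  by (simp add: adjoint_matrix_def vec_eq_iff)

lemma adjoint_scaleR: "adjoint_matrix (c *\<^sub>R A) = c *\<^sub>R adjoint_matrix A"
  by (simp add: adjoint_matrix_def vec_eq_iff)

lemma adjoint_mat [simp]: "adjoint_matrix (mat c) = mat (cnj c)"
  by (simp add: adjoint_matrix_def vec_eq_iff mat_def)

lemma adjoint_diag: "adjoint_matrix (diag_matrix d) = diag_matrix (\<lambda>l. cnj (d l))"
  by (simp add: adjoint_matrix_def vec_eq_iff diag_matrix_def)

lemma diag_matrix_mult: "diag_matrix a ** diag_matrix b = diag_matrix (\<lambda>l. a l * b l)"
  by (simp add: diag_matrix_def vec_eq_iff matrix_matrix_mult_def if_mult cong: if_cong)

lemma diag_matrix_const: "diag_matrix (\<lambda>_. c) = mat c"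
  by (simp add: diag_matrix_def vec_eq_iff mat_def)

lemma diag_matrix_add: "diag_matrix a + diag_matrix b = diag_matrix (\<lambda>l. a l + b l)"
  by (simp add: diag_matrix_def vec_eq_iff)

lemma diag_matrix_diff: "diag_matrix a - diag_matrix b = diag_matrix (\<lambda>l. a l - b l)"
  by (simp add: diag_matrix_def vec_eq_iff)

lemma det_diag_matrix: "det (diag_matrix d) = (\<Prod>l\<in>UNIV. d l)"
  by (subst det_diagonal) (auto simp: diag_matrix_def)

lemma mat_mult_commute: "mat c ** (A :: 'a::comm_semiring_1^'n^'n) = A ** mat c"
  by (simp add: vec_eq_iff matrix_matrix_mult_def mat_def if_mult mult.commute cong: if_cong)

lemma mat_mult_mat: "mat a ** mat b = (mat (a * b) :: 'a::comm_semiring_1^'n^'n)"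
  by (simp add: vec_eq_iff matrix_matrix_mult_def mat_def if_mult cong: if_cong)

lemma mat_mult_nth: "(mat c ** (A :: 'a::comm_semiring_1^'n^'n)) $ i $ j = c * A $ i $ j"
  by (simp add: matrix_matrix_mult_def mat_def if_mult cong: if_cong)

lemma mat_mult_left_commute:
  "(A :: 'a::comm_semiring_1^'n^'n) ** (mat c ** B) = mat c ** (A ** B)"
  by (simp only: matrix_mul_assoc mat_mult_commute[of c A])

lemma scaleR_eq_mat: "c *\<^sub>R (A :: complex^'n^'n) = mat (of_real c) ** A"
  unfolding vec_eq_iff mat_mult_nth vector_scaleR_component by (simp add: scaleR_conv_of_real)

lemma matrix_add_rdistrib: "(B + C) ** (A :: 'a::comm_ring_1^'n^'n) = B ** A + C ** A"
  by (simp add: vec_eq_iff matrix_matrix_mult_def sum.distrib algebra_simps)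

lemma matrix_diff_ldistrib: "(A :: 'a::comm_ring_1^'n^'n) ** (B - C) = A ** B - A ** C"
  by (simp add: vec_eq_iff matrix_matrix_mult_def sum_subtractf algebra_simps)

lemma matrix_diff_rdistrib: "(B - C) ** (A :: 'a::comm_ring_1^'n^'n) = B ** A - C ** A"
  by (simp add: vec_eq_iff matrix_matrix_mult_def sum_subtractf algebra_simps)

lemma unitary_adjoint:
  "U \<in> unitary_group \<Longrightarrow> adjoint_matrix U ** U = mat 1"
  "U \<in> unitary_group \<Longrightarrow> U ** adjoint_matrix U = mat 1"
  by (auto simp: unitary_group_def)

lemma unitaryI: "adjoint_matrix U ** U = mat 1 \<Longrightarrow> U \<in> unitary_group"
  unfolding unitary_group_def using matrix_left_right_inverse by blast

lemma unitary_mult: "A \<in> unitary_group \<Longrightarrow> B \<in> unitary_group \<Longrightarrow> A ** B \<in> unitary_group"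
proof (rule unitaryI)
  assume "A \<in> unitary_group" "B \<in> unitary_group"
  then have "adjoint_matrix B ** (adjoint_matrix A ** A) ** B = mat 1"
    by (simp add: unitary_adjoint)
  then show "adjoint_matrix (A ** B) ** (A ** B) = mat 1"
    by (simp add: adjoint_mult matrix_mul_assoc)
qed

lemma unitary_mat: "cmod c = 1 \<Longrightarrow> mat c \<in> unitary_group"
  by (rule unitaryI) (simp add: mat_mult_mat complex_norm_square[symmetric] mult.commute[of "cnj c"])

lemma unitary_det_nonzero:
  assumes "U \<in> unitary_group" shows "det U \<noteq> 0"
  using det_mul[of "adjoint_matrix U" U] unitary_adjoint(1)[OF assms] by auto

lemma udiag_mult:
  assumes "U \<in> unitary_group"
  shows "udiag U a ** udiag U b = udiag U (\<lambda>l. a l * b l)"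
proof -
  have "udiag U a ** udiag U b
      = U ** diag_matrix a ** (adjoint_matrix U ** U) ** diag_matrix b ** adjoint_matrix U"
    by (simp only: udiag_def matrix_mul_assoc)
  also have "\<dots> = U ** (diag_matrix a ** diag_matrix b) ** adjoint_matrix U"
    by (simp add: unitary_adjoint[OF assms] matrix_mul_assoc)
  finally show ?thesis
    by (simp add: diag_matrix_mult udiag_def)
qed

lemma udiag_add: "udiag U a + udiag U b = udiag U (\<lambda>l. a l + b l)"
  by (simp add: udiag_def diag_matrix_add[symmetric] matrix_add_ldistrib matrix_add_rdistrib)

lemma udiag_diff: "udiag U a - udiag U b = udiag U (\<lambda>l. a l - b l)"
  by (simp add: udiag_def diag_matrix_diff[symmetric] matrix_diff_ldistrib matrix_diff_rdistrib)

lemma udiag_const: "U \<in> unitary_group \<Longrightarrow> udiag U (\<lambda>_. c) = mat c"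
  unfolding udiag_def diag_matrix_const mat_mult_commute[symmetric]
  by (metis matrix_mul_assoc matrix_mul_rid unitary_adjoint(2))

lemma udiag_scale:
  assumes "U \<in> unitary_group" shows "mat c ** udiag U a = udiag U (\<lambda>l. c * a l)"
  by (simp add: udiag_mult[OF assms] udiag_const[OF assms, symmetric])

lemma adjoint_udiag: "adjoint_matrix (udiag U a) = udiag U (\<lambda>l. cnj (a l))"
  by (simp add: udiag_def adjoint_mult adjoint_diag matrix_mul_assoc)

lemma det_udiag:
  assumes "U \<in> unitary_group" shows "det (udiag U d) = (\<Prod>l\<in>UNIV. d l)"
proof -
  have "det U * det (adjoint_matrix U) = 1"
    using det_mul[of U "adjoint_matrix U"] by (simp add: unitary_adjoint[OF assms])
  then show ?thesis
    by (simp add: udiag_def det_mul det_diag_matrix ac_simps)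
qed

lemma trace_udiag:
  assumes "U \<in> unitary_group" shows "trace (udiag U d) = (\<Sum>l\<in>UNIV. d l)"
proof -
  have "trace (udiag U d) = trace (adjoint_matrix U ** (U ** diag_matrix d))"
    unfolding udiag_def by (rule trace_mul_sym)
  also have "\<dots> = trace (diag_matrix d)"
    by (simp add: matrix_mul_assoc unitary_adjoint[OF assms])
  finally show ?thesis by (simp add: trace_def diag_matrix_def)
qed

lemma matrix_inv_inverse:
  assumes "invertible (A :: 'a::field^'n^'n)"
  shows "A ** matrix_inv A = mat 1" "matrix_inv A ** A = mat 1"
  using someI_ex[OF assms[unfolded invertible_def]] by (auto simp: matrix_inv_def)

lemma matrix_inv_eqI:
  fixes A B :: "'a::field^'n^'n"
  assumes "A ** B = mat 1" shows "matrix_inv A = B"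
proof -
  have inv: "invertible A" unfolding invertible_def using assms matrix_left_right_inverse by blast
  have "matrix_inv A = matrix_inv A ** (A ** B)" by (simp add: assms)
  also have "\<dots> = B" by (simp add: matrix_mul_assoc matrix_inv_inverse[OF inv])
  finally show ?thesis .
qed

lemma matrix_inv_mult:
  assumes "det (A :: 'a::field^'n^'n) \<noteq> 0"
  shows "A ** matrix_inv A = mat 1" "matrix_inv A ** A = mat 1"
  using assms by (auto simp: invertible_det_nz matrix_inv_inverse)

lemma matrix_inv_udiag:
  assumes "U \<in> unitary_group" "\<And>l. d l \<noteq> 0"
  shows "matrix_inv (udiag U d) = udiag U (\<lambda>l. 1 / d l)"
  by (rule matrix_inv_eqI) (use assms in \<open>simp add: udiag_mult udiag_const\<close>)

lemma udiag_unitary: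
  assumes "U \<in> unitary_group" "\<And>l. cmod (d l) = 1"
  shows "udiag U d \<in> unitary_group"
  by (rule unitaryI)
    (use assms in \<open>simp add: adjoint_udiag udiag_mult udiag_const complex_norm_square[symmetric]
      mult.commute[of "cnj _"]\<close>)

lemma udiag_hermitian: "udiag U (\<lambda>l. complex_of_real (d l)) \<in> hermitian_set"
  by (simp add: hermitian_set_def adjoint_udiag)

lemma inner_adjoint:
  fixes A :: "complex^'n^'n"
  shows "inner (A *v x) y = inner x (adjoint_matrix A *v y)"
proof -
  have "inner (A *v x) y = (\<Sum>i\<in>UNIV. \<Sum>j\<in>UNIV. inner (A$i$j * x$j) (y$i))"
    by (simp add: inner_vec_def matrix_vector_mult_def inner_sum_left)
  also have "\<dots> = (\<Sum>j\<in>UNIV. \<Sum>i\<in>UNIV. inner (A$i$j * x$j) (y$i))"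
    by (rule sum.swap)
  also have "\<dots> = inner x (adjoint_matrix A *v y)"
    unfolding inner_vec_def matrix_vector_mult_def vec_lambda_beta inner_sum_right adjoint_matrix_def
    by (intro sum.cong refl) (simp add: inner_complex_def algebra_simps)
  finally show ?thesis .
qed

lemma hermitian_inner:
  "H \<in> hermitian_set \<Longrightarrow> inner (H *v x) y = inner x (H *v y)"
  by (simp add: inner_adjoint hermitian_set_def)

lemma scaleR_vec_eq: "c *\<^sub>R (x :: complex^'n) = complex_of_real c *s x"
  unfolding vec_eq_iff vector_scaleR_component vector_smult_component
  by (simp add: scaleR_conv_of_real)

lemma matrix_vector_scaleR: "(A :: complex^'n^'n) *v (c *\<^sub>R x) = c *\<^sub>R (A *v x)"
  by (simp add: scaleR_vec_eq vec.scale)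

section \<open>The spectral theorem for Hermitian matrices\<close>

text \<open>A maximum of the quadratic form on the unit sphere of an invariant subspace is an eigenvector.  The inner
product is the real one, and \<open>V\<close> is only a real subspace.  At a maximum \<open>x\<close>, the gradient of the Rayleigh quotient is a multiple
of \<open>H x - \<mu> x\<close>; moving in this direction would increase the quotient, unless this vector is 0.\<close>

lemma hermitian_eigenvector:
  fixes H :: "complex^'n^'n" and V :: "(complex^'n) set"
  assumes H: "H \<in> hermitian_set" and V: "subspace V" "\<And>x. x \<in> V \<Longrightarrow> H *v x \<in> V"
    and nz: "\<exists>x\<in>V. x \<noteq> 0"
  obtains x \<mu> where "x \<in> V" "norm x = 1" "H *v x = \<mu> *\<^sub>R x"
proof -
  let ?S = "V \<inter> sphere 0 1"
  have comp: "compact ?S"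
    by (metis closed_subspace closed_Int_compact compact_sphere V(1))
  obtain y where y: "y \<in> V" "y \<noteq> 0" using nz by auto
  have "(1 / norm y) *\<^sub>R y \<in> ?S"
    using y V(1) by (auto simp: subspace_scale)
  then have ne: "?S \<noteq> {}" by blast
  have cont: "continuous_on ?S (\<lambda>x. inner (H *v x) x)"
    by (intro continuous_intros matrix_vector_mult_linear_continuous_on)
  obtain x where x: "x \<in> ?S" and mx: "\<And>y. y \<in> ?S \<Longrightarrow> inner (H *v y) y \<le> inner (H *v x) x"
    using continuous_attains_sup[OF comp ne cont] by blast
  define \<mu> where "\<mu> = inner (H *v x) x"
  have xV: "x \<in> V" and x1: "norm x = 1" using x by auto
  have bound: "inner (H *v y) y \<le> \<mu> * (inner y y)" if "y \<in> V" for y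
  proof (cases "y = 0")
    case False
    then have "(1 / norm y) *\<^sub>R y \<in> ?S"
      using that V(1) by (auto simp: subspace_scale)
    from mx[OF this] have "inner (H *v y) y / (norm y)^2 \<le> \<mu>"
      by (simp add: \<mu>_def matrix_vector_scaleR power2_eq_square)
    then show ?thesis using False
      by (simp add: power2_norm_eq_inner[symmetric] divide_simps)
  qed auto
  define r where "r = H *v x - \<mu> *\<^sub>R x"
  have rV: "r \<in> V" using V xV by (auto simp: r_def subspace_diff subspace_scale)
  have key: "2 * t * inner r r + t^2 * (inner (H *v r) r - \<mu> * inner r r) \<le> 0" for t
  proof -
    have "x + t *\<^sub>R r \<in> V" using V xV rV by (auto simp: subspace_add subspace_scale)
    from bound[OF this]
    have "inner (H *v x + t *\<^sub>R (H *v r)) (x + t *\<^sub>R r) \<le> \<mu> * inner (x + t *\<^sub>R r) (x + t *\<^sub>R r)"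
      by (simp add: vec.add matrix_vector_scaleR)
    moreover have "inner (H *v r) x = inner r (H *v x)"
      by (rule hermitian_inner[OF H])
    moreover have "inner (H *v x) x = \<mu> * inner x x"
      using x1 by (simp add: \<mu>_def norm_eq_1)
    ultimately have "t * (inner r (H *v x)) + t * inner r (H *v x) + t^2 * inner (H *v r) r
       \<le> 2 * t * \<mu> * inner r x + \<mu> * t^2 * inner r r"
      by (simp add: inner_add_left inner_add_right inner_commute power2_eq_square algebra_simps)
    moreover have "inner r r = inner r (H *v x) - \<mu> * inner r x"
      using inner_diff_right[of r "H *v x" "\<mu> *\<^sub>R x"] by (simp add: r_def[symmetric])
    then have "2 * t * inner r r = 2 * t * inner r (H *v x) - 2 * t * \<mu> * inner r x"
      by (metis (no_types) mult.assoc right_diff_distrib)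
    ultimately show ?thesis by (simp add: algebra_simps)
  qed
  have "inner r r = 0"
  proof (rule ccontr)
    assume "inner r r \<noteq> 0"
    then have p: "inner r r > 0" by (metis inner_ge_zero order_le_less)
    define q where "q = \<bar>inner (H *v r) r - \<mu> * inner r r\<bar>"
    \<comment> \<open>This \<open>t\<close> is so small that the term of \<open>key\<close> linear in \<open>t\<close> outweighs the quadratic one.\<close>
    define t where "t = inner r r / (q + 1)"
    have q: "q \<ge> 0" by (simp add: q_def)
    then have t: "t > 0" using p by (simp add: t_def)
    have tq: "t * q \<le> inner r r" using p q by (simp add: t_def field_simps)
    have "t^2 * (inner (H *v r) r - \<mu> * inner r r) \<ge> - (t * (t * q))"
      using mult_left_mono[of "- q" "inner (H *v r) r - \<mu> * inner r r" "t^2"]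
      by (simp add: q_def power2_eq_square algebra_simps)
    moreover have "t * (t * q) \<le> t * inner r r"
      using t tq by simp
    moreover have "t * inner r r > 0" using t p by simp
    ultimately show False using key[of t] by linarith
  qed
  then have "H *v x = \<mu> *\<^sub>R x" by (simp add: r_def)
  then show ?thesis using that xV x1 by blast
qed

text \<open>The eigenvectors are chosen one at a time in the orthogonal complement of the earlier ones.  The two real
equations \<open>inner b c = 0\<close> and \<open>inner b (\<i> *s c) = 0\<close> say that the Hermitian product of \<open>b\<close> and \<open>c\<close> is zero;
the complement is nonzero because \<open>k\<close> vectors impose \<open>2 k\<close> real conditions in a space of real dimension twice
the number of coordinates.\<close>

lemma hermitian_orthonormal_eigenvectors:
  fixes H :: "complex^'n^'n"
  assumes H: "H \<in> hermitian_set" and "k \<le> CARD('n)"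
  shows "\<exists>B. finite B \<and> card B = k \<and>
    (\<forall>b\<in>B. norm b = 1 \<and> (\<exists>\<mu>. H *v b = \<mu> *\<^sub>R b)) \<and>
    (\<forall>b\<in>B. \<forall>c\<in>B. b \<noteq> c \<longrightarrow> inner b c = 0 \<and> inner b (\<i> *s c) = 0)"
  using assms(2)
proof (induction k)
  case 0
  show ?case by (rule exI[of _ "{}"]) auto
next
  case (Suc k)
  then obtain B where B: "finite B" "card B = k"
    "\<And>b. b \<in> B \<Longrightarrow> norm b = 1" "\<And>b. b \<in> B \<Longrightarrow> \<exists>\<mu>. H *v b = \<mu> *\<^sub>R b"
    "\<And>b c. b \<in> B \<Longrightarrow> c \<in> B \<Longrightarrow> b \<noteq> c \<Longrightarrow> inner b c = 0 \<and> inner b (\<i> *s c) = 0"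
    by auto
  define V where "V = {x. \<forall>b\<in>B. inner x b = 0 \<and> inner x (\<i> *s b) = 0}"
  have "subspace V"
    by (auto simp: V_def subspace_def inner_add_left)
  moreover have "H *v x \<in> V" if "x \<in> V" for x
  proof -
    have "inner (H *v x) b = 0 \<and> inner (H *v x) (\<i> *s b) = 0" if b: "b \<in> B" for b
    proof -
      obtain \<mu> where \<mu>: "H *v b = \<mu> *\<^sub>R b" using B b by blast
      have "H *v (\<i> *s b) = \<mu> *\<^sub>R (\<i> *s b)"
        by (simp add: vec.scale \<mu> vec_eq_iff)
      then show ?thesis
        using \<open>x \<in> V\<close> b by (simp add: hermitian_inner[OF H] \<mu> V_def)
    qed
    then show ?thesis by (simp add: V_def)
  qed
  moreover have "\<exists>x\<in>V. x \<noteq> 0"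
  proof -
    let ?S = "B \<union> (\<lambda>b. \<i> *s b) ` B"
    have "dim ?S \<le> card ?S" using B(1) by (intro dim_le_card') auto
    also have "\<dots> \<le> card B + card B"
      using B(1) card_Un_le[of B "(\<lambda>b. \<i> *s b) ` B"] card_image_le[OF B(1), of "\<lambda>b. \<i> *s b"]
      by linarith
    also have "\<dots> < DIM(complex^'n)"
      using Suc.prems B(2) by simp
    finally obtain x where "x \<noteq> 0" "\<And>y. y \<in> span ?S \<Longrightarrow> orthogonal x y"
      using orthogonal_to_subspace_exists by blast
    then have "x \<in> V" by (auto simp: V_def orthogonal_def span_base)
    then show ?thesis using \<open>x \<noteq> 0\<close> by blast
  qed
  ultimately obtain x \<mu> where x: "x \<in> V" "norm x = 1" "H *v x = \<mu> *\<^sub>R x"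
    using hermitian_eigenvector[OF H] by metis
  have i1: "inner (\<i> *s a) (b :: complex^'n) = - inner a (\<i> *s b)" for a b
    by (simp add: inner_vec_def inner_complex_def sum_negf[symmetric] algebra_simps)
  have x0: "inner x b = 0" "inner x (\<i> *s b) = 0" "inner b x = 0" "inner b (\<i> *s x) = 0"
    if "b \<in> B" for b
    using x(1) that i1[of x b] i1[of b x] by (auto simp: V_def inner_commute)
  have "x \<notin> B" using x0(1)[of x] x(2) by auto
  then show ?case
    using B x x0 by (intro exI[of _ "insert x B"]) auto
qed

lemma hermitian_diagonalization:
  fixes H :: "complex^'n^'n"
  assumes H: "H \<in> hermitian_set"
  obtains U and d :: "'n \<Rightarrow> real" where "U \<in> unitary_group" "H = udiag U (\<lambda>l. complex_of_real (d l))"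
proof -
  obtain B where B: "finite B" "card B = CARD('n)"
    "\<And>b. b \<in> B \<Longrightarrow> norm b = 1" "\<And>b. b \<in> B \<Longrightarrow> \<exists>\<mu>. H *v b = \<mu> *\<^sub>R b"
    "\<And>b c. b \<in> B \<Longrightarrow> c \<in> B \<Longrightarrow> b \<noteq> c \<Longrightarrow> inner b c = 0 \<and> inner b (\<i> *s c) = 0"
    using hermitian_orthonormal_eigenvectors[OF H order_refl] by blast
  obtain f :: "'n \<Rightarrow> complex^'n" where f: "bij_betw f UNIV B"
    using finite_same_card_bij[of "UNIV :: 'n set" B] B by auto
  have fB: "f l \<in> B" for l using f by (auto simp: bij_betw_def)
  obtain d where d: "\<And>l. H *v f l = d l *\<^sub>R f l" using B(4)[OF fB] by metis
  define U where "U = (\<chi> i j. f j $ i)"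
  have h: "(\<Sum>k\<in>UNIV. x $ k * cnj (y $ k)) = Complex (inner x y) (inner x (\<i> *s y))" for x y :: "complex^'n"
    by (simp add: complex_eq_iff inner_vec_def inner_complex_def algebra_simps)
  have sq: "inner y (\<i> *s y) = 0" for y :: "complex^'n"
    by (simp add: inner_vec_def inner_complex_def algebra_simps)
  have orth: "(\<Sum>k\<in>UNIV. f j $ k * cnj (f i $ k)) = (if i = j then 1 else 0)" for i j
  proof (cases "i = j")
    case True
    then show ?thesis using B(3)[OF fB[of i]] by (simp add: h sq norm_eq_1 complex_eq_iff)
  next
    case False
    then have "f j \<noteq> f i" using f by (auto simp: bij_betw_def inj_on_def)
    then show ?thesis using B(5)[OF fB[of j] fB[of i]] False by (simp add: h complex_eq_iff)
  qed
  have U: "U \<in> unitary_group"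
    by (rule unitaryI)
      (simp add: U_def vec_eq_iff adjoint_matrix_def matrix_matrix_mult_def mat_def orth mult.commute[of "cnj _"])
  have "H ** U = U ** diag_matrix (\<lambda>l. complex_of_real (d l))"
  proof -
    have "(\<Sum>k\<in>UNIV. H $ i $ k * f j $ k) = f j $ i * complex_of_real (d j)" for i j
      using d[of j] by (simp add: scaleR_vec_eq vec_eq_iff matrix_vector_mult_def mult.commute)
    then show ?thesis
      by (simp add: U_def vec_eq_iff matrix_matrix_mult_def diag_matrix_def if_mult cong: if_cong)
  qed
  then have "udiag U (\<lambda>l. complex_of_real (d l)) = H ** (U ** adjoint_matrix U)"
    by (simp add: udiag_def matrix_mul_assoc)
  also have "\<dots> = H" by (simp add: unitary_adjoint[OF U])
  finally show ?thesis using that U by blast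
qed


section \<open>Continuity of the matrix operations\<close>

lemma continuous_on_matrix_mult [continuous_intros]:
  fixes f g :: "'a::topological_space \<Rightarrow> complex^'n^'n"
  assumes "continuous_on S f" "continuous_on S g"
  shows "continuous_on S (\<lambda>x. f x ** g x)"
  unfolding matrix_matrix_mult_def
  by (intro continuous_on_vec_lambda continuous_intros assms)

lemma continuous_on_adjoint [continuous_intros]:
  fixes f :: "'a::topological_space \<Rightarrow> complex^'n^'n"
  assumes "continuous_on S f"
  shows "continuous_on S (\<lambda>x. adjoint_matrix (f x))"
  unfolding adjoint_matrix_def
  by (intro continuous_on_vec_lambda continuous_intros assms)

lemma continuous_on_det [continuous_intros]:
  fixes f :: "'a::topological_space \<Rightarrow> complex^'n^'n"
  assumes "continuous_on S f"
  shows "continuous_on S (\<lambda>x. det (f x))"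
  unfolding det_def by (intro continuous_intros assms)

lemma continuous_on_mat [continuous_intros]:
  fixes f :: "'a::topological_space \<Rightarrow> complex"
  assumes "continuous_on S f"
  shows "continuous_on S (\<lambda>x. mat (f x) :: complex^'n^'n)"
  unfolding mat_def
proof (intro continuous_on_vec_lambda)
  fix i j :: 'n
  show "continuous_on S (\<lambda>x. if i = j then f x else 0)"
    using assms by (cases "i = j") auto
qed

lemma continuous_on_diag_matrix [continuous_intros]:
  fixes f :: "'a::topological_space \<Rightarrow> 'n::finite \<Rightarrow> complex"
  assumes "\<And>l. continuous_on S (\<lambda>x. f x l)"
  shows "continuous_on S (\<lambda>x. diag_matrix (f x))"
  unfolding diag_matrix_def
proof (intro continuous_on_vec_lambda)
  fix i j :: 'n
  show "continuous_on S (\<lambda>x. if i = j then f x i else 0)"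
    using assms by (cases "i = j") auto
qed

lemma continuous_on_udiag [continuous_intros]:
  fixes U :: "'a::topological_space \<Rightarrow> complex^'n^'n"
  assumes "continuous_on S U" "\<And>l. continuous_on S (\<lambda>x. d x l)"
  shows "continuous_on S (\<lambda>x. udiag (U x) (d x))"
  unfolding udiag_def by (intro continuous_intros assms)

text \<open>Cramer's rule writes the inverse as a quotient of polynomials in the entries, which is where the continuity
of the inverse comes from.\<close>

lemma matrix_inv_cramer:
  fixes A :: "complex^'n^'n"
  assumes "det A \<noteq> 0"
  shows "matrix_inv A = (\<chi> i j. det (\<chi> a b. if b = i then axis j 1 $ a else A $ a $ b) / det A)"
proof -
  have "matrix_inv A *v axis j 1 = (\<chi> i. det (\<chi> a b. if b = i then axis j 1 $ a else A $ a $ b) / det A)" for j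
  proof -
    have "A *v (matrix_inv A *v axis j 1) = axis j 1"
      by (simp add: matrix_vector_mul_assoc matrix_inv_mult[OF assms])
    then show ?thesis using cramer[OF assms] by blast
  qed
  moreover have "(matrix_inv A *v axis j 1) $ i = matrix_inv A $ i $ j" for i j
    by (simp add: matrix_vector_mult_def axis_def if_mult cong: if_cong)
  ultimately show ?thesis by (simp add: vec_eq_iff)
qed

lemma continuous_on_matrix_inv [continuous_intros]:
  fixes f :: "'a::topological_space \<Rightarrow> complex^'n^'n"
  assumes "continuous_on S f" "\<And>x. x \<in> S \<Longrightarrow> det (f x) \<noteq> 0"
  shows "continuous_on S (\<lambda>x. matrix_inv (f x))"
proof -
  have c: "continuous_on S (\<lambda>x. if b = i then axis j 1 $ a else f x $ a $ b)" for a b i j :: 'n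
    by (cases "b = i") (auto intro!: continuous_intros assms)
  have "continuous_on S (\<lambda>x. \<chi> i j. det (\<chi> a b. if b = i then axis j 1 $ a else f x $ a $ b) / det (f x))"
    by (intro continuous_on_vec_lambda continuous_intros assms c) (use assms in auto)
  then show ?thesis
    by (rule continuous_on_eq) (simp add: matrix_inv_cramer assms)
qed

text \<open>On scalars this is the map \<open>x \<mapsto> (x + \<i>) / (x - \<i>)\<close> from the real line onto the unit circle without 1,
written as \<open>1 + 2 \<i> / (x - \<i>)\<close> so that only one resolvent occurs.\<close>

definition cayley :: "complex^'n^'n \<Rightarrow> complex^'n^'n" where
  "cayley H = mat 1 + mat (2 * \<i>) ** matrix_inv (H - mat \<i>)"

definition cayley_inv :: "complex^'n^'n \<Rightarrow> complex^'n^'n" where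
  "cayley_inv A = mat \<i> + mat (2 * \<i>) ** matrix_inv (A - mat 1)"

section \<open>The Cayley transform between Hermitian matrices and the set E\<close>

lemma det_mat_nonzero: "c \<noteq> 0 \<Longrightarrow> det (mat c :: complex^'n^'n) \<noteq> 0"
  by (simp add: diag_matrix_const[symmetric] det_diag_matrix)

lemma mat_mult_mat_left: "mat a ** (mat b ** A) = mat (a * b) ** (A :: 'a::comm_semiring_1^'n^'n)"
  by (simp add: matrix_mul_assoc mat_mult_mat)

lemma mat_mult_mat_mult:
  fixes A B :: "'a::comm_semiring_1^'n^'n"
  shows "(mat a ** A) ** (mat b ** B) = mat (a * b) ** (A ** B)"
proof -
  have "(mat a ** A) ** (mat b ** B) = mat b ** (mat a ** A ** B)"
    by (rule mat_mult_left_commute)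
  also have "\<dots> = mat (b * a) ** (A ** B)"
    by (simp only: matrix_mul_assoc mat_mult_mat)
  finally show ?thesis by (simp only: mult.commute)
qed

lemma real_minus_i_nonzero: "complex_of_real x - \<i> \<noteq> 0"
  by (simp add: complex_eq_iff)

lemma hermitian_minus_i:
  assumes "H \<in> hermitian_set" shows "det (H - mat \<i>) \<noteq> 0"
proof -
  obtain U d where U: "U \<in> unitary_group" and H: "H = udiag U (\<lambda>l. complex_of_real (d l))"
    using hermitian_diagonalization[OF assms] by blast
  have "H - mat \<i> = udiag U (\<lambda>l. complex_of_real (d l) - \<i>)"
    by (simp add: H udiag_diff udiag_const[OF U, symmetric])
  then show ?thesis using real_minus_i_nonzero by (simp add: det_udiag[OF U])
qed

lemma cayley_udiag:
  assumes U: "U \<in> unitary_group"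
  shows "cayley (udiag U (\<lambda>l. complex_of_real (d l))) =
    udiag U (\<lambda>l. (complex_of_real (d l) + \<i>) / (complex_of_real (d l) - \<i>))"
proof -
  have e: "1 + 2 * \<i> * (1 / (complex_of_real x - \<i>)) = (complex_of_real x + \<i>) / (complex_of_real x - \<i>)" for x
    using real_minus_i_nonzero[of x] by (simp add: field_simps)
  have "matrix_inv (udiag U (\<lambda>l. complex_of_real (d l)) - mat \<i>)
      = udiag U (\<lambda>l. 1 / (complex_of_real (d l) - \<i>))"
    unfolding udiag_const[OF U, symmetric] udiag_diff
    by (rule matrix_inv_udiag[OF U real_minus_i_nonzero])
  then show ?thesis
    by (simp add: cayley_def udiag_scale[OF U] udiag_const[OF U, symmetric, of 1] udiag_add e del: times_divide_eq_right)
qed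

lemma cayley_in_E:
  assumes "H \<in> hermitian_set" shows "cayley H \<in> E_set"
proof -
  obtain U d where U: "U \<in> unitary_group" and H: "H = udiag U (\<lambda>l. complex_of_real (d l))"
    using hermitian_diagonalization[OF assms] by blast
  let ?z = "\<lambda>l. (complex_of_real (d l) + \<i>) / (complex_of_real (d l) - \<i>)"
  have n: "cmod (?z l) = 1" for l
    using real_minus_i_nonzero[of "d l"] by (simp add: norm_divide) (simp add: cmod_def)
  have z: "?z l - 1 \<noteq> 0" for l
    using real_minus_i_nonzero[of "d l"] by (simp add: field_simps)
  have "cayley H - mat 1 = udiag U (\<lambda>l. ?z l - 1)"
    by (simp add: H cayley_udiag[OF U] udiag_const[OF U, symmetric, of 1] udiag_diff)
  then have "det (cayley H - mat 1) \<noteq> 0"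
    using z by (simp add: det_udiag[OF U])
  moreover have "cayley H \<in> unitary_group"
    using n by (simp add: H cayley_udiag[OF U] udiag_unitary[OF U])
  ultimately show ?thesis by (simp add: E_set_def)
qed

lemma E_set_unitary: "A \<in> E_set \<Longrightarrow> A \<in> unitary_group"
  by (simp add: E_set_def)

lemma E_set_det: "A \<in> E_set \<Longrightarrow> det (A - mat 1) \<noteq> 0"
  by (simp add: E_set_def)

lemma adjoint_matrix_inv:
  assumes "det A \<noteq> 0"
  shows "adjoint_matrix (matrix_inv A) = matrix_inv (adjoint_matrix A)"
proof (rule matrix_inv_eqI[symmetric])
  show "adjoint_matrix A ** adjoint_matrix (matrix_inv A) = mat 1"
    by (simp add: adjoint_mult[symmetric] matrix_inv_mult[OF assms])
qed

text \<open>For unitary \<open>A\<close> the adjoint is the inverse, and this turns the adjoint of the resolvent \<open>R\<close> of \<open>A\<close> at 1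
into \<open>- (1 + R)\<close>.\<close>

lemma cayley_inv_hermitian:
  assumes A: "A \<in> E_set" shows "cayley_inv A \<in> hermitian_set"
proof -
  let ?R = "matrix_inv (A - mat 1)" and ?B = "adjoint_matrix A"
  note d = E_set_det[OF A] and U = unitary_adjoint[OF E_set_unitary[OF A]]
  note R = matrix_inv_mult[OF d]
  have AR: "A ** ?R = mat 1 + ?R"
    using R(1) by (simp add: matrix_diff_rdistrib algebra_simps)
  have "(?B - mat 1) ** (mat 1 + ?R) = mat (- 1)"
  proof -
    have "(?B - mat 1) ** (A ** ?R) = (?B ** A) ** ?R - A ** ?R"
      by (simp add: matrix_diff_rdistrib matrix_mul_assoc)
    also have "\<dots> = ?R - (mat 1 + ?R)"
      by (simp add: U AR)
    also have "\<dots> = mat (- 1)" by (simp add: vec_eq_iff mat_def)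
    finally show ?thesis by (simp add: AR)
  qed
  then have "(?B - mat 1) ** (mat (- 1) ** (mat 1 + ?R)) = mat (- 1) ** mat (- 1)"
    by (simp add: mat_mult_left_commute)
  then have "(?B - mat 1) ** (mat (- 1) ** (mat 1 + ?R)) = mat 1"
    by (simp add: mat_mult_mat)
  from matrix_inv_eqI[OF this]
  have "adjoint_matrix ?R = mat (- 1) ** (mat 1 + ?R)"
    by (simp add: adjoint_matrix_inv[OF d] adjoint_diff)
  then show ?thesis
    by (simp add: hermitian_set_def cayley_inv_def adjoint_add adjoint_mult mat_mult_commute[symmetric])
      (simp add: vec_eq_iff mat_mult_nth algebra_simps, simp add: mat_def)
qed

lemma cayley_inv_cayley:
  assumes "H \<in> hermitian_set" shows "cayley_inv (cayley H) = H"
proof -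
  have "(cayley H - mat 1) ** (mat (1 / (2 * \<i>)) ** (H - mat \<i>)) =
      mat (2 * \<i>) ** mat (1 / (2 * \<i>)) ** (matrix_inv (H - mat \<i>) ** (H - mat \<i>))"
    by (simp only: cayley_def add_diff_cancel_left' mat_mult_mat_mult mat_mult_mat)
  also have "\<dots> = mat 1"
    by (simp add: matrix_inv_mult[OF hermitian_minus_i[OF assms]] mat_mult_mat)
  finally have "matrix_inv (cayley H - mat 1) = mat (1 / (2 * \<i>)) ** (H - mat \<i>)"
    by (rule matrix_inv_eqI)
  then show ?thesis by (simp add: cayley_inv_def matrix_mul_assoc mat_mult_mat)
qed

lemma cayley_cayley_inv:
  assumes "A \<in> E_set" shows "cayley (cayley_inv A) = A"
proof -
  have "(cayley_inv A - mat \<i>) ** (mat (1 / (2 * \<i>)) ** (A - mat 1)) =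
      mat (2 * \<i>) ** mat (1 / (2 * \<i>)) ** (matrix_inv (A - mat 1) ** (A - mat 1))"
    by (simp only: cayley_inv_def add_diff_cancel_left' mat_mult_mat_mult mat_mult_mat)
  also have "\<dots> = mat 1"
    by (simp add: matrix_inv_mult[OF E_set_det[OF assms]] mat_mult_mat)
  finally have "matrix_inv (cayley_inv A - mat \<i>) = mat (1 / (2 * \<i>)) ** (A - mat 1)"
    by (rule matrix_inv_eqI)
  then show ?thesis by (simp add: cayley_def matrix_mul_assoc mat_mult_mat)
qed

lemma E_set_diagonalization:
  fixes A :: "complex^'n^'n"
  assumes "A \<in> E_set"
  obtains U and d :: "'n \<Rightarrow> real" where "U \<in> unitary_group"
    "cayley_inv A = udiag U (\<lambda>l. complex_of_real (d l))"
    "A = udiag U (\<lambda>l. (complex_of_real (d l) + \<i>) / (complex_of_real (d l) - \<i>))"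
  using hermitian_diagonalization[OF cayley_inv_hermitian[OF assms]] cayley_udiag cayley_cayley_inv[OF assms]
  by metis

lemma continuous_on_cayley [continuous_intros]:
  assumes "continuous_on S f" "\<And>x. x \<in> S \<Longrightarrow> f x \<in> hermitian_set"
  shows "continuous_on S (\<lambda>x. cayley (f x))"
  unfolding cayley_def using assms hermitian_minus_i by (intro continuous_intros) auto

lemma continuous_on_cayley_inv [continuous_intros]:
  assumes "continuous_on S f" "\<And>x. x \<in> S \<Longrightarrow> f x \<in> E_set"
  shows "continuous_on S (\<lambda>x. cayley_inv (f x))"
  unfolding cayley_inv_def using assms E_set_det by (intro continuous_intros) auto

text \<open>With \<open>X\<close> and \<open>Y\<close> the inverses of \<open>H\<close> and \<open>K\<close>, both sides expand to \<open>c X + c Y + c\<^sup>2 X Y\<close>, because \<open>X (H + K) Y = Y + X\<close>.\<close>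

lemma resolvent_product:
  fixes H K X Y :: "complex^'n^'n"
  assumes "X ** H = mat 1" "K ** Y = mat 1"
  shows "(mat 1 + mat c ** X) ** (mat 1 + mat c ** Y) - mat 1 = mat c ** (X ** (H + K + mat c) ** Y)"
proof -
  have "X ** (H + K + mat c) ** Y = (X ** H) ** Y + X ** (K ** Y) + X ** mat c ** Y"
    by (simp only: matrix_add_ldistrib matrix_add_rdistrib matrix_mul_assoc)
  also have "\<dots> = Y + X + mat c ** (X ** Y)"
    by (simp only: assms matrix_mul_lid matrix_mul_rid mat_mult_commute[of c X] matrix_mul_assoc)
  finally have e: "X ** (H + K + mat c) ** Y = Y + X + mat c ** (X ** Y)" .
  have "(mat 1 + mat c ** X) ** (mat 1 + mat c ** Y) - mat 1 = mat c ** (Y + X + mat c ** (X ** Y))"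
    by (simp add: matrix_add_ldistrib matrix_add_rdistrib mat_mult_mat_mult mat_mult_mat_left)
  then show ?thesis by (simp only: e)
qed

text \<open>This makes the space of pairs linear: in Cayley coordinates the condition on the product depends on the sum of
the two Hermitian matrices only, by the factorization \<open>A B - 1 = 2 \<i> X (H + K) Y\<close> with invertible \<open>X\<close> and \<open>Y\<close>.\<close>

lemma product_in_E_iff:
  assumes A: "A \<in> E_set" and B: "B \<in> E_set"
  shows "A ** B \<in> E_set \<longleftrightarrow> det (cayley_inv A + cayley_inv B) \<noteq> 0"
proof -
  let ?H = "cayley_inv A - mat \<i>" and ?K = "cayley_inv B - mat \<i>"
  let ?X = "matrix_inv ?H" and ?Y = "matrix_inv ?K"
  note dH = hermitian_minus_i[OF cayley_inv_hermitian[OF A]] and dK = hermitian_minus_i[OF cayley_inv_hermitian[OF B]]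
  have AX: "mat 1 + mat (2 * \<i>) ** ?X = A"
    using cayley_cayley_inv[OF A] by (simp add: cayley_def)
  have BY: "mat 1 + mat (2 * \<i>) ** ?Y = B"
    using cayley_cayley_inv[OF B] by (simp add: cayley_def)
  have S: "?H + ?K + mat (2 * \<i>) = cayley_inv A + cayley_inv B"
    by (simp add: vec_eq_iff mat_def)
  have e: "A ** B - mat 1 = mat (2 * \<i>) ** (?X ** (cayley_inv A + cayley_inv B) ** ?Y)"
    using resolvent_product[OF matrix_inv_mult(2)[OF dH] matrix_inv_mult(1)[OF dK], of "2 * \<i>"]
    by (simp only: AX BY S)
  have dXY: "det ?X \<noteq> 0" "det ?Y \<noteq> 0"
    using det_mul[of ?X ?H] det_mul[of ?Y ?K] by (auto simp: matrix_inv_mult[OF dH] matrix_inv_mult[OF dK])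
  have "det (A ** B - mat 1) \<noteq> 0 \<longleftrightarrow> det (cayley_inv A + cayley_inv B) \<noteq> 0"
    using dXY by (simp add: e det_mul det_mat_nonzero)
  then show ?thesis
    using unitary_mult[OF E_set_unitary[OF A] E_set_unitary[OF B]] by (simp add: E_set_def)
qed

section \<open>The function rho as a sum of arctangents, and its continuity\<close>

lemma pconst_sum: "[:sum f A:] = (\<Sum>x\<in>A. [:f x:])"
  by (rule poly_eqI) (simp add: coeff_sum coeff_pCons split: nat.split)

lemma map_const_mult:
  "map_matrix (\<lambda>a. [:a:]) (A ** B :: complex^'n^'n) = map_matrix (\<lambda>a. [:a:]) A ** map_matrix (\<lambda>a. [:a:]) B"
  by (simp add: vec_eq_iff map_matrix_def matrix_matrix_mult_def pconst_sum mult.commute)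

text \<open>Entrywise embedding of scalars as constant polynomials is a ring homomorphism on matrices, so unitary
conjugation can be carried out over the polynomial ring.\<close>

lemma charpoly_udiag:
  assumes U: "U \<in> unitary_group"
  shows "charpoly (udiag U z) = (\<Prod>l\<in>UNIV. [:- z l, 1:])"
proof -
  let ?C = "map_matrix (\<lambda>a. [:a:]) :: complex^'n^'n \<Rightarrow> complex poly^'n^'n"
  have C1: "?C (mat 1) = mat 1"
    by (simp add: vec_eq_iff map_matrix_def mat_def one_pCons)
  have inv: "?C U ** ?C (adjoint_matrix U) = mat 1"
    by (simp add: map_const_mult[symmetric] unitary_adjoint[OF U] C1)
  have "mat [:0, 1:] - ?C (udiag U z) = mat [:0, 1:] ** (?C U ** ?C (adjoint_matrix U)) - ?C (udiag U z)"
    by (simp add: inv)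
  also have "\<dots> = ?C U ** (mat [:0, 1:] - ?C (diag_matrix z)) ** ?C (adjoint_matrix U)"
    by (simp only: udiag_def map_const_mult matrix_diff_ldistrib matrix_diff_rdistrib matrix_mul_assoc
        mat_mult_commute[of "[:0, 1:]" "?C U"])
  finally have "charpoly (udiag U z) = det (?C U) * det (?C (adjoint_matrix U)) * det (mat [:0, 1:] - ?C (diag_matrix z))"
    by (simp add: charpoly_def det_mul)
  also have "det (?C U) * det (?C (adjoint_matrix U)) = 1"
    using inv det_mul[of "?C U" "?C (adjoint_matrix U)"] by simp
  also have "det (mat [:0, 1:] - ?C (diag_matrix z)) = (\<Prod>l\<in>UNIV. [:- z l, 1:])"
    by (subst det_diagonal) (auto simp: diag_matrix_def map_matrix_def mat_def)
  finally show ?thesis by simp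
qed

lemma rho_udiag:
  assumes U: "U \<in> unitary_group"
  shows "rho (udiag U z :: complex^'n^'n) = real CARD('n) - 1 / pi * (\<Sum>l\<in>UNIV. Arg2pi (z l))"
proof -
  have "proots (charpoly (udiag U z)) = (\<Sum>l\<in>UNIV. {#z l#})"
    by (simp add: charpoly_udiag[OF U] proots_prod)
  moreover have "(\<Sum>w\<in>#(\<Sum>l\<in>B. {#z l#}). Arg2pi w) = (\<Sum>l\<in>B. Arg2pi (z l))" for B :: "'n set"
    by (induction B rule: infinite_finite_induct) auto
  ultimately show ?thesis by (simp add: rho_def)
qed

text \<open>If \<open>x = cot (\<theta> / 2)\<close>, then the Cayley transform of \<open>x\<close> is \<open>cis \<theta>\<close>.\<close>

lemma Arg2pi_cayley:
  "Arg2pi ((complex_of_real x + \<i>) / (complex_of_real x - \<i>)) = pi - 2 * arctan x"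
proof (rule Arg2pi_unique[of 1])
  have s: "1 + x^2 > 0" by (simp add: add_pos_nonneg)
  have c: "cos (pi - 2 * arctan x) = (x^2 - 1) / (1 + x^2)"
    using s by (simp add: cos_diff cos_double) (simp add: cos_arctan sin_arctan power_divide diff_divide_distrib)
  have sn: "sin (pi - 2 * arctan x) = 2 * x / (1 + x^2)"
    using s by (simp add: sin_diff sin_double) (simp add: cos_arctan sin_arctan field_simps)
  have "Complex ((x^2 - 1) / (1 + x^2)) (2 * x / (1 + x^2)) * (complex_of_real x - \<i>) = complex_of_real x + \<i>"
  proof -
    define s where "s = 1 + x^2"
    have "s \<noteq> 0" "x^2 = s - 1" using s by (simp_all add: s_def)
    then have "(x^2 - 1) / s * x + 2 * x / s = x" "2 * x / s * x - (x^2 - 1) / s = 1"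
      by (auto simp: field_simps power2_eq_square[symmetric])
    then show ?thesis by (simp add: complex_eq_iff s_def)
  qed
  then have "cis (pi - 2 * arctan x) * (complex_of_real x - \<i>) = complex_of_real x + \<i>"
    by (simp only: cis.ctr c sn)
  then show "complex_of_real 1 * exp (\<i> * complex_of_real (pi - 2 * arctan x))
      = (complex_of_real x + \<i>) / (complex_of_real x - \<i>)"
    using real_minus_i_nonzero[of x] by (simp add: cis_conv_exp field_simps)
  show "0 \<le> pi - 2 * arctan x" "pi - 2 * arctan x < 2 * pi"
    using arctan_bounded[of x] by auto
qed auto

lemma rho_cayley_udiag:
  assumes U: "U \<in> unitary_group"
  shows "rho (cayley (udiag U (\<lambda>l. complex_of_real (d l))) :: complex^'n^'n) = 2 / pi * (\<Sum>l\<in>UNIV. arctan (d l))"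
  by (simp add: cayley_udiag[OF U] rho_udiag[OF U] Arg2pi_cayley sum_subtractf sum_distrib_left[symmetric])
    (simp add: field_simps)

lemma one_plus_i_polar:
  "1 + \<i> * complex_of_real x = complex_of_real (sqrt (1 + x^2)) * cis (arctan x)"
proof -
  have "1 + x^2 > 0" by (simp add: add_pos_nonneg)
  then show ?thesis by (simp add: complex_eq_iff cos_arctan sin_arctan)
qed

lemma prod_cis: "(\<Prod>l\<in>A. cis (f l)) = cis (\<Sum>l\<in>A. f l)"
  by (induction A rule: infinite_finite_induct) (auto simp: cis_mult)

lemma hermitian_subspace: "subspace hermitian_set"
  by (auto simp: subspace_def hermitian_set_def adjoint_add adjoint_scaleR) (simp add: adjoint_matrix_def vec_eq_iff)

lemma udiag_scaleR:
  assumes "U \<in> unitary_group"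
  shows "t *\<^sub>R udiag U (\<lambda>l. complex_of_real (d l)) = udiag U (\<lambda>l. complex_of_real (t * d l))"
  by (simp add: scaleR_eq_mat udiag_scale[OF assms])

text \<open>The form in which discreteness is used for all lifting arguments below: the values lie in the multiples of \<open>c\<close>.\<close>

lemma continuous_on_int_valued_constant:
  fixes h :: "real \<Rightarrow> real"
  assumes "connected S" "continuous_on S h" "\<And>x. x \<in> S \<Longrightarrow> h x / c \<in> \<int>" "c > 0" "a \<in> S" "b \<in> S"
  shows "h a = h b"
proof -
  have "h constant_on S"
  proof (rule continuous_discrete_range_constant[OF assms(1,2)])
    fix x assume x: "x \<in> S"
    have "c \<le> norm (h y - h x)" if y: "y \<in> S" and ne: "h y \<noteq> h x" for y
    proof -
      obtain i j where "h x / c = of_int i" "h y / c = of_int j"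
        using assms(3) x y by (meson Ints_cases)
      then have e: "h x = of_int i * c" "h y = of_int j * c"
        using assms(4) by (auto simp: field_simps)
      then have "i \<noteq> j" using ne by auto
      then have "1 \<le> \<bar>real_of_int (j - i)\<bar>" by linarith
      then have "1 * c \<le> \<bar>real_of_int (j - i)\<bar> * c"
        using assms(4) by (intro mult_right_mono) auto
      also have "\<dots> = norm (h y - h x)"
        using assms(4) by (simp add: e left_diff_distrib[symmetric] abs_mult)
      finally show ?thesis by simp
    qed
    then show "\<exists>e>0. \<forall>y. y \<in> S \<and> h y \<noteq> h x \<longrightarrow> e \<le> norm (h y - h x)"
      using assms(4) by blast
  qed
  then show ?thesis using assms(5,6) by (auto simp: constant_on_def)
qed

text \<open>Eigenvalues are not followed individually.  The determinant of \<open>1 + \<i> H\<close> has no zero on the contractible space of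
Hermitian matrices and therefore has a continuous logarithm \<open>g\<close>.  Along the ray \<open>t H\<close> both the imaginary part of \<open>g\<close>
and the sum of the arctangents of \<open>t\<close> times the eigenvalues are continuous arguments of this determinant, so they differ by a constant.\<close>

lemma rho_cayley_continuous: "continuous_on hermitian_set (\<lambda>H :: complex^'n^'n. rho (cayley H))"
proof -
  let ?f = "\<lambda>H :: complex^'n^'n. det (mat 1 + mat \<i> ** H)"
  have fU: "?f (udiag U (\<lambda>l. complex_of_real (d l))) =
      complex_of_real (\<Prod>l\<in>UNIV. sqrt (1 + (d l)^2)) * cis (\<Sum>l\<in>UNIV. arctan (d l))"
    if U: "U \<in> unitary_group" for U and d :: "'n \<Rightarrow> real"
    by (simp add: udiag_const[OF U, symmetric, of 1] udiag_scale[OF U] udiag_add det_udiag[OF U]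
      one_plus_i_polar prod.distrib prod_cis)
  have pos: "(\<Prod>l\<in>UNIV. sqrt (1 + (d l)^2)) > 0" for d :: "'n \<Rightarrow> real"
    by (intro prod_pos) (simp add: add_pos_nonneg)
  have nz: "?f H \<noteq> 0" if H: "H \<in> hermitian_set" for H
  proof -
    obtain U d where U: "U \<in> unitary_group" and H: "H = udiag U (\<lambda>l. complex_of_real (d l))"
      using hermitian_diagonalization[OF H] by blast
    have "complex_of_real (\<Prod>l\<in>UNIV. sqrt (1 + (d l)^2)) \<noteq> 0"
      unfolding of_real_eq_0_iff using pos[of d] by linarith
    then show ?thesis unfolding H fU[OF U] mult_eq_0_iff by (simp only: cis_neq_zero simp_thms)
  qed
  have contr: "contractible (hermitian_set :: (complex^'n^'n) set)"
    by (intro convex_imp_contractible subspace_imp_convex hermitian_subspace)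
  have cont: "continuous_on hermitian_set ?f"
    by (intro continuous_intros)
  obtain g where g: "continuous_on hermitian_set g"
    and gf: "\<And>H. H \<in> hermitian_set \<Longrightarrow> ?f H = exp (g H)"
    using continuous_logarithm_on_contractible[OF cont contr nz] by blast
  have "rho (cayley H) = 2 / pi * (Im (g H) - Im (g 0))" if H: "H \<in> hermitian_set" for H
  proof -
    obtain U d where U: "U \<in> unitary_group" and HU: "H = udiag U (\<lambda>l. complex_of_real (d l))"
      using hermitian_diagonalization[OF H] by blast
    define h where "h t = Im (g (t *\<^sub>R H)) - (\<Sum>l\<in>UNIV. arctan (t * d l))" for t
    have tH: "t *\<^sub>R H \<in> hermitian_set" for t
      by (rule subspace_scale[OF hermitian_subspace H])
    have "continuous_on {0..1} (\<lambda>t. g (t *\<^sub>R H))"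
      by (rule continuous_on_compose2[OF g]) (auto intro!: continuous_intros tH)
    then have "continuous_on {0..1} h"
      unfolding h_def by (intro continuous_intros)
    moreover have "h t / (2 * pi) \<in> \<int>" for t
    proof -
      let ?r = "\<Prod>l\<in>UNIV. sqrt (1 + (t * d l)^2)" and ?a = "\<Sum>l\<in>UNIV. arctan (t * d l)"
      have e: "exp (g (t *\<^sub>R H)) = complex_of_real ?r * cis ?a"
        using gf[OF tH, of t] fU[OF U, of "\<lambda>l. t * d l"] by (simp add: HU udiag_scaleR[OF U])
      have p: "?r > 0" by (rule pos)
      have n: "exp (Re (g (t *\<^sub>R H))) = ?r"
        using arg_cong[OF e, of norm] p by (simp only: norm_mult norm_cis norm_of_real norm_exp_eq_Re abs_of_pos mult_1_right)
      have "complex_of_real (exp (Re (g (t *\<^sub>R H)))) * cis (Im (g (t *\<^sub>R H))) = complex_of_real ?r * cis ?a"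
        using e by (simp add: exp_eq_polar)
      then have "complex_of_real ?r * cis (Im (g (t *\<^sub>R H))) = complex_of_real ?r * cis ?a"
        by (simp only: n)
      moreover have "complex_of_real ?r \<noteq> 0"
        unfolding of_real_eq_0_iff using p by linarith
      ultimately have "cis (Im (g (t *\<^sub>R H))) = cis ?a"
        using mult_left_cancel by blast
      then have "cis (h t) = 1"
        by (simp add: h_def cis_divide[symmetric])
      then have "cos (h t) = 1" by (simp add: complex_eq_iff)
      then obtain i :: int where "h t = of_int i * 2 * pi" by (auto simp: cos_one_2pi_int)
      then show ?thesis by simp
    qed
    ultimately have "h 0 = h 1"
      using continuous_on_int_valued_constant[of "{0..1}" h "2 * pi" 0 1] by auto
    then have "Im (g H) - Im (g 0) = (\<Sum>l\<in>UNIV. arctan (d l))"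
      by (simp add: h_def)
    then show ?thesis by (simp add: HU rho_cayley_udiag[OF U])
  qed
  moreover have "continuous_on hermitian_set (\<lambda>H. 2 / pi * (Im (g H) - Im (g 0)))"
    by (intro continuous_intros g)
  ultimately show ?thesis by (simp cong: continuous_on_cong)
qed

lemma rho_continuous: "continuous_on E_set (rho :: complex^'n^'n \<Rightarrow> real)"
proof -
  have "continuous_on E_set (\<lambda>A :: complex^'n^'n. rho (cayley (cayley_inv A)))"
    by (rule continuous_on_compose2[OF rho_cayley_continuous])
      (auto intro!: continuous_intros cayley_inv_hermitian)
  then show ?thesis by (simp add: cayley_cayley_inv cong: continuous_on_cong)
qed

text \<open>The determinant is \<open>cis\<close> of the sum of the angles, so \<open>rho\<close> is determined by it modulo 2.\<close>

lemma cis_rho: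
  assumes "A \<in> E_set"
  shows "cis (pi * rho A) * det (A :: complex^'n^'n) = cis (pi * real CARD('n))"
proof -
  obtain U d where U: "U \<in> unitary_group"
    and A: "A = udiag U (\<lambda>l. (complex_of_real (d l) + \<i>) / (complex_of_real (d l) - \<i>))"
    using E_set_diagonalization[OF assms] by metis
  let ?z = "\<lambda>l. (complex_of_real (d l) + \<i>) / (complex_of_real (d l) - \<i>)"
  have n: "?z l \<noteq> 0" "cmod (?z l) = 1" for l
    using real_minus_i_nonzero[of "d l"] by (simp_all add: norm_divide) (simp_all add: cmod_def complex_eq_iff)
  have "?z l = cis (Arg2pi (?z l))" for l
    using Arg2pi_eq[of "?z l"] by (simp only: n cis_conv_exp) simp
  then have "det A = (\<Prod>l\<in>UNIV. cis (Arg2pi (?z l)))"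
    by (simp only: A det_udiag[OF U])
  then have "det A = cis (\<Sum>l\<in>UNIV. Arg2pi (?z l))"
    by (simp only: prod_cis)
  moreover have "pi * rho A = pi * real CARD('n) - (\<Sum>l\<in>UNIV. Arg2pi (?z l))"
    by (simp only: A rho_udiag[OF U]) (simp add: right_diff_distrib)
  ultimately show ?thesis by (simp add: cis_mult)
qed

section \<open>The sign and the signature of an invertible Hermitian matrix\<close>

definition invertible_hermitian :: "(complex^'n^'n) set" where
  "invertible_hermitian = {S \<in> hermitian_set. det S \<noteq> 0}"

text \<open>\<open>J\<close> is the unitary factor of the polar decomposition of the Hermitian matrix \<open>S\<close>: an involution such that \<open>J S\<close> is
positive semidefinite.  In this form the relation is closed in \<open>(S, J)\<close>, which gives the continuity of the sign.\<close>

definition is_sign :: "complex^'n^'n \<Rightarrow> complex^'n^'n \<Rightarrow> bool" where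
  "is_sign S J \<longleftrightarrow> J \<in> hermitian_set \<and> J ** J = mat 1 \<and> J ** S \<in> hermitian_set \<and>
     (\<forall>v. 0 \<le> inner ((J ** S) *v v) v)"

definition herm_sign :: "complex^'n^'n \<Rightarrow> complex^'n^'n" where
  "herm_sign S = (THE J. is_sign S J)"

lemma hermitian_adjoint: "H \<in> hermitian_set \<Longrightarrow> adjoint_matrix H = H"
  by (simp add: hermitian_set_def)

lemma udiag_eigenvector:
  assumes U: "U \<in> unitary_group"
  shows "udiag U (\<lambda>l. complex_of_real (d l)) *v (U *v axis l 1) = d l *\<^sub>R (U *v axis l 1)"
    and "U *v axis l 1 \<noteq> 0"
proof -
  have "udiag U (\<lambda>l. complex_of_real (d l)) *v (U *v axis l 1)
      = (U ** diag_matrix (\<lambda>l. complex_of_real (d l)) ** (adjoint_matrix U ** U)) *v axis l 1"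
    by (simp only: udiag_def matrix_vector_mul_assoc matrix_mul_assoc)
  also have "\<dots> = U *v (diag_matrix (\<lambda>l. complex_of_real (d l)) *v axis l 1)"
    by (simp only: unitary_adjoint[OF U] matrix_mul_rid matrix_vector_mul_assoc)
  also have "diag_matrix (\<lambda>l. complex_of_real (d l)) *v axis l 1 = d l *\<^sub>R axis l 1"
    by (simp add: scaleR_vec_eq vec_eq_iff matrix_vector_mult_def diag_matrix_def axis_def if_mult cong: if_cong)
  finally show "udiag U (\<lambda>l. complex_of_real (d l)) *v (U *v axis l 1) = d l *\<^sub>R (U *v axis l 1)"
    by (simp only: matrix_vector_scaleR)
  show "U *v axis l 1 \<noteq> 0"
  proof
    assume "U *v axis l 1 = 0"
    then have "(adjoint_matrix U ** U) *v axis l 1 = 0"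
      by (simp add: matrix_vector_mul_assoc[symmetric])
    then show False by (simp add: unitary_adjoint[OF U])
  qed
qed

lemma udiag_zero: "udiag U (\<lambda>_. 0) = 0"
  by (simp add: vec_eq_iff udiag_def diag_matrix_def matrix_matrix_mult_def)

text \<open>If \<open>Q\<^sup>2 = R\<^sup>2\<close> and \<open>v\<close> is an eigenvector of \<open>Q - R\<close> for the eigenvalue \<open>d\<close>, then
\<open>0 = \<langle>(Q (Q - R) + (Q - R) R) v, v\<rangle> = d (\<langle>Q v, v\<rangle> + \<langle>R v, v\<rangle>)\<close>, so \<open>d \<noteq> 0\<close> would
give \<open>\<langle>Q v, v\<rangle> = \<langle>R v, v\<rangle> = 0\<close> and then \<open>d \<langle>v, v\<rangle> = 0\<close>.\<close>

lemma psd_square_root_unique: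
  assumes Q: "Q \<in> hermitian_set" "\<And>v. 0 \<le> inner (Q *v v) v"
    and R: "R \<in> hermitian_set" "\<And>v. 0 \<le> inner (R *v v) v"
    and eq: "Q ** Q = R ** (R :: complex^'n^'n)"
  shows "Q = R"
proof -
  have QR: "Q - R \<in> hermitian_set"
    by (rule subspace_diff[OF hermitian_subspace Q(1) R(1)])
  then obtain U d where U: "U \<in> unitary_group" and D: "Q - R = udiag U (\<lambda>l. complex_of_real (d l))"
    using hermitian_diagonalization by blast
  have "d l = 0" for l
  proof (rule ccontr)
    assume d: "d l \<noteq> 0"
    define v where "v = U *v axis l 1"
    have E: "(Q - R) *v v = d l *\<^sub>R v" and v0: "v \<noteq> 0"
      using udiag_eigenvector[OF U] by (simp_all add: v_def D)
    have "0 = inner ((Q ** Q - R ** R) *v v) v"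
      by (simp add: eq)
    also have "Q ** Q - R ** R = Q ** (Q - R) + (Q - R) ** R"
      by (simp add: matrix_diff_ldistrib matrix_diff_rdistrib)
    also have "inner ((Q ** (Q - R) + (Q - R) ** R) *v v) v
        = inner (Q *v ((Q - R) *v v)) v + inner ((Q - R) *v (R *v v)) v"
      by (simp add: matrix_vector_mult_add_rdistrib inner_add_left matrix_vector_mul_assoc)
    also have "inner ((Q - R) *v (R *v v)) v = inner (R *v v) ((Q - R) *v v)"
      by (rule hermitian_inner[OF \<open>Q - R \<in> hermitian_set\<close>])
    finally have "d l * (inner (Q *v v) v + inner (R *v v) v) = 0"
      by (simp add: E matrix_vector_scaleR distrib_left)
    then have "inner (Q *v v) v + inner (R *v v) v = 0" using d by simp
    then have "inner (Q *v v) v = 0" "inner (R *v v) v = 0"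
      using Q(2)[of v] R(2)[of v] by linarith+
    then have "inner ((Q - R) *v v) v = 0"
      by (simp add: matrix_vector_mult_diff_rdistrib inner_diff_left)
    then show False using d v0 by (simp add: E)
  qed
  then have "Q - R = 0" by (simp add: D udiag_zero)
  then show ?thesis by simp
qed

text \<open>For a sign \<open>J\<close> of \<open>S\<close>, the matrix \<open>J S\<close> is the positive semidefinite square root of \<open>S\<^sup>2\<close>.\<close>

lemma is_sign_unique:
  assumes S: "S \<in> invertible_hermitian" and J: "is_sign S J" "is_sign S K"
  shows "J = K"
proof -
  have sq: "(J ** S) ** (J ** S) = S ** S" if "is_sign S J" for J
  proof -
    have "J ** S = S ** J"
      using that S hermitian_adjoint[of "J ** S"]
      by (simp add: is_sign_def adjoint_mult hermitian_adjoint invertible_hermitian_def)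
    then have "(J ** S) ** (J ** S) = (S ** J) ** (J ** S)"
      by (rule arg_cong)
    also have "\<dots> = S ** (J ** J) ** S"
      by (simp only: matrix_mul_assoc)
    finally have "(J ** S) ** (J ** S) = S ** (J ** J) ** S" .
    then show ?thesis using that by (simp add: is_sign_def)
  qed
  have "J ** S = K ** S"
  proof (rule psd_square_root_unique)
    show "(J ** S) ** (J ** S) = (K ** S) ** (K ** S)"
      by (simp only: sq[OF J(1)] sq[OF J(2)])
  qed (use J in \<open>simp_all add: is_sign_def\<close>)
  then have "J ** (S ** matrix_inv S) = K ** (S ** matrix_inv S)"
    by (simp only: matrix_mul_assoc)
  moreover have "det S \<noteq> 0"
    using S by (simp add: invertible_hermitian_def)
  ultimately show ?thesis by (simp add: matrix_inv_mult)
qed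

lemma udiag_psd:
  assumes "\<And>l. 0 \<le> e l"
  shows "0 \<le> inner (udiag U (\<lambda>l. complex_of_real (e l)) *v v) v"
proof -
  let ?w = "adjoint_matrix U *v v"
  have "inner (udiag U (\<lambda>l. complex_of_real (e l)) *v v) v
      = inner (diag_matrix (\<lambda>l. complex_of_real (e l)) *v ?w) ?w"
    by (simp add: udiag_def matrix_vector_mul_assoc[symmetric] inner_adjoint[of U])
  also have "\<dots> = (\<Sum>l\<in>UNIV. e l * inner (?w $ l) (?w $ l))"
    by (simp add: inner_vec_def matrix_vector_mult_def diag_matrix_def if_mult inner_complex_def
        algebra_simps cong: if_cong)
  also have "\<dots> \<ge> 0" using assms by (intro sum_nonneg) simp
  finally show ?thesis .
qed

lemma udiag_invertible_hermitian:
  assumes "U \<in> unitary_group"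
  shows "udiag U (\<lambda>l. complex_of_real (d l)) \<in> invertible_hermitian \<longleftrightarrow> (\<forall>l. d l \<noteq> 0)"
  by (simp add: invertible_hermitian_def udiag_hermitian det_udiag[OF assms])

lemma is_sign_udiag:
  assumes U: "U \<in> unitary_group" and d: "\<And>l. d l \<noteq> 0"
  shows "is_sign (udiag U (\<lambda>l. complex_of_real (d l))) (udiag U (\<lambda>l. complex_of_real (sgn (d l))))"
proof -
  have p: "udiag U (\<lambda>l. complex_of_real (sgn (d l))) ** udiag U (\<lambda>l. complex_of_real (d l))
      = udiag U (\<lambda>l. complex_of_real \<bar>d l\<bar>)"
    by (simp add: udiag_mult[OF U] of_real_mult[symmetric] abs_sgn mult.commute del: of_real_mult)
  have "sgn (d l) * sgn (d l) = 1" for l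
    using d[of l] by (simp add: sgn_if)
  then have "udiag U (\<lambda>l. complex_of_real (sgn (d l))) ** udiag U (\<lambda>l. complex_of_real (sgn (d l))) = mat 1"
    by (simp add: udiag_mult[OF U] of_real_mult[symmetric] udiag_const[OF U] del: of_real_mult)
  then show ?thesis
    unfolding is_sign_def p using udiag_psd[of "\<lambda>l. \<bar>d l\<bar>" U] by (simp add: udiag_hermitian)
qed

lemma invertible_hermitian_diagonalization:
  fixes S :: "complex^'n^'n"
  assumes "S \<in> invertible_hermitian"
  obtains U and d :: "'n \<Rightarrow> real" where "U \<in> unitary_group" "\<And>l. d l \<noteq> 0"
    "S = udiag U (\<lambda>l. complex_of_real (d l))"
proof -
  have "S \<in> hermitian_set" using assms by (simp add: invertible_hermitian_def)
  then obtain U and d :: "'n \<Rightarrow> real" where U: "U \<in> unitary_group"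
    and S: "S = udiag U (\<lambda>l. complex_of_real (d l))"
    using hermitian_diagonalization by blast
  then have "\<And>l. d l \<noteq> 0" using assms udiag_invertible_hermitian[OF U] by simp
  then show ?thesis using that U S by blast
qed

lemma herm_sign_eqI:
  assumes "S \<in> invertible_hermitian" "is_sign S J" shows "herm_sign S = J"
  unfolding herm_sign_def using assms is_sign_unique by blast

lemma herm_sign_is_sign:
  assumes "S \<in> invertible_hermitian" shows "is_sign S (herm_sign S)"
  using invertible_hermitian_diagonalization[OF assms] is_sign_udiag herm_sign_eqI[OF assms] by metis

lemma herm_sign_udiag:
  assumes U: "U \<in> unitary_group" and d: "\<And>l. d l \<noteq> 0"
  shows "herm_sign (udiag U (\<lambda>l. complex_of_real (d l))) = udiag U (\<lambda>l. complex_of_real (sgn (d l)))"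
  using assms by (intro herm_sign_eqI is_sign_udiag) (auto simp: udiag_invertible_hermitian)

text \<open>The number of positive eigenvalues minus the number of negative ones (see \<open>signature_udiag\<close>).\<close>

definition signature :: "complex^'n^'n \<Rightarrow> real" where
  "signature S = Re (trace (herm_sign S))"

lemma signature_udiag:
  assumes U: "U \<in> unitary_group" and d: "\<And>l. d l \<noteq> 0"
  shows "signature (udiag U (\<lambda>l. complex_of_real (d l))) = (\<Sum>l\<in>UNIV. sgn (d l))"
  by (simp add: signature_def herm_sign_udiag[OF assms] trace_udiag[OF U])

lemma sum_sgn_eq:
  fixes d :: "'n::finite \<Rightarrow> real"
  assumes "\<And>l. d l \<noteq> 0"
  shows "(\<Sum>l\<in>UNIV. sgn (d l)) = 2 * real (card {l. d l > 0}) - real CARD('n)"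
proof -
  have "sgn (d l) = 2 * (if d l > 0 then 1 else 0) - 1" for l
    using assms[of l] by (auto simp: sgn_if)
  then have "(\<Sum>l\<in>UNIV. sgn (d l)) = (\<Sum>l\<in>UNIV. 2 * (if d l > 0 then 1 else 0) - 1)"
    by (simp only:)
  also have "\<dots> = 2 * real (card {l. d l > 0}) - real CARD('n)"
    by (simp add: sum_subtractf sum_distrib_left[symmetric] sum.If_cases)
  finally show ?thesis .
qed

lemma continuous_on_matrix_vector [continuous_intros]:
  fixes f :: "'a::topological_space \<Rightarrow> complex^'n^'n"
  assumes "continuous_on S f" "continuous_on S g"
  shows "continuous_on S (\<lambda>x. f x *v g x)"
  unfolding matrix_vector_mult_def
  by (intro continuous_on_vec_lambda continuous_intros assms)

lemma compact_unitary_group: "compact (unitary_group :: (complex^'n^'n) set)"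
proof -
  have "norm U \<le> (\<Sum>i\<in>(UNIV::'n set). \<Sum>j\<in>(UNIV::'n set). 1)" if U: "U \<in> unitary_group" for U :: "complex^'n^'n"
  proof -
    have e: "cmod (U $ i $ j) \<le> 1" for i j
    proof -
      have "(adjoint_matrix U ** U) $ j $ j = 1"
        by (simp add: unitary_adjoint[OF U] mat_def)
      then have "(\<Sum>k\<in>UNIV. complex_of_real ((cmod (U $ k $ j))\<^sup>2)) = 1"
        by (simp add: adjoint_matrix_def matrix_matrix_mult_def mult.commute[of "cnj _"] complex_norm_square[symmetric])
      then have "(\<Sum>k\<in>UNIV. (cmod (U $ k $ j))\<^sup>2) = 1"
        by (metis of_real_eq_1_iff of_real_sum)
      then have "(cmod (U $ i $ j))\<^sup>2 \<le> 1"
        using member_le_sum[of i UNIV "\<lambda>k. (cmod (U $ k $ j))\<^sup>2"] by simp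
      then show ?thesis by (simp add: power_le_one_iff)
    qed
    have "norm U \<le> (\<Sum>i\<in>UNIV. norm (U $ i))"
      unfolding norm_vec_def by (rule L2_set_le_sum) simp
    also have "\<dots> \<le> (\<Sum>i\<in>(UNIV::'n set). \<Sum>j\<in>(UNIV::'n set). cmod (U $ i $ j))"
      unfolding norm_vec_def[of "U $ _"] by (intro sum_mono L2_set_le_sum) simp
    also have "\<dots> \<le> (\<Sum>i\<in>(UNIV::'n set). \<Sum>j\<in>(UNIV::'n set). 1)"
      by (intro sum_mono e)
    finally show ?thesis .
  qed
  then have "bounded (unitary_group :: (complex^'n^'n) set)"
    unfolding bounded_iff by blast
  moreover have "closed (unitary_group :: (complex^'n^'n) set)"
    unfolding unitary_group_def
    by (intro closed_Collect_conj closed_Collect_eq continuous_intros)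
  ultimately show ?thesis by (simp add: compact_eq_bounded_closed)
qed

lemma involution_unitary:
  assumes "J \<in> hermitian_set" "J ** J = mat 1" shows "J \<in> unitary_group"
  using assms by (intro unitaryI) (simp add: hermitian_adjoint)

text \<open>The graph is closed and the values lie in the compact unitary group.\<close>

lemma continuous_on_herm_sign:
  "continuous_on invertible_hermitian (herm_sign :: complex^'n^'n \<Rightarrow> complex^'n^'n)"
proof -
  let ?H = "invertible_hermitian :: (complex^'n^'n) set"
  have "herm_sign \<in> ?H \<rightarrow> unitary_group"
    using herm_sign_is_sign involution_unitary by (fastforce simp: is_sign_def)
  moreover have "(\<lambda>S. (S, herm_sign S)) ` ?H = (?H \<times> unitary_group) \<inter> {x. is_sign (fst x) (snd x)}"
    using herm_sign_is_sign involution_unitary herm_sign_eqI by (fastforce simp: is_sign_def)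
  moreover have "closed {x :: (complex^'n^'n) \<times> (complex^'n^'n). is_sign (fst x) (snd x)}"
    unfolding is_sign_def hermitian_set_def mem_Collect_eq
    by (intro closed_Collect_conj closed_Collect_eq closed_Collect_all closed_Collect_le continuous_intros)
  ultimately show ?thesis
    by (simp add: continuous_closed_graph_eq[OF compact_unitary_group] closedin_closed_Int)
qed

section \<open>Path components of the invertible Hermitian matrices\<close>

lemma det_mat_diff_poly: "det (mat z - (A :: complex^'n^'n)) = poly (charpoly A) z"
proof -
  have e: "poly ((mat [:0, 1:] - map_matrix (\<lambda>a. [:a:]) A) $ i $ j) z = (mat z - A) $ i $ j" for i j
    by (simp add: mat_def map_matrix_def)
  show ?thesis
    unfolding charpoly_def det_def by (simp only: poly_sum poly_mult poly_prod e poly_of_int)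
qed

lemma unitary_eigenvalues_finite:
  assumes "A \<in> unitary_group" shows "finite {z. det (mat z - (A :: complex^'n^'n)) = 0}"
proof -
  have "mat 0 - A = mat (- 1) ** A" by (simp add: vec_eq_iff mat_mult_nth)
  moreover have "det (mat (- 1) :: complex^'n^'n) \<noteq> 0"
    by (rule det_mat_nonzero) simp
  ultimately have "det (mat 0 - A) \<noteq> 0"
    using unitary_det_nonzero[OF assms] by (simp only: det_mul mult_eq_0_iff) simp
  then have "poly (charpoly A) 0 \<noteq> 0"
    unfolding det_mat_diff_poly .
  then have "charpoly A \<noteq> 0" by auto
  then show ?thesis by (simp add: det_mat_diff_poly poly_roots_finite)
qed

lemma phase_in_E_iff:
  assumes A: "A \<in> unitary_group" and w: "cmod w = 1"
  shows "mat w ** A \<in> E_set \<longleftrightarrow> det (mat (cnj w) - A) \<noteq> 0"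
proof -
  have "w * cnj w = 1" using w by (simp add: complex_norm_square[symmetric])
  then have "mat w ** A - mat 1 = mat (- w) ** (mat (cnj w) - A)"
    by (simp add: vec_eq_iff mat_mult_nth algebra_simps) (simp add: mat_def)
  moreover have "- w \<noteq> 0" using w by auto
  ultimately show ?thesis
    using unitary_mult[OF unitary_mat[OF w] A] by (simp add: E_set_def det_mul det_mat_nonzero)
qed

text \<open>A unitary matrix has finitely many eigenvalues, so only finitely many of the small rotations can leave 1 in the
spectrum.\<close>

lemma small_phase_in_E:
  assumes A: "(A :: complex^'n^'n) \<in> unitary_group" and "\<delta> > 0"
  obtains t where "0 < t" "t < \<delta>" "mat (cis t) ** A \<in> E_set"
proof -
  let ?I = "{0<..<min \<delta> 1}"
  have "inj_on (\<lambda>t. cis (- t)) ?I"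
  proof (rule inj_onI)
    fix x y :: real assume xy: "x \<in> ?I" "y \<in> ?I" "cis (- x) = cis (- y)"
    then have "cos x = cos y" "x \<le> pi" "y \<le> pi"
      using pi_gt3 by (auto simp: complex_eq_iff)
    then show "x = y" using cos_inj_pi[of x y] xy(1,2) by simp
  qed
  then have "infinite ((\<lambda>t. cis (- t)) ` ?I)"
    using assms(2) by (simp add: finite_image_iff infinite_Ioo)
  then obtain t where "t \<in> ?I" "det (mat (cis (- t)) - A) \<noteq> 0"
    using finite_subset[OF _ unitary_eigenvalues_finite[OF A], of "(\<lambda>t. cis (- t)) ` ?I"] by blast
  then show ?thesis
    using that[of t] phase_in_E_iff[OF A, of "cis t"] by (simp add: cis_cnj)
qed

lemma hermitian_0: "0 \<in> hermitian_set"
  using hermitian_subspace by (rule subspace_0)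

text \<open>After a rotation a unitary matrix lies in \<open>E_set\<close>, which the Cayley transform contracts to \<open>cayley 0 = - 1\<close>; undoing the
rotation at the same time gives a path in the unitary group.\<close>

lemma unitary_group_path_connected:
  assumes "U \<in> unitary_group" "V \<in> unitary_group"
  shows "path_component unitary_group (U :: complex^'n^'n) V"
proof -
  have base: "path_component unitary_group (cayley 0) U" if U: "U \<in> unitary_group" for U :: "complex^'n^'n"
  proof -
    obtain r where r: "mat (cis r) ** U \<in> E_set"
      using small_phase_in_E[OF U, of 1] by auto
    define s where "s = - r"
    define A where "A = mat (cis (- s)) ** U"
    have A: "A \<in> E_set"
      using r by (simp add: A_def s_def)
    define g where "g t = mat (cis (t * s)) ** cayley (t *\<^sub>R cayley_inv A)" for t
    have h: "t *\<^sub>R cayley_inv A \<in> hermitian_set" for t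
      by (rule subspace_scale[OF hermitian_subspace cayley_inv_hermitian[OF A]])
    have "path g"
      unfolding path_def g_def by (intro continuous_intros h)
    moreover have "path_image g \<subseteq> unitary_group"
      by (auto simp: path_image_def g_def 
          intro!: unitary_mult[OF unitary_mat E_set_unitary[OF cayley_in_E[OF h]]])
    moreover have "pathstart g = cayley 0" by (simp add: pathstart_def g_def)
    moreover have "pathfinish g = U"
      by (simp add: pathfinish_def g_def cayley_cayley_inv[OF A]) (simp add: A_def matrix_mul_assoc mat_mult_mat cis_mult)
    ultimately show ?thesis unfolding path_component_def by blast
  qed
  show ?thesis
    using base assms by (meson path_component_sym path_component_trans)
qed

lemma udiag_permute:
  assumes p: "bij \<pi>" and U: "U \<in> unitary_group"
  shows "udiag U d = udiag (\<chi> i j. U $ i $ \<pi> j) (\<lambda>l. d (\<pi> l))"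
    and "(\<chi> i j. U $ i $ \<pi> j) \<in> unitary_group"
proof -
  have u: "udiag V e $ i $ j = (\<Sum>l\<in>UNIV. V $ i $ l * e l * cnj (V $ j $ l))" for V e i j
    by (simp add: udiag_def matrix_matrix_mult_def diag_matrix_def adjoint_matrix_def if_mult cong: if_cong)
  show "udiag U d = udiag (\<chi> i j. U $ i $ \<pi> j) (\<lambda>l. d (\<pi> l))"
    unfolding vec_eq_iff u by (simp, intro allI, rule sum.reindex_bij_betw[OF p, symmetric])
  have "(\<Sum>k\<in>UNIV. cnj (U $ k $ i) * U $ k $ j) = (if i = j then 1 else 0)" for i j
    using unitary_adjoint(1)[OF U] by (simp add: vec_eq_iff adjoint_matrix_def matrix_matrix_mult_def mat_def)
  moreover have "\<pi> i = \<pi> j \<longleftrightarrow> i = j" for i j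
    using p by (simp add: bij_is_inj inj_eq)
  ultimately show "(\<chi> i j. U $ i $ \<pi> j) \<in> unitary_group"
    by (intro unitaryI) (simp add: vec_eq_iff adjoint_matrix_def matrix_matrix_mult_def mat_def)
qed

text \<open>Equal signatures allow the eigenvalues to be matched with equal signs.  The unitary frames are then joined by a path, while
the eigenvalues move along segments that avoid 0.\<close>

lemma invertible_hermitian_path_component:
  assumes S: "S \<in> invertible_hermitian" and T: "T \<in> invertible_hermitian"
    and sig: "signature S = signature (T :: complex^'n^'n)"
  shows "path_component invertible_hermitian S T"
proof -
  obtain U d where U: "U \<in> unitary_group" and d: "\<And>l. d l \<noteq> 0"
    and SU: "S = udiag U (\<lambda>l. complex_of_real (d l))"
    using invertible_hermitian_diagonalization[OF S] by metis
  obtain V e where V: "V \<in> unitary_group" and e: "\<And>l. e l \<noteq> 0"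
    and TV: "T = udiag V (\<lambda>l. complex_of_real (e l))"
    using invertible_hermitian_diagonalization[OF T] by metis
  let ?P = "{l. d l > 0}" and ?Q = "{l. e l > 0}"
  have c: "card ?P = card ?Q"
    using sig sum_sgn_eq[of d, OF d] sum_sgn_eq[of e, OF e]
    by (simp add: SU TV signature_udiag[OF U d] signature_udiag[OF V e])
  obtain f where f: "bij_betw f ?P ?Q"
    using finite_same_card_bij[OF _ _ c] by auto
  have "card (- ?P) = card (- ?Q)" using c by (simp add: Compl_eq_Diff_UNIV card_Diff_subset)
  then obtain g where g: "bij_betw g (- ?P) (- ?Q)"
    using finite_same_card_bij[of "- ?P" "- ?Q"] by auto
  define \<pi> where "\<pi> = (\<lambda>l. if l \<in> ?P then f l else g l)"
  have p: "bij \<pi>"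
    using bij_betw_disjoint_Un[OF f g] by (simp add: \<pi>_def)
  have pos: "e (\<pi> l) > 0 \<longleftrightarrow> d l > 0" for l
    using bij_betw_apply[OF f, of l] bij_betw_apply[OF g, of l] by (auto simp: \<pi>_def)
  define W where "W = (\<chi> i j. V $ i $ \<pi> j)"
  have W: "W \<in> unitary_group" and TW: "T = udiag W (\<lambda>l. complex_of_real (e (\<pi> l)))"
    using udiag_permute[OF p V] by (simp_all add: W_def TV)
  obtain u where u: "path u" "path_image u \<subseteq> unitary_group" "u 0 = U" "u 1 = W"
    using unitary_group_path_connected[OF U W] by (auto simp: path_component_def pathstart_def pathfinish_def)
  have uU: "u t \<in> unitary_group" if "t \<in> {0..1}" for t
    using u(2) that by (auto simp: path_image_def)
  define k where "k t l = (1 - t) * d l + t * e (\<pi> l)" for t l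
  have k: "k t l \<noteq> 0" if t: "t \<in> {0..1}" for t l
  proof (cases "d l > 0")
    case True
    then show ?thesis using pos[of l] t unfolding k_def
      by (cases "t = 0") (auto intro!: less_imp_neq[symmetric] add_nonneg_pos)
  next
    case False
    then have "d l < 0" "e (\<pi> l) < 0" using pos[of l] d[of l] e[of "\<pi> l"] by auto
    then show ?thesis using t unfolding k_def
      by (cases "t = 0") (auto intro!: less_imp_neq add_nonpos_neg simp: mult_nonneg_nonpos mult_pos_neg)
  qed
  define s where "s t = udiag (u t) (\<lambda>l. complex_of_real (k t l))" for t
  have "path s"
    using u(1) unfolding path_def s_def k_def by (intro continuous_intros)
  moreover have "path_image s \<subseteq> invertible_hermitian"
    using k by (auto simp: path_image_def s_def udiag_invertible_hermitian[OF uU])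
  moreover have "pathstart s = S" "pathfinish s = T"
    by (simp_all add: pathstart_def pathfinish_def s_def k_def u SU TW)
  ultimately show ?thesis unfolding path_component_def by blast
qed

section \<open>Integrality of Delta, and the defect of rho as a signature\<close>

text \<open>Both \<open>x\<close> and \<open>y\<close> are arguments of \<open>1 / D\<close> up to sign, in units of \<open>pi\<close>; squaring removes the sign.\<close>

lemma cis_quotient_int:
  assumes "cis (pi * x) * D = cis (pi * real a)" "cis (pi * y) * D = cis (pi * real b)"
  shows "x - y \<in> \<int>"
proof -
  have sq: "(cis (pi * real k))\<^sup>2 = 1" for k
    by (simp add: power2_eq_square cis_mult complex_eq_iff mult.assoc[symmetric] flip: mult_2)
  have D: "D \<noteq> 0" using assms(1) by (metis cis_neq_zero mult_zero_right)
  have "(cis (pi * x))\<^sup>2 * D\<^sup>2 = (cis (pi * y))\<^sup>2 * D\<^sup>2"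
    unfolding power_mult_distrib[symmetric] assms sq ..
  then have "(cis (pi * x))\<^sup>2 = (cis (pi * y))\<^sup>2" using D by simp
  then have "cis (2 * pi * x) = cis (2 * pi * y)"
    by (simp add: power2_eq_square cis_mult mult.assoc)
  then have "cis (2 * pi * x - 2 * pi * y) = 1"
    by (simp add: cis_divide[symmetric])
  then have "cos (2 * pi * x - 2 * pi * y) = 1" by (simp add: complex_eq_iff)
  then obtain i :: int where "2 * pi * x - 2 * pi * y = of_int i * 2 * pi"
    by (auto simp: cos_one_2pi_int)
  then have "2 * pi * (x - y) = 2 * pi * of_int i" by (simp add: algebra_simps)
  then have "x - y = of_int i" by simp
  then show ?thesis by simp
qed

lemma X_set_E: "A \<in> X_set m \<Longrightarrow> j \<in> {1..m} \<Longrightarrow> A j \<in> E_set"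
  by (auto simp: X_set_def)

lemma X_set_prod_E: "A \<in> X_set m \<Longrightarrow> mat_prod A m \<in> E_set"
  by (auto simp: X_set_def)

lemma cis_sum_rho:
  assumes "\<And>j. j \<in> {1..k} \<Longrightarrow> A j \<in> (E_set :: (complex^'n^'n) set)"
  shows "cis (pi * (\<Sum>j=1..k. rho (A j))) * det (mat_prod A k) = cis (pi * real (k * CARD('n)))"
  using assms
proof (induction k)
  case (Suc k)
  have "cis (pi * (\<Sum>j=1..Suc k. rho (A j))) * det (mat_prod A (Suc k)) =
      (cis (pi * (\<Sum>j=1..k. rho (A j))) * det (mat_prod A k)) * (cis (pi * rho (A (Suc k))) * det (A (Suc k)))"
    by (simp add: distrib_left cis_mult[symmetric] det_mul)
  also have "\<dots> = cis (pi * real (k * CARD('n))) * cis (pi * real CARD('n))"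
    using Suc by (simp add: cis_rho del: of_nat_mult)
  finally show ?case by (simp add: cis_mult algebra_simps)
qed auto

lemma Delta_int:
  fixes A :: "nat \<Rightarrow> complex^'n^'n"
  assumes "A \<in> X_set m" shows "Delta m A \<in> \<int>"
  unfolding Delta_def
  by (rule cis_quotient_int[OF cis_sum_rho cis_rho]) (use assms X_set_E X_set_prod_E in auto)

lemma pair_Delta_int:
  assumes "A \<in> E_set" "B \<in> E_set" "A ** B \<in> E_set"
  shows "rho A + rho B - rho (A ** B :: complex^'n^'n) \<in> \<int>"
proof -
  have "cis (pi * (rho A + rho B)) * det (A ** B) = (cis (pi * rho A) * det A) * (cis (pi * rho B) * det B)"
    by (simp add: distrib_left cis_mult[symmetric] det_mul)
  also have "\<dots> = cis (pi * real (CARD('n) + CARD('n)))"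
    by (simp only: cis_rho assms cis_mult distrib_left of_nat_add)
  finally show ?thesis
    by (rule cis_quotient_int[OF _ cis_rho[OF assms(3)]])
qed

lemma Arg2pi_cis:
  assumes "0 \<le> t" "t < 2 * pi" shows "Arg2pi (cis t) = t"
  using assms by (intro Arg2pi_unique[of 1]) (auto simp: cis_conv_exp)

lemma cayley_scalar_cis:
  "(complex_of_real x + \<i>) / (complex_of_real x - \<i>) = cis (pi - 2 * arctan x)"
proof -
  let ?z = "(complex_of_real x + \<i>) / (complex_of_real x - \<i>)"
  have "cmod ?z = 1"
    using real_minus_i_nonzero[of x] by (simp add: norm_divide) (simp add: cmod_def)
  then show ?thesis
    using Arg2pi_eq[of ?z] by (simp only: Arg2pi_cayley cis_conv_exp) simp
qed

text \<open>The signature formula.  The defect on the left is integer-valued and continuous, hence unchanged when the pair of Cayley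
coordinates \<open>(H, K)\<close> is moved along \<open>H + K = S\<close> to \<open>(S / 2, S / 2)\<close>.  There the two factors commute and the formula
is the scalar one: an angle doubled modulo \<open>2 pi\<close> wraps around exactly if the corresponding eigenvalue of \<open>S\<close> is negative.\<close>

theorem rho_product_defect:
  fixes A B :: "complex^'n^'n"
  assumes A: "A \<in> E_set" and B: "B \<in> E_set" and AB: "A ** B \<in> E_set"
  shows "rho A + rho B - rho (A ** B) = signature (cayley_inv A + cayley_inv B)"
proof -
  define S where "S = cayley_inv A + cayley_inv B"
  have S: "S \<in> invertible_hermitian"
    using product_in_E_iff[OF A B] AB subspace_add[OF hermitian_subspace cayley_inv_hermitian[OF A] cayley_inv_hermitian[OF B]]
    by (simp add: S_def invertible_hermitian_def)
  then obtain U d where U: "U \<in> unitary_group" and d: "\<And>l. d l \<noteq> 0"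
    and SU: "S = udiag U (\<lambda>l. complex_of_real (d l))"
    using invertible_hermitian_diagonalization by metis
  have Sh: "S \<in> hermitian_set" using S by (simp add: invertible_hermitian_def)
  \<comment> \<open>The pair \<open>(h t, k t)\<close> moves from the Cayley coordinates of \<open>A\<close> and \<open>B\<close> to two copies of \<open>S / 2\<close>.\<close>
  define h where "h t = (1 - t) *\<^sub>R cayley_inv A + (t / 2) *\<^sub>R S" for t
  define k where "k t = S - h t" for t
  have hh: "h t \<in> hermitian_set" for t
    unfolding h_def by (intro subspace_add[OF hermitian_subspace] subspace_scale[OF hermitian_subspace] cayley_inv_hermitian A Sh)
  have kh: "k t \<in> hermitian_set" for t
    unfolding k_def by (rule subspace_diff[OF hermitian_subspace Sh hh])
  have P: "cayley (h t) ** cayley (k t) \<in> E_set" for t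
    using product_in_E_iff[OF cayley_in_E[OF hh] cayley_in_E[OF kh], of t t] S
    by (simp add: cayley_inv_cayley hh kh invertible_hermitian_def) (simp add: k_def)
  define \<delta> where "\<delta> t = rho (cayley (h t)) + rho (cayley (k t)) - rho (cayley (h t) ** cayley (k t))" for t
  have "continuous_on {0..1} h" "continuous_on {0..1} k"
    unfolding h_def k_def by (auto intro!: continuous_intros)
  then have "continuous_on {0..1} \<delta>"
    unfolding \<delta>_def
    by (intro continuous_intros continuous_on_compose2[OF rho_continuous] continuous_on_cayley)
      (auto intro: hh kh P cayley_in_E)
  moreover have "\<delta> t / 1 \<in> \<int>" for t
    unfolding \<delta>_def using pair_Delta_int[OF cayley_in_E[OF hh] cayley_in_E[OF kh] P] by simp
  ultimately have "\<delta> 0 = \<delta> 1"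
    using continuous_on_int_valued_constant[of "{0..1}" \<delta> 1 0 1] by auto
  moreover have "\<delta> 0 = rho A + rho B - rho (A ** B)"
    by (simp add: \<delta>_def h_def k_def S_def cayley_cayley_inv A B)
  moreover have "\<delta> 1 = signature S"
  proof -
    have h1: "h 1 = udiag U (\<lambda>l. complex_of_real (d l / 2))"
      by (simp add: h_def SU udiag_scaleR[OF U])
    have "k 1 = h 1"
      by (simp add: k_def h_def vec_eq_iff field_simps)
    let ?a = "\<lambda>l. arctan (d l / 2)"
    have c: "cayley (h 1) = udiag U (\<lambda>l. cis (pi - 2 * ?a l))"
      by (simp only: h1 cayley_udiag[OF U] cayley_scalar_cis)
    have ang: "Arg2pi (cis (pi - 2 * x) * cis (pi - 2 * x)) = (if x > 0 then 2 * pi - 4 * x else - 4 * x)"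
      if "- pi / 2 < x" "x < pi / 2" for x
    proof (cases "x > 0")
      case True
      then show ?thesis using that Arg2pi_cis[of "2 * pi - 4 * x"] by (simp add: cis_mult)
    next
      case False
      have "cis (pi - 2 * x) * cis (pi - 2 * x) = cis (2 * pi) * cis (- 4 * x)"
        by (simp only: cis_mult) (simp add: algebra_simps)
      then show ?thesis using that False Arg2pi_cis[of "- 4 * x"] by simp
    qed
    have ang': "Arg2pi (cis (pi - 2 * ?a l) * cis (pi - 2 * ?a l)) = (2 * pi - 4 * ?a l) - (if d l > 0 then 0 else 2 * pi)" for l
      using arctan_bounded[of "d l / 2"] by (subst ang) auto
    have "\<delta> 1 = 2 * (2 / pi * (\<Sum>l\<in>UNIV. ?a l)) -
       (real CARD('n) - 1 / pi * (\<Sum>l\<in>UNIV. (2 * pi - 4 * ?a l) - (if d l > 0 then 0 else 2 * pi)))"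
    proof -
      have r: "rho (udiag U (\<lambda>l. cis (pi - 2 * ?a l))) = 2 / pi * (\<Sum>l\<in>UNIV. ?a l)"
        using rho_cayley_udiag[OF U, of "\<lambda>l. d l / 2"] by (simp only: h1[symmetric] c)
      show ?thesis
        by (simp only: \<delta>_def \<open>k 1 = h 1\<close> c udiag_mult[OF U] r) (simp only: rho_udiag[OF U] ang')
    qed
    also have "\<dots> = (\<Sum>l\<in>UNIV. (4 / pi) * ?a l - 1 + (2 - 4 / pi * ?a l) - (if d l > 0 then 0 else 2))"
    proof -
      have "1 / pi * (\<Sum>l\<in>UNIV. (2 * pi - 4 * ?a l) - (if d l > 0 then 0 else 2 * pi))
          = (\<Sum>l\<in>UNIV. (2 - 4 / pi * ?a l) - (if d l > 0 then 0 else 2))"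
        unfolding sum_distrib_left by (intro sum.cong refl) (simp add: field_simps)
      then show ?thesis
        by (simp add: sum_subtractf sum.distrib sum_distrib_left)
    qed
    also have "\<dots> = (\<Sum>l\<in>UNIV. sgn (d l))"
      by (intro sum.cong refl) (use d in \<open>auto simp: sgn_if\<close>)
    finally show ?thesis by (simp add: SU signature_udiag[OF U d])
  qed
  ultimately show ?thesis by (simp add: S_def)
qed

lemma signature_range:
  fixes S :: "complex^'n^'n"
  assumes "S \<in> invertible_hermitian"
  obtains k where "k \<le> CARD('n)" "signature S = real CARD('n) - 2 * real k"
proof -
  obtain U and d :: "'n \<Rightarrow> real" where U: "U \<in> unitary_group" and d: "\<And>l. d l \<noteq> 0"
    and SU: "S = udiag U (\<lambda>l. complex_of_real (d l))"
    using invertible_hermitian_diagonalization[OF assms] by metis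
  have c: "card {l. d l > 0} \<le> CARD('n)" by (simp add: card_mono)
  show ?thesis
    by (rule that[of "CARD('n) - card {l. d l > 0}"])
      (use c in \<open>simp_all add: SU signature_udiag[OF U d] sum_sgn_eq[OF d] of_nat_diff\<close>)
qed

section \<open>Paths in the space of tuples, and local constancy of Delta\<close>

lemma topspace_X_space: "topspace (X_space m) = X_set m"
proof -
  have "X_set m \<subseteq> {1..m} \<rightarrow>\<^sub>E unitary_group"
    using PiE_mono[of "{1..m}" "\<lambda>_. E_set" "\<lambda>_. unitary_group"] E_set_unitary
    unfolding X_set_def by blast
  then show ?thesis by (auto simp: X_space_def)
qed

lemma continuous_map_X_space_iff:
  "continuous_map T (X_space m) f \<longleftrightarrow>
     f \<in> topspace T \<rightarrow> X_set m \<and> (\<forall>j\<in>{1..m}. continuous_map T euclidean (\<lambda>x. f x j))"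
proof -
  have "f \<in> topspace T \<rightarrow> X_set m \<Longrightarrow> f \<in> topspace T \<rightarrow> extensional {1..m}
      \<and> (\<forall>j\<in>{1..m}. (\<lambda>x. f x j) \<in> topspace T \<rightarrow> unitary_group)"
    using E_set_unitary by (auto simp: X_set_def PiE_iff Pi_iff)
  then show ?thesis
    unfolding X_space_def
    by (auto simp: continuous_map_in_subtopology continuous_map_componentwise image_subset_iff_funcset)
qed

lemma X_space_pathI:
  assumes "\<And>t. t \<in> {0..1::real} \<Longrightarrow> g t \<in> X_set m" "\<And>j. j \<in> {1..m} \<Longrightarrow> continuous_on {0..1} (\<lambda>t. g t j)"
    "g 0 = A" "g 1 = B"
  shows "path_component_of (X_space m) A B"
  unfolding path_component_of_def pathin_def continuous_map_X_space_iff
  using assms by (intro exI[of _ g]) (auto simp: Pi_iff)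

lemma X_space_pathE:
  assumes "path_component_of (X_space m) A B"
  obtains g where "\<And>t. t \<in> {0..1} \<Longrightarrow> g t \<in> X_set m"
    "\<And>j. j \<in> {1..m} \<Longrightarrow> continuous_on {0..1} (\<lambda>t. g t j)" "g (0::real) = A" "g 1 = B"
proof -
  obtain g where "continuous_map (top_of_set {0..1::real}) (X_space m) g" "g 0 = A" "g 1 = B"
    using assms unfolding path_component_of_def pathin_def by blast
  then show ?thesis
    by (intro that[of g]) (auto simp: continuous_map_X_space_iff Pi_iff)
qed

lemma continuous_on_mat_prod:
  assumes "\<And>j. j \<in> {1..k} \<Longrightarrow> continuous_on S (\<lambda>t. g t j)"
  shows "continuous_on S (\<lambda>t. mat_prod (g t) k :: complex^'n^'n)"
  using assms
proof (induction k)
  case (Suc k)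
  then show ?case by (auto intro!: continuous_intros)
qed (auto intro!: continuous_intros)

lemma continuous_map_euclidean_mult:
  fixes f g :: "'a \<Rightarrow> complex^'n^'n"
  assumes "continuous_map T euclidean f" "continuous_map T euclidean g"
  shows "continuous_map T euclidean (\<lambda>x. f x ** g x)"
proof -
  have c1: "continuous_map T (prod_topology euclidean euclidean) (\<lambda>x. (f x, g x))"
    using assms by (rule continuous_map_pairedI)
  have c2: "continuous_map (prod_topology euclidean euclidean) euclidean (\<lambda>y :: (complex^'n^'n) \<times> (complex^'n^'n). fst y ** snd y)"
    unfolding euclidean_product_topology by (auto intro!: continuous_intros)
  show ?thesis
    using continuous_map_compose[OF c1 c2] by (simp add: o_def)
qed

lemma continuous_map_mat_prod:
  assumes "\<And>j. j \<in> {1..k} \<Longrightarrow> continuous_map T euclidean (\<lambda>t. g t j)"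
  shows "continuous_map T euclidean (\<lambda>t. mat_prod (g t) k :: complex^'n^'n)"
  using assms
proof (induction k)
  case (Suc k)
  then show ?case by (auto intro!: continuous_map_euclidean_mult)
qed auto

lemma continuous_map_Delta: "continuous_map (X_space m) euclideanreal (Delta m :: (nat \<Rightarrow> complex^'n^'n) \<Rightarrow> real)"
proof -
  have rho: "continuous_map (X_space m) euclideanreal (\<lambda>A. rho (f A))"
    if f: "continuous_map (X_space m) euclidean f" "\<And>A. A \<in> X_set m \<Longrightarrow> f A \<in> E_set"
    for f :: "(nat \<Rightarrow> complex^'n^'n) \<Rightarrow> complex^'n^'n"
  proof -
    have c1: "continuous_map (X_space m) (top_of_set E_set) f"
      using f by (simp add: continuous_map_in_subtopology topspace_X_space Pi_iff)
    have c2: "continuous_map (top_of_set E_set) euclideanreal (rho :: complex^'n^'n \<Rightarrow> real)"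
      using rho_continuous by simp
    show ?thesis using continuous_map_compose[OF c1 c2] by (simp only: o_def)
  qed
  have comp: "continuous_map (X_space m) euclidean (\<lambda>A :: nat \<Rightarrow> complex^'n^'n. A j)" if "j \<in> {1..m}" for j
    using continuous_map_X_space_iff[of "X_space m" m "\<lambda>A :: nat \<Rightarrow> complex^'n^'n. A"] that by (simp add: topspace_X_space)
  show ?thesis
    unfolding Delta_def
    by (intro continuous_map_diff continuous_map_sum rho continuous_map_mat_prod comp)
      (auto intro: X_set_E X_set_prod_E)
qed

lemma Delta_path_constant:
  assumes "path_component_of (X_space m) A (B :: nat \<Rightarrow> complex^'n^'n)"
  shows "Delta m A = Delta m B"
proof -
  obtain g where g: "pathin (X_space m) g" "g 0 = A" "g 1 = B"
    using assms by (auto simp: path_component_of_def)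
  have "continuous_map (top_of_set {0..1}) euclideanreal (Delta m \<circ> g)"
    using g(1) continuous_map_Delta continuous_map_compose unfolding pathin_def by blast
  then have "continuous_on {0..1} (\<lambda>t. Delta m (g t))" by (simp add: o_def)
  moreover have "Delta m (g t) / 1 \<in> \<int>" if "t \<in> {0..1}" for t
  proof -
    have "g t \<in> X_set m"
      using g(1) that unfolding pathin_def continuous_map_X_space_iff by auto
    then show ?thesis using Delta_int by simp
  qed
  ultimately show ?thesis
    using continuous_on_int_valued_constant[of "{0..1}" "\<lambda>t. Delta m (g t)" 1 0 1] g by auto
qed

section \<open>Appending a factor with prescribed Hermitian sum\<close>

lemma mat_prod_cong: "(\<And>j. j \<in> {1..k} \<Longrightarrow> A j = B j) \<Longrightarrow> mat_prod A k = mat_prod B k"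
  by (induction k) auto

text \<open>The last factor is prescribed by \<open>S\<close>, the sum of its Cayley coordinate and that of the product of the earlier factors.
The condition for the longer product to stay in \<open>E_set\<close> is then that \<open>S\<close> is invertible, independently of \<open>B\<close>.\<close>

definition append_factor :: "nat \<Rightarrow> (nat \<Rightarrow> complex^'n^'n) \<Rightarrow> complex^'n^'n \<Rightarrow> nat \<Rightarrow> complex^'n^'n" where
  "append_factor m B S = B(Suc m := cayley (S - cayley_inv (mat_prod B m)))"

lemma append_factor_prod:
  "mat_prod (append_factor m B S) m = mat_prod B m"
  by (rule mat_prod_cong) (simp add: append_factor_def)

lemma append_factor_hermitian:
  assumes "B \<in> X_set m" "S \<in> invertible_hermitian"
  shows "S - cayley_inv (mat_prod B m) \<in> hermitian_set"
  using subspace_diff[OF hermitian_subspace, of S] cayley_inv_hermitian[OF X_set_prod_E[OF assms(1)]] assms(2)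
  by (simp add: invertible_hermitian_def)

lemma append_factor_in_X:
  assumes B: "B \<in> X_set m" and S: "S \<in> invertible_hermitian"
  shows "append_factor m B S \<in> X_set (Suc m)"
proof -
  note h = append_factor_hermitian[OF B S]
  have "append_factor m B S \<in> {1..Suc m} \<rightarrow>\<^sub>E E_set"
    using B cayley_in_E[OF h] by (auto simp: append_factor_def X_set_def PiE_iff extensional_def)
  moreover have "mat_prod B m ** cayley (S - cayley_inv (mat_prod B m)) \<in> E_set"
    using product_in_E_iff[OF X_set_prod_E[OF B] cayley_in_E[OF h]] S
    by (simp add: cayley_inv_cayley[OF h] invertible_hermitian_def)
  ultimately show ?thesis
    by (simp add: X_set_def append_factor_prod) (simp add: append_factor_def)
qed

text \<open>Telescoping; the bracket is the defect of a pair.\<close>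

lemma Delta_Suc:
  "Delta (Suc m) A = Delta m A + (rho (mat_prod A m) + rho (A (Suc m)) - rho (mat_prod A m ** A (Suc m)))"
  by (simp add: Delta_def)

lemma Delta_cong: "(\<And>j. j \<in> {1..m} \<Longrightarrow> A j = B j) \<Longrightarrow> Delta m A = Delta m B"
  using mat_prod_cong[of m A B] by (simp add: Delta_def)

lemma Delta_append_factor:
  assumes B: "B \<in> X_set m" and S: "S \<in> invertible_hermitian"
  shows "Delta (Suc m) (append_factor m B S) = Delta m B + signature S"
proof -
  note h = append_factor_hermitian[OF B S]
  have "Delta m (append_factor m B S) = Delta m B"
    by (rule Delta_cong) (simp add: append_factor_def)
  moreover have "mat_prod B m ** cayley (S - cayley_inv (mat_prod B m)) \<in> E_set"
    using X_set_prod_E[OF append_factor_in_X[OF B S]]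
    by (simp add: append_factor_prod) (simp add: append_factor_def)
  then have "rho (mat_prod B m) + rho (cayley (S - cayley_inv (mat_prod B m)))
      - rho (mat_prod B m ** cayley (S - cayley_inv (mat_prod B m))) = signature S"
    using rho_product_defect[OF X_set_prod_E[OF B] cayley_in_E[OF h]] by (simp add: cayley_inv_cayley[OF h])
  ultimately show ?thesis
    by (simp add: Delta_Suc append_factor_prod) (simp add: append_factor_def)
qed

text \<open>The coordinates \<open>(B, S)\<close> cover exactly the tuples whose product without the last factor is in \<open>E_set\<close>.\<close>

lemma append_factor_surj:
  assumes A: "A \<in> X_set (Suc m)" and P: "mat_prod A m \<in> E_set"
  defines "B \<equiv> restrict A {1..m}"
  obtains S where "B \<in> X_set m" "S \<in> invertible_hermitian" "A = append_factor m B S"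
proof -
  have e: "mat_prod B m = mat_prod A m"
    by (rule mat_prod_cong) (simp add: B_def)
  have B: "B \<in> X_set m"
    using A P by (auto simp: X_set_def e) (auto simp: B_def PiE_iff)
  let ?S = "cayley_inv (mat_prod A m) + cayley_inv (A (Suc m))"
  have AE: "A (Suc m) \<in> E_set" using A by (auto simp: X_set_def)
  have "mat_prod A m ** A (Suc m) \<in> E_set" using A by (simp add: X_set_def)
  then have S: "?S \<in> invertible_hermitian"
    using product_in_E_iff[OF P AE] subspace_add[OF hermitian_subspace cayley_inv_hermitian[OF P] cayley_inv_hermitian[OF AE]]
    by (simp add: invertible_hermitian_def)
  have "A = append_factor m B ?S"
  proof
    fix j
    show "A j = append_factor m B ?S j"
    proof (cases "j = Suc m")
      case True
      then show ?thesis by (simp add: append_factor_def e cayley_cayley_inv[OF AE])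
    next
      case False
      then show ?thesis
        using A by (auto simp: append_factor_def B_def X_set_def PiE_iff extensional_def restrict_def)
    qed
  qed
  then show ?thesis using that B S by blast
qed

text \<open>The coordinates \<open>B\<close> and \<open>S\<close> can be moved independently of each other.\<close>

lemma append_factor_path:
  fixes B B' :: "nat \<Rightarrow> complex^'n^'n"
  assumes "path_component_of (X_space m) B B'" "path_component invertible_hermitian S S'"
  shows "path_component_of (X_space (Suc m)) (append_factor m B S) (append_factor m B' S')"
proof -
  obtain g where g: "\<And>t. t \<in> {0..1} \<Longrightarrow> g t \<in> X_set m"
    "\<And>j. j \<in> {1..m} \<Longrightarrow> continuous_on {0..1} (\<lambda>t. g t j)" "g (0::real) = B" "g 1 = B'"
    using X_space_pathE[OF assms(1)] by metis
  obtain s where s: "path s" "path_image s \<subseteq> invertible_hermitian" "s 0 = S" "s 1 = S'"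
    using assms(2) by (auto simp: path_component_def pathstart_def pathfinish_def)
  have sI: "s t \<in> invertible_hermitian" if "t \<in> {0..1}" for t
    using s(2) that by (auto simp: path_image_def)
  have PE: "mat_prod (g t) m \<in> E_set" and hS: "s t - cayley_inv (mat_prod (g t) m) \<in> hermitian_set"
    if "t \<in> {0..1}" for t
    using X_set_prod_E append_factor_hermitian g(1)[OF that] sI[OF that] by blast+
  show ?thesis
  proof (rule X_space_pathI[of "\<lambda>t. append_factor m (g t) (s t)"])
    show "append_factor m (g t) (s t) \<in> X_set (Suc m)" if "t \<in> {0..1}" for t
      using append_factor_in_X g(1) sI that by blast
    fix j assume j: "j \<in> {1..Suc m}"
    show "continuous_on {0..1} (\<lambda>t. append_factor m (g t) (s t) j)"
    proof (cases "j = Suc m")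
      case True
      have "continuous_on {0..1} (\<lambda>t. cayley (s t - cayley_inv (mat_prod (g t) m)))"
        using s(1) unfolding path_def
        by (intro continuous_intros continuous_on_mat_prod g(2)) (use PE hS in auto)
      then show ?thesis using True by (simp add: append_factor_def)
    next
      case False
      then show ?thesis using g(2)[of j] j by (simp add: append_factor_def)
    qed
  qed (simp_all add: g s)
qed

lemma mat_prod_first_phase:
  assumes "m \<ge> 1"
  shows "mat_prod (A(1 := mat w ** A 1)) m = mat w ** mat_prod A m"
  using assms
proof (induction m rule: dec_induct)
  case base
  show ?case by simp
next
  case (step k)
  then show ?case by (simp add: matrix_mul_assoc)
qed

text \<open>Rotating the first factor rotates all partial products by the same phase.  For small phases the first factor and the full
product stay in the open set \<open>E_set\<close>, and for some of them the product of the first \<open>m\<close> factors is in \<open>E_set\<close> too.\<close>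

lemma perturb_to_append_factor:
  fixes A :: "nat \<Rightarrow> complex^'n^'n"
  assumes m: "m \<ge> 1" and A: "A \<in> X_set (Suc m)"
  obtains B S where "B \<in> X_set m" "S \<in> invertible_hermitian"
    "path_component_of (X_space (Suc m)) A (append_factor m B S)"
proof -
  let ?g = "\<lambda>s. A(1 := mat (cis s) ** A 1)"
  let ?O = "{s. det (mat (cis s) ** A 1 - mat 1) \<noteq> 0 \<and> det (mat (cis s) ** mat_prod A (Suc m) - mat 1) \<noteq> 0}"
  have U: "A 1 \<in> unitary_group" "mat_prod A (Suc m) \<in> unitary_group"
    using E_set_unitary X_set_E[OF A, of 1] X_set_prod_E[OF A] m by auto
  have "open ?O"
    by (intro open_Collect_conj open_Collect_neq continuous_intros)
  moreover have "0 \<in> ?O"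
    using X_set_E[OF A, of 1] X_set_prod_E[OF A] E_set_det by auto
  ultimately obtain \<delta> where \<delta>0: "\<delta> > 0" "ball 0 \<delta> \<subseteq> ?O"
    by (meson open_contains_ball)
  have \<delta>: "\<delta> > 0" "\<And>s. \<bar>s\<bar> < \<delta> \<Longrightarrow> s \<in> ?O"
    using \<delta>0(1) subsetD[OF \<delta>0(2)] by simp_all
  have PU: "mat_prod A k \<in> unitary_group" if "k \<le> Suc m" for k
    using that
  proof (induction k)
    case 0 show ?case using unitary_mat[of 1] by simp
  next
    case (Suc k)
    then show ?case using unitary_mult E_set_unitary[OF X_set_E[OF A, of "Suc k"]] by simp
  qed
  obtain t where t: "0 < t" "t < \<delta>" "mat (cis t) ** mat_prod A m \<in> E_set"
    using small_phase_in_E[OF PU[of m] \<delta>(1)] by auto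
  have gX: "?g s \<in> X_set (Suc m)" if "\<bar>s\<bar> < \<delta>" for s
  proof -
    have "mat (cis s) ** A 1 \<in> E_set" "mat (cis s) ** mat_prod A (Suc m) \<in> E_set"
      using \<delta>(2)[OF that] unitary_mult[OF unitary_mat U(1), of "cis s"] unitary_mult[OF unitary_mat U(2), of "cis s"]
      by (auto simp: E_set_def)
    moreover have "?g s \<in> {1..Suc m} \<rightarrow>\<^sub>E E_set" if "mat (cis s) ** A 1 \<in> E_set"
      using A that by (auto simp: X_set_def PiE_iff extensional_def)
    ultimately show ?thesis
      using mat_prod_first_phase[of "Suc m" A "cis s"] by (simp add: X_set_def del: mat_prod.simps)
  qed
  have "path_component_of (X_space (Suc m)) A (?g t)"
  proof (rule X_space_pathI[of "\<lambda>s. ?g (s * t)"])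
    fix s :: real assume "s \<in> {0..1}"
    then have "\<bar>s * t\<bar> \<le> 1 * t"
      using t(1) by (simp add: abs_mult)
    then show "?g (s * t) \<in> X_set (Suc m)" using t(2) by (intro gX) linarith
  next
    fix j assume "j \<in> {1..Suc m}"
    show "continuous_on {0..1} (\<lambda>s. ?g (s * t) j)"
      by (cases "j = 1") (auto intro!: continuous_intros)
  qed auto
  moreover have "mat_prod (?g t) m \<in> E_set"
    using t(3) mat_prod_first_phase[OF m, of A "cis t"] by simp
  then obtain S where "restrict (?g t) {1..m} \<in> X_set m" "S \<in> invertible_hermitian"
      "?g t = append_factor m (restrict (?g t) {1..m}) S"
    using append_factor_surj[OF gX[of t]] t by auto
  ultimately show ?thesis using that by metis
qed

section \<open>Diagonal tuples\<close>

definition diag_tuple :: "nat \<Rightarrow> ('n::finite \<Rightarrow> nat \<Rightarrow> real) \<Rightarrow> nat \<Rightarrow> complex^'n^'n" where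
  "diag_tuple m \<theta> = (\<lambda>j\<in>{1..m}. diag_matrix (\<lambda>l. cis (\<theta> l j)))"

text \<open>\<open>N l\<close> counts how often the angles in position \<open>l\<close>, added up, pass a multiple of \<open>2 pi\<close>.\<close>

definition winding_data :: "nat \<Rightarrow> ('n::finite \<Rightarrow> nat \<Rightarrow> real) \<Rightarrow> ('n \<Rightarrow> nat) \<Rightarrow> bool" where
  "winding_data m \<theta> N \<longleftrightarrow> (\<forall>l. \<forall>j\<in>{1..m}. 0 < \<theta> l j \<and> \<theta> l j < 2 * pi) \<and>
     (\<forall>l. 2 * pi * real (N l) < (\<Sum>j=1..m. \<theta> l j) \<and> (\<Sum>j=1..m. \<theta> l j) < 2 * pi * (real (N l) + 1))"

lemma diag_eq_udiag: "diag_matrix z = udiag (mat 1) z"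
  by (simp add: udiag_def)

lemma mat1_unitary: "mat 1 \<in> unitary_group"
  using unitary_mat[of 1] by simp

lemma cis_period: "cis (x - 2 * pi * real k) = cis x"
proof -
  have "cis (2 * pi * real k) = 1"
  proof -
    have "cis (2 * pi * real k) = cis (2 * pi) ^ k"
      by (simp only: Complex.DeMoivre mult.commute)
    then show ?thesis by simp
  qed
  then show ?thesis by (simp add: cis_divide[symmetric])
qed

lemma diag_cis_in_E:
  assumes "\<And>l. 2 * pi * real (N l) < x l" "\<And>l. x l < 2 * pi * (real (N l) + 1)"
  shows "diag_matrix (\<lambda>l. cis (x l)) \<in> E_set"
    and "rho (diag_matrix (\<lambda>l. cis (x l)) :: complex^'n^'n)
      = (\<Sum>l\<in>UNIV. 1 - x l / pi + 2 * real (N l))"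
proof -
  have A: "Arg2pi (cis (x l)) = x l - 2 * pi * real (N l)" for l
  proof -
    have "Arg2pi (cis (x l - 2 * pi * real (N l))) = x l - 2 * pi * real (N l)"
      using assms[of l] by (intro Arg2pi_cis) (simp_all add: algebra_simps)
    then show ?thesis by (simp only: cis_period)
  qed
  have "cis (x l) \<noteq> 1" for l
  proof
    assume "cis (x l) = 1"
    then have "Arg2pi (cis (x l)) = 0" using Arg2pi_cis[of 0] by simp
    then show False using A[of l] assms(1)[of l] by simp
  qed
  then have "det (diag_matrix (\<lambda>l. cis (x l)) - mat 1) \<noteq> 0"
    by (simp add: diag_matrix_const[symmetric] diag_matrix_diff det_diag_matrix)
  then show "diag_matrix (\<lambda>l. cis (x l)) \<in> E_set"
    by (simp add: E_set_def diag_eq_udiag udiag_unitary[OF mat1_unitary])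
  have "rho (diag_matrix (\<lambda>l. cis (x l)) :: complex^'n^'n)
      = real CARD('n) - 1 / pi * (\<Sum>l\<in>UNIV. x l - 2 * pi * real (N l))"
    by (simp only: diag_eq_udiag rho_udiag[OF mat1_unitary] A)
  also have "\<dots> = (\<Sum>l\<in>UNIV. 1 - 1 / pi * (x l - 2 * pi * real (N l)))"
    by (simp only: sum_subtractf[of "\<lambda>_. 1"] sum_distrib_left sum_constant)
  also have "\<dots> = (\<Sum>l\<in>UNIV. 1 - x l / pi + 2 * real (N l))"
    by (intro sum.cong refl) (simp add: field_simps)
  finally show "rho (diag_matrix (\<lambda>l. cis (x l)) :: complex^'n^'n)
      = (\<Sum>l\<in>UNIV. 1 - x l / pi + 2 * real (N l))" .
qed

lemma mat_prod_diag_tuple: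
  "k \<le> m \<Longrightarrow> mat_prod (diag_tuple m \<theta>) k = diag_matrix (\<lambda>l. cis (\<Sum>j=1..k. \<theta> l j))"
proof (induction k)
  case (Suc k)
  then show ?case by (simp add: diag_tuple_def diag_matrix_mult cis_mult)
qed (simp add: diag_matrix_const)

lemma diag_tuple_in_X:
  assumes "winding_data m \<theta> N"
  shows "diag_tuple m \<theta> \<in> X_set m"
    and "Delta m (diag_tuple m \<theta> :: nat \<Rightarrow> complex^'n^'n)
      = (real m - 1) * real CARD('n) - 2 * real (\<Sum>l\<in>UNIV. N l)"
proof -
  have e: "diag_tuple m \<theta> j = diag_matrix (\<lambda>l. cis (\<theta> l j))" if "j \<in> {1..m}" for j
    using that by (simp add: diag_tuple_def)
  have j: "diag_tuple m \<theta> j \<in> E_set" "rho (diag_tuple m \<theta> j) = (\<Sum>l\<in>UNIV. 1 - \<theta> l j / pi)"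
    if "j \<in> {1..m}" for j
    using diag_cis_in_E[of "\<lambda>_. 0" "\<lambda>l. \<theta> l j"] assms that by (simp_all add: e winding_data_def)
  have p: "mat_prod (diag_tuple m \<theta>) m \<in> E_set"
     "rho (mat_prod (diag_tuple m \<theta>) m) = (\<Sum>l\<in>UNIV. 1 - (\<Sum>j=1..m. \<theta> l j) / pi + 2 * real (N l))"
    unfolding mat_prod_diag_tuple[OF order_refl]
    using diag_cis_in_E[of N "\<lambda>l. \<Sum>j=1..m. \<theta> l j"] assms by (simp_all add: winding_data_def)
  show "diag_tuple m \<theta> \<in> X_set m"
  proof -
    have "diag_tuple m \<theta> \<in> extensional {1..m}" by (simp add: diag_tuple_def)
    then show ?thesis using j(1) p(1) by (simp add: X_set_def PiE_iff)
  qed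
  have "(\<Sum>j=1..m. rho (diag_tuple m \<theta> j)) = (\<Sum>j=1..m. \<Sum>l\<in>UNIV. 1 - \<theta> l j / pi)"
    by (intro sum.cong refl j(2))
  also have "\<dots> = (\<Sum>l\<in>UNIV. \<Sum>j=1..m. 1 - \<theta> l j / pi)"
    by (rule sum.swap)
  also have "\<dots> = (\<Sum>l\<in>UNIV. real m - (\<Sum>j=1..m. \<theta> l j) / pi)"
    by (simp add: sum_subtractf sum_divide_distrib)
  finally have sr: "(\<Sum>j=1..m. rho (diag_tuple m \<theta> j)) = (\<Sum>l\<in>UNIV. real m - (\<Sum>j=1..m. \<theta> l j) / pi)" .
  have "Delta m (diag_tuple m \<theta>) = (\<Sum>l\<in>UNIV. (real m - (\<Sum>j=1..m. \<theta> l j) / pi) -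
      (1 - (\<Sum>j=1..m. \<theta> l j) / pi + 2 * real (N l)))"
    by (simp only: Delta_def sr p(2) sum_subtractf)
  also have "\<dots> = (\<Sum>l\<in>UNIV. (real m - 1) - 2 * real (N l))"
    by (intro sum.cong refl) simp
  also have "\<dots> = (real m - 1) * real CARD('n) - 2 * real (\<Sum>l\<in>UNIV. N l)"
    by (simp only: sum_subtractf[of "\<lambda>_. real m - 1"] sum_distrib_left[symmetric] sum_constant of_nat_sum) simp
  finally show "Delta m (diag_tuple m \<theta>) = (real m - 1) * real CARD('n) - 2 * real (\<Sum>l\<in>UNIV. N l)" .
qed

lemma convex_strict_bounds:
  fixes a b x y t :: real
  assumes "a < x" "x < b" "a < y" "y < b" "t \<in> {0..1}"
  shows "a < (1 - t) * x + t * y" "(1 - t) * x + t * y < b"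
  using convexD_alt[of "{a<..<b}" x y t] assms by auto

text \<open>For fixed winding numbers the admissible angles form a convex set.\<close>

lemma diag_tuple_path:
  assumes x: "winding_data m \<theta> N" and y: "winding_data m \<eta> N"
  shows "path_component_of (X_space m) (diag_tuple m \<theta> :: nat \<Rightarrow> complex^'n^'n) (diag_tuple m \<eta>)"
proof (rule X_space_pathI[of "\<lambda>t. diag_tuple m (\<lambda>l j. (1 - t) * \<theta> l j + t * \<eta> l j)"])
  fix t :: real assume t: "t \<in> {0..1}"
  have s: "(\<Sum>j=1..m. (1 - t) * \<theta> l j + t * \<eta> l j) = (1 - t) * (\<Sum>j=1..m. \<theta> l j) + t * (\<Sum>j=1..m. \<eta> l j)" for l
    by (simp add: sum.distrib sum_distrib_left)
  have "winding_data m (\<lambda>l j. (1 - t) * \<theta> l j + t * \<eta> l j) N"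
    unfolding winding_data_def s
    using x y t by (auto simp: winding_data_def intro!: convex_strict_bounds)
  then show "diag_tuple m (\<lambda>l j. (1 - t) * \<theta> l j + t * \<eta> l j) \<in> X_set m"
    by (rule diag_tuple_in_X)
next
  fix j assume "j \<in> {1..m}"
  then show "continuous_on {0..1} (\<lambda>t. diag_tuple m (\<lambda>l j. (1 - t) * \<theta> l j + t * \<eta> l j) j)"
    by (auto simp: diag_tuple_def cis_conv_exp intro!: continuous_intros)
qed simp_all

text \<open>The first \<open>m\<close> angles in position \<open>l\<close> are equal and add up to \<open>2 pi (a l + 1/2)\<close>; the last one is three quarters of a turn
for \<open>l \<in> T\<close>, which passes the next multiple of \<open>2 pi\<close>, and one quarter of a turn otherwise, which does not.\<close>

definition row_angles :: "nat \<Rightarrow> ('n::finite \<Rightarrow> nat) \<Rightarrow> 'n set \<Rightarrow> 'n \<Rightarrow> nat \<Rightarrow> real" where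
  "row_angles m a T l j =
     (if j \<le> m then 2 * pi * (real (a l) + 1 / 2) / real m else if l \<in> T then 3 * pi / 2 else pi / 2)"

lemma row_angles_winding:
  fixes a :: "'n::finite \<Rightarrow> nat"
  assumes m: "m \<ge> 1" and a: "\<forall>l. a l \<le> m - 1"
  shows "winding_data m (row_angles m a T) a"
    and "winding_data (Suc m) (row_angles m a T) (\<lambda>l. a l + (if l \<in> T then 1 else 0))"
proof -
  have s: "(\<Sum>j=1..m. row_angles m a T l j) = 2 * pi * (real (a l) + 1 / 2)" for l
    using m by (simp add: row_angles_def)
  have b: "0 < row_angles m a T l j \<and> row_angles m a T l j < 2 * pi" for l j
  proof -
    have "real (a l) + 1 / 2 < real m" using a[rule_format, of l] m by linarith
    then have "pi * (real (a l) + 1 / 2) < pi * real m" by (intro mult_strict_left_mono) auto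
    then show ?thesis
      using m by (simp add: row_angles_def field_simps add_pos_nonneg)
  qed
  show "winding_data m (row_angles m a T) a"
    unfolding winding_data_def s using b by (simp add: algebra_simps)
  have "(\<Sum>j=1..Suc m. row_angles m a T l j) = 2 * pi * (real (a l) + 1 / 2) + (if l \<in> T then 3 * pi / 2 else pi / 2)" for l
    using s[of l] by (simp add: row_angles_def)
  then show "winding_data (Suc m) (row_angles m a T) (\<lambda>l. a l + (if l \<in> T then 1 else 0))"
    unfolding winding_data_def using b by (simp add: algebra_simps)
qed

lemma bounded_summands:
  assumes "K \<le> M * CARD('n::finite)"
  obtains a :: "'n::finite \<Rightarrow> nat" where "\<forall>l. a l \<le> M" "(\<Sum>l\<in>UNIV. a l) = K"
proof -
  have "\<exists>a :: 'n \<Rightarrow> nat. (\<forall>l. a l \<le> M) \<and> (\<Sum>l\<in>UNIV. a l) = K"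
    using assms
  proof (induction K)
    case 0
    show ?case by (rule exI[of _ "\<lambda>_. 0"]) simp
  next
    case (Suc K)
    then obtain a :: "'n \<Rightarrow> nat" where a: "\<And>l. a l \<le> M" "(\<Sum>l\<in>UNIV. a l) = K" by auto
    have "\<exists>l. a l < M"
    proof (rule ccontr)
      assume "\<not> ?thesis"
      then have "a = (\<lambda>_. M)" using a(1) by (auto simp: fun_eq_iff intro: antisym simp: not_less)
      then show False using a(2) Suc.prems by (simp add: mult.commute)
    qed
    then obtain l where l: "a l < M" by blast
    have "(\<Sum>k\<in>UNIV. (a(l := Suc (a l))) k) = Suc K"
      using a(2) by (simp add: sum.remove[of UNIV l])
    then show ?case using a(1) l by (intro exI[of _ "a(l := Suc (a l))"]) auto
  qed
  then show ?thesis using that by blast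
qed

section \<open>Path connectedness of the fibers of Delta\<close>

text \<open>\<open>\<kappa>\<close> is the number of negative eigenvalues of \<open>S\<close>, and \<open>K + \<kappa>\<close> determines the fiber of \<open>Delta\<close> that contains \<open>A\<close>.\<close>

definition factor_type :: "nat \<Rightarrow> nat \<Rightarrow> nat \<Rightarrow> (nat \<Rightarrow> complex^'n^'n) \<Rightarrow> bool" where
  "factor_type m K \<kappa> A \<longleftrightarrow> (\<exists>B\<in>X_set m. \<exists>S\<in>invertible_hermitian. A = append_factor m B S \<and>
      Delta m B = (real m - 1) * real CARD('n) - 2 * real K \<and>
      signature S = real CARD('n) - 2 * real \<kappa>)"

lemma row_angles_factor_type:
  fixes a :: "'n::finite \<Rightarrow> nat"
  assumes m: "m \<ge> 1" and a: "\<forall>l. a l \<le> m - 1"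
  shows "factor_type m (\<Sum>l\<in>UNIV. a l) (card T) (diag_tuple (Suc m) (row_angles m a T) :: nat \<Rightarrow> complex^'n^'n)"
proof -
  note w = row_angles_winding[OF m a, where T = T]
  let ?A = "diag_tuple (Suc m) (row_angles m a T) :: nat \<Rightarrow> complex^'n^'n"
  let ?B = "diag_tuple m (row_angles m a T) :: nat \<Rightarrow> complex^'n^'n"
  have r: "restrict ?A {1..m} = ?B"
    by (auto simp: diag_tuple_def restrict_def)
  have P: "mat_prod ?A m \<in> E_set"
    using X_set_prod_E[OF diag_tuple_in_X(1)[OF w(1)]] by (simp add: mat_prod_diag_tuple)
  obtain S where S: "?B \<in> X_set m" "S \<in> invertible_hermitian" "?A = append_factor m ?B S"
    by (rule append_factor_surj[OF diag_tuple_in_X(1)[OF w(2)] P, unfolded r])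
  have "Delta (Suc m) ?A = Delta m ?B + signature S"
    by (subst S(3)) (rule Delta_append_factor[OF S(1,2)])
  then have "signature S = Delta (Suc m) ?A - Delta m ?B"
    by simp
  also have "\<dots> = real CARD('n) - 2 * real (card T)"
    unfolding diag_tuple_in_X(2)[OF w(1)] diag_tuple_in_X(2)[OF w(2)]
    by (simp add: sum.distrib sum.If_cases algebra_simps)
  finally show ?thesis
    unfolding factor_type_def using S diag_tuple_in_X(2)[OF w(1)] by blast
qed

text \<open>The two diagonal tuples have the same total winding numbers.  In position \<open>l\<close> the multiple of \<open>2 pi\<close> is passed at the
last factor in \<open>C\<close>, and one step earlier in \<open>D\<close>.\<close>

lemma factor_type_exchange:
  assumes m: "m \<ge> 1" and K: "Suc K \<le> (m - 1) * CARD('n)" and k: "Suc \<kappa> \<le> CARD('n)"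
  obtains C D :: "nat \<Rightarrow> complex^'n^'n" where "factor_type m K (Suc \<kappa>) C" "factor_type m (Suc K) \<kappa> D"
    "path_component_of (X_space (Suc m)) C D"
proof -
  obtain a :: "'n \<Rightarrow> nat" where a: "\<forall>l. a l \<le> m - 1" "(\<Sum>l\<in>UNIV. a l) = K"
    by (rule bounded_summands[OF Suc_leD[OF K]])
  have "\<exists>l. a l < m - 1"
  proof (rule ccontr)
    assume "\<not> ?thesis"
    then have "a = (\<lambda>_. m - 1)" using a(1) by (auto simp: fun_eq_iff intro: antisym simp: not_less)
    then show False using a(2) K by (simp add: mult.commute)
  qed
  then obtain l where l: "a l < m - 1" by blast
  have "\<kappa> \<le> card (UNIV - {l})" using k by simp
  then obtain T where T: "T \<subseteq> UNIV - {l}" "card T = \<kappa>" "finite T"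
    by (rule obtain_subset_with_card_n)
  let ?a = "a(l := Suc (a l))"
  have a': "\<forall>k. ?a k \<le> m - 1" using a(1) l by auto
  have sa': "(\<Sum>k\<in>UNIV. ?a k) = Suc K"
    using a(2) by (simp add: sum.remove[of UNIV l])
  have lT: "l \<notin> T" using T by auto
  have N: "(\<lambda>k. a k + (if k \<in> insert l T then 1 else 0)) = (\<lambda>k. ?a k + (if k \<in> T then 1 else 0))"
    using lT by auto
  show ?thesis
  proof (rule that)
    show "factor_type m K (Suc \<kappa>) (diag_tuple (Suc m) (row_angles m a (insert l T)))"
      using row_angles_factor_type[OF m a(1), where T = "insert l T"] a(2) T lT by simp
    show "factor_type m (Suc K) \<kappa> (diag_tuple (Suc m) (row_angles m ?a T))"
      using row_angles_factor_type[OF m a', where T = T] by (simp only: sa' T(2))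
    show "path_component_of (X_space (Suc m)) (diag_tuple (Suc m) (row_angles m a (insert l T)))
        (diag_tuple (Suc m) (row_angles m ?a T))"
      using row_angles_winding(2)[OF m a(1), where T = "insert l T"] row_angles_winding(2)[OF m a', where T = T]
      unfolding N by (rule diag_tuple_path)
  qed
qed

text \<open>Tuples of the same type are joined: the first \<open>m\<close> factors by the hypothesis, and \<open>S\<close> because its signature is fixed.\<close>

lemma factor_type_path:
  fixes A A' :: "nat \<Rightarrow> complex^'n^'n"
  assumes IH: "\<forall>B\<in>X_set m. \<forall>B'\<in>X_set m. Delta m B = Delta m (B' :: nat \<Rightarrow> complex^'n^'n) \<longrightarrow>
      path_component_of (X_space m) B B'"
    and "factor_type m K \<kappa> A" "factor_type m K \<kappa> A'"
  shows "path_component_of (X_space (Suc m)) A A'"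
proof -
  obtain B S where A: "B \<in> X_set m" "S \<in> invertible_hermitian" "A = append_factor m B S"
      "Delta m B = (real m - 1) * real CARD('n) - 2 * real K" "signature S = real CARD('n) - 2 * real \<kappa>"
    using assms(2) unfolding factor_type_def by blast
  obtain B' S' where A': "B' \<in> X_set m" "S' \<in> invertible_hermitian" "A' = append_factor m B' S'"
      "Delta m B' = (real m - 1) * real CARD('n) - 2 * real K" "signature S' = real CARD('n) - 2 * real \<kappa>"
    using assms(3) unfolding factor_type_def by blast
  show ?thesis
    unfolding A(3) A'(3)
  proof (rule append_factor_path)
    show "path_component_of (X_space m) B B'"
      using IH A(1,4) A'(1,4) by simp
    show "path_component invertible_hermitian S S'"
      by (rule invertible_hermitian_path_component) (simp_all only: A A')
  qed
qed

text \<open>Types with the same sum \<open>K + \<kappa>\<close> are joined by \<open>n\<close> exchanges.\<close>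

lemma factor_type_path_exchange:
  fixes A A' :: "nat \<Rightarrow> complex^'n^'n"
  assumes m: "m \<ge> 1"
    and IH: "\<forall>B\<in>X_set m. \<forall>B'\<in>X_set m. Delta m B = Delta m (B' :: nat \<Rightarrow> complex^'n^'n) \<longrightarrow>
      path_component_of (X_space m) B B'"
    and "factor_type m K (\<kappa> + n) A" "factor_type m (K + n) \<kappa> A'"
    and "K + n \<le> (m - 1) * CARD('n)" "\<kappa> + n \<le> CARD('n)"
  shows "path_component_of (X_space (Suc m)) A A'"
  using assms(3-)
proof (induction n arbitrary: K A)
  case 0
  then show ?case using factor_type_path[OF IH, of K \<kappa>] by simp
next
  case (Suc n)
  have le: "Suc K \<le> (m - 1) * CARD('n)" "Suc (\<kappa> + n) \<le> CARD('n)"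
    using Suc.prems by auto
  obtain C D :: "nat \<Rightarrow> complex^'n^'n" where C: "factor_type m K (Suc (\<kappa> + n)) C" "factor_type m (Suc K) (\<kappa> + n) D"
    "path_component_of (X_space (Suc m)) C D"
    by (rule factor_type_exchange[OF m le])
  have "path_component_of (X_space (Suc m)) A C"
    using factor_type_path[OF IH _ C(1)] Suc.prems by simp
  moreover have "path_component_of (X_space (Suc m)) D A'"
    using Suc.IH[OF C(2)] Suc.prems by simp
  ultimately show ?case using C(3) path_component_of_trans by metis
qed

theorem X_set_Delta_values:
  fixes A :: "nat \<Rightarrow> complex^'n^'n"
  assumes "m \<ge> 1" "A \<in> X_set m"
  obtains K where "K \<le> (m - 1) * CARD('n)" "Delta m A = (real m - 1) * real CARD('n) - 2 * real K"
proof -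
  have "\<exists>K\<le>(m - 1) * CARD('n). Delta m A = (real m - 1) * real CARD('n) - 2 * real K"
    using assms
  proof (induction m arbitrary: A rule: dec_induct)
    case base
    then show ?case by (simp add: Delta_def)
  next
    case (step m)
    obtain B S where B: "B \<in> X_set m" and S: "S \<in> invertible_hermitian"
      and p: "path_component_of (X_space (Suc m)) A (append_factor m B S)"
      using perturb_to_append_factor[OF step(1) step.prems] by metis
    obtain K where K: "K \<le> (m - 1) * CARD('n)" "Delta m B = (real m - 1) * real CARD('n) - 2 * real K"
      using step.IH[OF B] by auto
    obtain \<kappa> where \<kappa>: "\<kappa> \<le> CARD('n)" "signature S = real CARD('n) - 2 * real \<kappa>"
      using signature_range[OF S] by metis
    have "Delta (Suc m) A = Delta m B + signature S"
      using Delta_path_constant[OF p] Delta_append_factor[OF B S] by simp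
    moreover have "(m - 1) * CARD('n) + CARD('n) = m * CARD('n)"
      using step(1) by (cases m) auto
    ultimately show ?case
      using K \<kappa> by (intro exI[of _ "K + \<kappa>"]) (auto simp: algebra_simps)
  qed
  then show ?thesis using that by blast
qed

text \<open>Induction on the number of factors: each tuple is joined to one with coordinates \<open>(B, S)\<close>, tuples with coordinates of the same
type are joined by induction, and exchanges connect the different types in one fiber.\<close>

theorem X_set_fiber_path:
  fixes A A' :: "nat \<Rightarrow> complex^'n^'n"
  assumes "m \<ge> 1" "A \<in> X_set m" "A' \<in> X_set m" "Delta m A = Delta m A'"
  shows "path_component_of (X_space m) A A'"
  using assms
proof (induction m arbitrary: A A' rule: dec_induct)
  case base
  have E: "A 1 \<in> E_set" "A' 1 \<in> E_set" using base X_set_E[of _ 1 1] by auto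
  define h where "h t = (1 - t) *\<^sub>R cayley_inv (A 1) + t *\<^sub>R cayley_inv (A' 1)" for t
  have h: "h t \<in> hermitian_set" for t
    unfolding h_def by (intro subspace_add[OF hermitian_subspace] subspace_scale[OF hermitian_subspace] cayley_inv_hermitian E)
  have hA: "cayley (h 0) = A 1" "cayley (h 1) = A' 1"
    using E by (simp_all add: h_def cayley_cayley_inv)
  have ext: "B = restrict (\<lambda>_. B 1) {1..1}" if "B \<in> X_set 1" for B :: "nat \<Rightarrow> complex^'n^'n"
    using that by (auto simp: X_set_def PiE_iff extensional_def restrict_def fun_eq_iff)
  show ?case
  proof (rule X_space_pathI[of "\<lambda>t. restrict (\<lambda>_. cayley (h t)) {1..1}"])
    show "restrict (\<lambda>_. cayley (h t)) {1..1} \<in> X_set 1" for t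
      using cayley_in_E[OF h] by (simp add: X_set_def)
    show "continuous_on {0..1} (\<lambda>t. restrict (\<lambda>_. cayley (h t)) {1..1} j)" if "j \<in> {1..1}" for j
      using that h by (auto simp: h_def intro!: continuous_intros)
    show "restrict (\<lambda>_. cayley (h 0)) {1..1} = A" "restrict (\<lambda>_. cayley (h 1)) {1..1} = A'"
      by (simp_all only: hA ext[OF base(1), symmetric] ext[OF base(2), symmetric])
  qed
next
  case (step m)
  have red: "\<exists>K \<kappa> B. factor_type m K \<kappa> B \<and> path_component_of (X_space (Suc m)) A B \<and>
      K \<le> (m - 1) * CARD('n) \<and> \<kappa> \<le> CARD('n) \<and>
      Delta (Suc m) A = real m * real CARD('n) - 2 * real (K + \<kappa>)"
    if A: "A \<in> X_set (Suc m)" for A :: "nat \<Rightarrow> complex^'n^'n"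
  proof -
    obtain B S where B: "B \<in> X_set m" and S: "S \<in> invertible_hermitian"
      and p: "path_component_of (X_space (Suc m)) A (append_factor m B S)"
      using perturb_to_append_factor[OF step(1) A] by metis
    obtain K where K: "K \<le> (m - 1) * CARD('n)" "Delta m B = (real m - 1) * real CARD('n) - 2 * real K"
      using X_set_Delta_values[OF step(1) B] by metis
    obtain \<kappa> where \<kappa>: "\<kappa> \<le> CARD('n)" "signature S = real CARD('n) - 2 * real \<kappa>"
      using signature_range[OF S] by metis
    have "factor_type m K \<kappa> (append_factor m B S)"
      unfolding factor_type_def using B S K \<kappa> by blast
    moreover have "Delta (Suc m) A = real m * real CARD('n) - 2 * real (K + \<kappa>)"
      using Delta_path_constant[OF p] Delta_append_factor[OF B S] K \<kappa> by (simp add: algebra_simps)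
    ultimately show ?thesis using p K \<kappa> by blast
  qed
  obtain K \<kappa> B where B: "factor_type m K \<kappa> B" "path_component_of (X_space (Suc m)) A B"
      "K \<le> (m - 1) * CARD('n)" "\<kappa> \<le> CARD('n)" "Delta (Suc m) A = real m * real CARD('n) - 2 * real (K + \<kappa>)"
    using red[OF step.prems(1)] by blast
  obtain K' \<kappa>' B' where B': "factor_type m K' \<kappa>' B'" "path_component_of (X_space (Suc m)) A' B'"
      "K' \<le> (m - 1) * CARD('n)" "\<kappa>' \<le> CARD('n)" "Delta (Suc m) A' = real m * real CARD('n) - 2 * real (K' + \<kappa>')"
    using red[OF step.prems(2)] by blast
  have "real (K + \<kappa>) = real (K' + \<kappa>')" using step.prems(3) unfolding B(5) B'(5) by simp
  then have eq: "K + \<kappa> = K' + \<kappa>'" by (simp only: of_nat_eq_iff)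
  have IH: "\<forall>B\<in>X_set m. \<forall>B'\<in>X_set m. Delta m B = Delta m (B' :: nat \<Rightarrow> complex^'n^'n) \<longrightarrow>
      path_component_of (X_space m) B B'"
    using step.IH by blast
  note exch = factor_type_path_exchange[OF step(1) IH]
  have "path_component_of (X_space (Suc m)) B B'"
  proof (cases "K \<le> K'")
    case True
    then have "K' = K + (K' - K)" "\<kappa> = \<kappa>' + (K' - K)" using eq by auto
    then show ?thesis using exch[of K \<kappa>' "K' - K" B B'] B B' by simp
  next
    case False
    then have "K = K' + (K - K')" "\<kappa>' = \<kappa> + (K - K')" using eq by auto
    then show ?thesis using exch[of K' \<kappa> "K - K'" B' B] B B' path_component_of_sym by simp
  qed
  then show ?case
    using B(2) B'(2) by (meson path_component_of_sym path_component_of_trans)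
qed

section \<open>The image of Delta and the connected components\<close>

lemma Delta_image:
  assumes m: "m \<ge> 1"
  shows "Delta m ` (X_set m :: (nat \<Rightarrow> complex^'n^'n) set) =
       {(real m - 1) * real CARD('n) - 2 * real K | K :: nat. K \<le> (m - 1) * CARD('n)}"
proof (intro equalityI subsetI)
  fix c assume "c \<in> Delta m ` (X_set m :: (nat \<Rightarrow> complex^'n^'n) set)"
  then obtain A :: "nat \<Rightarrow> complex^'n^'n" where A: "A \<in> X_set m" "c = Delta m A" by blast
  show "c \<in> {(real m - 1) * real CARD('n) - 2 * real K | K :: nat. K \<le> (m - 1) * CARD('n)}"
    using X_set_Delta_values[OF m A(1)] A(2) by blast
next
  fix c assume "c \<in> {(real m - 1) * real CARD('n) - 2 * real K | K :: nat. K \<le> (m - 1) * CARD('n)}"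
  then obtain K where K: "K \<le> (m - 1) * CARD('n)" "c = (real m - 1) * real CARD('n) - 2 * real K" by blast
  obtain a :: "'n \<Rightarrow> nat" where a: "\<forall>l. a l \<le> m - 1" "(\<Sum>l\<in>UNIV. a l) = K"
    by (rule bounded_summands[OF K(1)])
  note w = diag_tuple_in_X[OF row_angles_winding(1)[OF m a(1), where T = "{}"]]
  show "c \<in> Delta m ` (X_set m :: (nat \<Rightarrow> complex^'n^'n) set)"
    using w a(2) K(2) by (intro image_eqI[of _ _ "diag_tuple m (row_angles m a {})"]) simp_all
qed

text \<open>A path between two points of a fiber stays in the fiber, as \<open>Delta\<close> is constant along paths.\<close>

lemma Delta_fiber_path_connected:
  assumes m: "m \<ge> 1"
  shows "path_connectedin (X_space m) (Delta_fiber m c :: (nat \<Rightarrow> complex^'n^'n) set)"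
  unfolding path_connectedin
proof (intro conjI ballI)
  show "Delta_fiber m c \<subseteq> topspace (X_space m)"
    by (auto simp: Delta_fiber_def topspace_X_space)
  fix A B :: "nat \<Rightarrow> complex^'n^'n" assume AB: "A \<in> Delta_fiber m c" "B \<in> Delta_fiber m c"
  then have "path_component_of (X_space m) A B"
    by (intro X_set_fiber_path[OF m]) (auto simp: Delta_fiber_def)
  then obtain g where g: "pathin (X_space m) g" "g 0 = A" "g 1 = B"
    by (auto simp: path_component_of_def)
  have "g t \<in> Delta_fiber m c" if t: "t \<in> {0..1}" for t
  proof -
    have "path_component_of (X_space m) A (g t)"
      unfolding path_component_of using path_connectedin_path_image[OF g(1)] t g(2) by force
    then show ?thesis
      using Delta_path_constant[of m A "g t"] AB(1) path_component_in_topspace[of "X_space m" A "g t"]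
      by (simp add: Delta_fiber_def topspace_X_space)
  qed
  then show "\<exists>g. pathin (X_space m) g \<and> g \<in> {0..1} \<rightarrow> Delta_fiber m c \<and> g 0 = A \<and> g 1 = B"
    using g by blast
qed

lemma Delta_fiber_clopen:
  fixes c :: real
  shows "openin (X_space m) (Delta_fiber m c :: (nat \<Rightarrow> complex^'n^'n) set)"
    and "closedin (X_space m) (Delta_fiber m c :: (nat \<Rightarrow> complex^'n^'n) set)"
proof -
  have cl: "(Delta_fiber m c :: (nat \<Rightarrow> complex^'n^'n) set) = {A \<in> topspace (X_space m). Delta m A \<in> {c}}"
    by (auto simp: Delta_fiber_def topspace_X_space)
  show "closedin (X_space m) (Delta_fiber m c :: (nat \<Rightarrow> complex^'n^'n) set)"
    unfolding cl by (rule closedin_continuous_map_preimage[OF continuous_map_Delta]) simp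
  show "openin (X_space m) (Delta_fiber m c :: (nat \<Rightarrow> complex^'n^'n) set)"
  proof (cases "c \<in> \<int>")
    case True
    have "A \<in> Delta_fiber m c \<longleftrightarrow> A \<in> topspace (X_space m) \<and> Delta m A \<in> {c - 1<..<c + 1}"
      for A :: "nat \<Rightarrow> complex^'n^'n"
    proof (cases "A \<in> X_set m")
      case A: True
      obtain i j where "c = of_int i" "Delta m A = of_int j"
        using True Delta_int[OF A] by (meson Ints_cases)
      then show ?thesis using A by (auto simp: Delta_fiber_def topspace_X_space)
    qed (simp add: Delta_fiber_def topspace_X_space)
    then have "(Delta_fiber m c :: (nat \<Rightarrow> complex^'n^'n) set) = {A \<in> topspace (X_space m). Delta m A \<in> {c - 1<..<c + 1}}"
      by blast
    then show ?thesis
      using openin_continuous_map_preimage[OF continuous_map_Delta, of "{c - 1<..<c + 1}" m] by simp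
  next
    case False
    then have "Delta_fiber m c = ({} :: (nat \<Rightarrow> complex^'n^'n) set)"
      using Delta_int by (auto simp: Delta_fiber_def)
    then show ?thesis by simp
  qed
qed

lemma X_space_components:
  assumes m: "m \<ge> 1"
  shows "connected_components_of (X_space m :: (nat \<Rightarrow> complex^'n^'n) topology)
    = Delta_fiber m ` (Delta m ` (X_set m :: (nat \<Rightarrow> complex^'n^'n) set))"
proof -
  have comp: "connected_component_of_set (X_space m) A = Delta_fiber m (Delta m A)" if A: "A \<in> X_set m"
    for A :: "nat \<Rightarrow> complex^'n^'n"
  proof
    have in_fiber: "A \<in> Delta_fiber m (Delta m A)" using A by (simp add: Delta_fiber_def)
    show "Delta_fiber m (Delta m A) \<subseteq> connected_component_of_set (X_space m) A"
      by (intro connected_component_of_maximal path_connectedin_imp_connectedin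
          Delta_fiber_path_connected m in_fiber)
    have "A \<in> connected_component_of_set (X_space m) A"
      using A by (simp add: connected_component_of_refl topspace_X_space)
    then show "connected_component_of_set (X_space m) A \<subseteq> Delta_fiber m (Delta m A)"
      using connectedin_clopen_cases[OF connectedin_connected_component_of Delta_fiber_clopen(2,1),
          of m A "Delta m A"] in_fiber by (auto simp: disjnt_def)
  qed
  show ?thesis
    unfolding connected_components_of_def topspace_X_space image_image
    by (intro image_cong refl comp)
qed

lemma card_X_space_components:
  assumes m: "m \<ge> 1"
  shows "card (connected_components_of (X_space m :: (nat \<Rightarrow> complex^'n^'n) topology))
    = (m - 1) * CARD('n) + 1"
proof -
  have "inj_on (Delta_fiber m :: real \<Rightarrow> (nat \<Rightarrow> complex^'n^'n) set) (Delta m ` (X_set m :: (nat \<Rightarrow> complex^'n^'n) set))"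
  proof (rule inj_onI)
    fix c d assume c: "c \<in> Delta m ` (X_set m :: (nat \<Rightarrow> complex^'n^'n) set)"
      and eq: "Delta_fiber m c = (Delta_fiber m d :: (nat \<Rightarrow> complex^'n^'n) set)"
    then obtain A :: "nat \<Rightarrow> complex^'n^'n" where "A \<in> X_set m" "c = Delta m A" by blast
    then have "A \<in> Delta_fiber m d" unfolding eq[symmetric] by (simp add: Delta_fiber_def)
    then show "c = d" using \<open>c = Delta m A\<close> by (simp add: Delta_fiber_def)
  qed
  then have "card (connected_components_of (X_space m :: (nat \<Rightarrow> complex^'n^'n) topology))
      = card (Delta m ` (X_set m :: (nat \<Rightarrow> complex^'n^'n) set))"
    unfolding X_space_components[OF m] by (rule card_image)
  also have "Delta m ` (X_set m :: (nat \<Rightarrow> complex^'n^'n) set)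
      = (\<lambda>K. (real m - 1) * real CARD('n) - 2 * real K) ` {..(m - 1) * CARD('n)}"
    unfolding Delta_image[OF m] by blast
  also have "card \<dots> = card {..(m - 1) * CARD('n)}"
    by (rule card_image) (simp add: inj_on_def)
  finally show ?thesis by simp
qed

lemma pair_fiber_is_component:
  assumes "r \<le> CARD('n)"
  shows "(Delta_fiber 2 (2 * real r - real CARD('n)) :: (nat \<Rightarrow> complex^'n^'n) set)
    \<in> connected_components_of (X_space 2)"
proof -
  have "2 * real r - real CARD('n) \<in> Delta 2 ` (X_set 2 :: (nat \<Rightarrow> complex^'n^'n) set)"
    unfolding Delta_image[of 2, simplified]
    using assms by (intro CollectI exI[of _ "CARD('n) - r"]) (simp add: of_nat_diff)
  moreover have "connected_components_of (X_space 2 :: (nat \<Rightarrow> complex^'n^'n) topology)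
      = Delta_fiber 2 ` (Delta 2 ` (X_set 2 :: (nat \<Rightarrow> complex^'n^'n) set))"
    by (rule X_space_components) simp
  ultimately show ?thesis by blast
qed

section \<open>Orthogonal projections and subspaces\<close>

definition matrix_range :: "complex^'n^'n \<Rightarrow> (complex^'n) set" where
  "matrix_range P = range (\<lambda>v. P *v v)"

definition projections :: "(complex^'n^'n) set" where
  "projections = {P. P \<in> hermitian_set \<and> P ** P = P}"

lemma subspace_matrix_range: "vec.subspace (matrix_range P)"
  unfolding vec.subspace_def matrix_range_def
proof (intro conjI ballI allI)
  show "0 \<in> range (\<lambda>v. P *v v)" by (rule range_eqI[of _ _ 0]) simp
  fix x assume "x \<in> range (\<lambda>v. P *v v)"
  then obtain v where v: "x = P *v v" by blast
  show "c *s x \<in> range (\<lambda>v. P *v v)" for c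
    by (rule range_eqI[of _ _ "c *s v"]) (simp add: v vec.scale)
  fix y assume "y \<in> range (\<lambda>v. P *v v)"
  then obtain w where w: "y = P *v w" by blast
  show "x + y \<in> range (\<lambda>v. P *v v)"
    by (rule range_eqI[of _ _ "v + w"]) (simp add: v w matrix_vector_right_distrib)
qed

lemma projection_fixes_range:
  assumes "P \<in> projections" "v \<in> matrix_range P" shows "P *v v = v"
proof -
  obtain w where w: "v = P *v w" using assms(2) by (auto simp: matrix_range_def)
  have "P *v v = (P ** P) *v w" by (simp add: w matrix_vector_mul_assoc)
  then show ?thesis using assms(1) by (simp add: w projections_def)
qed

lemma projection_unique:
  fixes P Q :: "complex^'n^'n"
  assumes P: "P \<in> projections" and Q: "Q \<in> projections" and eq: "matrix_range P = matrix_range Q"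
  shows "P = Q"
proof -
  have absorb: "P ** Q = Q" if P: "P \<in> projections" and eq: "matrix_range P = matrix_range Q" for P Q :: "complex^'n^'n"
  proof -
    have "Q *v x \<in> matrix_range Q" for x
      unfolding matrix_range_def by (rule rangeI)
    then have "P *v (Q *v x) = Q *v x" for x
      by (intro projection_fixes_range[OF P]) (simp only: eq)
    then show ?thesis by (simp add: matrix_eq matrix_vector_mul_assoc[symmetric])
  qed
  note PQ = absorb[OF P eq] absorb[OF Q eq[symmetric]]
  have "P = adjoint_matrix (Q ** P)"
    using P by (simp add: PQ projections_def hermitian_set_def)
  also have "\<dots> = P ** Q"
    using P Q by (simp add: adjoint_mult projections_def hermitian_set_def)
  finally show ?thesis by (simp add: PQ)
qed

text \<open>In a unitary eigenbasis the projection is the coordinate projection onto the eigenvalue 1.\<close>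

lemma dim_matrix_range_projection:
  fixes P :: "complex^'n^'n"
  assumes P: "P \<in> projections"
  shows "trace P = of_nat (vec.dim (matrix_range P))"
proof -
  obtain U and d :: "'n \<Rightarrow> real" where U: "U \<in> unitary_group"
    and PU: "P = udiag U (\<lambda>l. complex_of_real (d l))"
    using hermitian_diagonalization P by (auto simp: projections_def)
  let ?T = "{l. d l = 1}" and ?V = "adjoint_matrix U"
  have d: "d l = 0 \<or> d l = 1" for l
  proof -
    have "P *v (P *v (U *v axis l 1)) = P *v (U *v axis l 1)"
      using P by (simp only: matrix_vector_mul_assoc[of P P] projections_def mem_Collect_eq)
    then have "(d l * d l) *\<^sub>R (U *v axis l 1) = d l *\<^sub>R (U *v axis l 1)"
      by (simp add: PU udiag_eigenvector[OF U] matrix_vector_scaleR)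
    then show ?thesis using udiag_eigenvector(2)[OF U, of l] by simp
  qed
  have "trace P = (\<Sum>l\<in>UNIV. if l \<in> ?T then 1 else 0)"
    unfolding PU trace_udiag[OF U] using d by (intro sum.cong refl) force
  then have tr: "trace P = of_nat (card ?T)" by (simp add: sum.If_cases)
  have D: "(diag_matrix (\<lambda>l. complex_of_real (d l)) *v x) $ i = (if i \<in> ?T then x $ i else 0)" for x i
    using d[of i] by (auto simp: matrix_vector_mult_def diag_matrix_def if_mult cong: if_cong)
  have "matrix_range P = (\<lambda>v. U *v v) ` {x. \<forall>i. i \<notin> ?T \<longrightarrow> x $ i = 0}"
  proof (intro equalityI subsetI)
    fix v assume "v \<in> matrix_range P"
    then obtain w where "v = P *v w" by (auto simp: matrix_range_def)
    then have "v = U *v (diag_matrix (\<lambda>l. complex_of_real (d l)) *v (?V *v w))"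
      by (simp add: PU udiag_def matrix_vector_mul_assoc matrix_mul_assoc)
    then show "v \<in> (\<lambda>v. U *v v) ` {x. \<forall>i. i \<notin> ?T \<longrightarrow> x $ i = 0}"
      using D by auto
  next
    fix v assume "v \<in> (\<lambda>v. U *v v) ` {x. \<forall>i. i \<notin> ?T \<longrightarrow> x $ i = 0}"
    then obtain x where x: "v = U *v x" "\<And>i. i \<notin> ?T \<Longrightarrow> x $ i = 0" by auto
    have "P *v v = U *v (diag_matrix (\<lambda>l. complex_of_real (d l)) *v ((?V ** U) *v x))"
      by (simp only: PU udiag_def matrix_vector_mul_assoc x(1) matrix_mul_assoc)
    also have "diag_matrix (\<lambda>l. complex_of_real (d l)) *v ((?V ** U) *v x) = x"
      using x(2) by (simp add: unitary_adjoint[OF U] vec_eq_iff D)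
    finally have "v = P *v v" using x(1) by simp
    then show "v \<in> matrix_range P" unfolding matrix_range_def by (rule range_eqI)
  qed
  moreover have "inj (\<lambda>v. U *v v)"
    using unitary_adjoint(1)[OF U] by (intro inj_on_inverseI[of _ "\<lambda>v. ?V *v v"]) (simp add: matrix_vector_mul_assoc)
  then have "vec.dim ((\<lambda>v. U *v v) ` {x. \<forall>i. i \<notin> ?T \<longrightarrow> x $ i = 0}) = vec.dim {x :: complex^'n. \<forall>i. i \<notin> ?T \<longrightarrow> x $ i = 0}"
    by (intro vec.dim_image_eq matrix_vector_mul_linear_gen) (auto intro: inj_on_subset)
  ultimately show ?thesis using tr by (simp only: dim_substandard_cart)
qed

section \<open>Continuity of the orthogonal projection onto a subspace\<close>

text \<open>The vectors of the frame become the columns with index in \<open>T\<close>, by means of an enumeration \<open>b\<close> of \<open>T\<close>; the other columns are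
zero.  This keeps all matrices square, although the length of the frame is not a type.\<close>

definition frame_matrix :: "('n::finite \<Rightarrow> nat) \<Rightarrow> 'n set \<Rightarrow> (nat \<Rightarrow> complex^'n) \<Rightarrow> complex^'n^'n" where
  "frame_matrix b T f = (\<chi> i l. if l \<in> T then f (b l) $ i else 0)"

definition coordinate_projection :: "'n::finite set \<Rightarrow> complex^'n^'n" where
  "coordinate_projection T = diag_matrix (\<lambda>l. if l \<in> T then 1 else 0)"

text \<open>The Gram matrix of the columns in \<open>T\<close>, completed to an invertible matrix by the identity on the other coordinates.\<close>

definition gram :: "'n::finite set \<Rightarrow> complex^'n^'n \<Rightarrow> complex^'n^'n" where
  "gram T F = adjoint_matrix F ** F + (mat 1 - coordinate_projection T)"

text \<open>The formula \<open>F G F*\<close> for the orthogonal projection onto the span of the columns of \<open>F\<close>, where \<open>F*\<close> is the adjoint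
and \<open>G\<close> the inverse of the completed Gram matrix.\<close>

definition range_projection :: "'n::finite set \<Rightarrow> complex^'n^'n \<Rightarrow> complex^'n^'n" where
  "range_projection T F = F ** matrix_inv (gram T F) ** adjoint_matrix F"

lemma coordinate_projection_mult:
  "coordinate_projection T ** coordinate_projection T = coordinate_projection T"
  by (simp add: coordinate_projection_def diag_matrix_mult if_mult cong: if_cong)

lemma coordinate_projection_hermitian:
  "adjoint_matrix (coordinate_projection T) = coordinate_projection T"
  by (simp add: coordinate_projection_def adjoint_diag if_distrib[of cnj] cong: if_cong)

lemma frame_matrix_coordinate_projection:
  "frame_matrix b T f ** coordinate_projection T = frame_matrix b T f"
  by (simp add: vec_eq_iff matrix_matrix_mult_def frame_matrix_def coordinate_projection_def diag_matrix_def
      if_mult cong: if_cong)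

lemma frame_matrix_vector:
  "frame_matrix b T f *v x = (\<Sum>l\<in>T. x $ l *s f (b l))"
  by (simp add: vec_eq_iff matrix_vector_mult_def frame_matrix_def if_mult mult.commute sum.If_cases cong: if_cong)

text \<open>The Gram matrix is a sum of two positive semidefinite matrices, whose kernels meet in zero as the frame is independent.\<close>

lemma gram_nonsingular:
  assumes f: "f \<in> frames r" and b: "bij_betw b T {1..r}"
  shows "det (gram T (frame_matrix b T f)) \<noteq> 0"
proof -
  let ?F = "frame_matrix b T f" and ?C = "coordinate_projection T"
  have inj: "inj_on (\<lambda>l. f (b l)) T" and im: "(\<lambda>l. f (b l)) ` T = f ` {1..r}"
    using f b comp_inj_on[of b T f] by (auto simp: frames_def bij_betw_def o_def image_image[symmetric])
  \<comment> \<open>Independence of the set of frame vectors gives independence of the family, because the frame is injective.\<close>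
  have ker: "x $ l = 0" if x: "?F *v x = 0" and l: "l \<in> T" for x l
  proof -
    let ?u = "\<lambda>w. x $ (inv_into T (\<lambda>l. f (b l)) w)"
    have "(\<Sum>w\<in>f ` {1..r}. ?u w *s w) = (\<Sum>l\<in>T. x $ l *s f (b l))"
      unfolding im[symmetric] by (subst sum.reindex[OF inj]) (simp add: inv_into_f_f[OF inj])
    also have "\<dots> = 0" using x by (simp add: frame_matrix_vector)
    finally have "?u (f (b l)) = 0"
      using f l im vec.independentD[of "f ` {1..r}" "f ` {1..r}" ?u "f (b l)"] by (auto simp: frames_def)
    then show ?thesis using l by (simp add: inv_into_f_f[OF inj])
  qed
  have "x = 0" if x: "gram T ?F *v x = 0" for x
  proof -
    have "inner (gram T ?F *v x) x = inner (?F *v x) (?F *v x) + inner ((mat 1 - ?C) *v x) x"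
      by (simp add: gram_def matrix_vector_mult_add_rdistrib inner_add_left matrix_vector_mul_assoc[symmetric] inner_adjoint)
    moreover have "(mat 1 - ?C) *v x = (\<chi> l. if l \<in> T then 0 else x $ l)"
      by (simp add: vec_eq_iff matrix_vector_mult_def coordinate_projection_def diag_matrix_const[symmetric]
          diag_matrix_diff) (simp add: diag_matrix_def if_mult cong: if_cong)
    then have "inner ((mat 1 - ?C) *v x) x = (\<Sum>l\<in>UNIV. if l \<in> T then 0 else inner (x $ l) (x $ l))"
      by (simp add: inner_vec_def) (intro sum.cong refl, simp)
    ultimately have s: "inner (?F *v x) (?F *v x) + (\<Sum>l\<in>UNIV. if l \<in> T then 0 else inner (x $ l) (x $ l)) = 0"
      using x by simp
    have nn: "0 \<le> (\<Sum>l\<in>UNIV. if l \<in> T then 0 else inner (x $ l) (x $ l))"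
      by (intro sum_nonneg) auto
    have "inner (?F *v x) (?F *v x) = 0" and z: "(\<Sum>l\<in>UNIV. if l \<in> T then 0 else inner (x $ l) (x $ l)) = 0"
      using s nn inner_ge_zero[of "?F *v x"] by linarith+
    then have "?F *v x = 0" by simp
    then have "x $ l = 0" if "l \<in> T" for l using ker that by blast
    moreover have "x $ l = 0" if "l \<notin> T" for l
      using z that by (subst (asm) sum_nonneg_eq_0_iff) (auto split: if_splits)
    ultimately show "x = 0" by (auto simp: vec_eq_iff)
  qed
  then show ?thesis
    unfolding invertible_det_nz[symmetric] invertible_left_inverse matrix_left_invertible_ker by blast
qed

text \<open>With \<open>C\<close> the coordinate projection and \<open>N\<close> the completed Gram matrix, \<open>F* F = N C\<close>; therefore the projection fixes the
columns of \<open>F\<close>.\<close>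

lemma range_projection_frame:
  assumes f: "f \<in> frames r" and b: "bij_betw b T {1..r}"
  shows "range_projection T (frame_matrix b T f) \<in> projections"
    and "matrix_range (range_projection T (frame_matrix b T f)) = frame_span r f"
proof -
  let ?F = "frame_matrix b T f" and ?C = "coordinate_projection T"
  let ?N = "gram T ?F" and ?P = "range_projection T ?F"
  let ?A = "adjoint_matrix ?F" and ?R = "matrix_inv ?N"
  note inv = matrix_inv_mult[OF gram_nonsingular[OF f b]]
  have FC: "?F ** ?C = ?F" by (rule frame_matrix_coordinate_projection)
  have NC: "?N ** ?C = ?A ** ?F"
    by (simp add: gram_def matrix_add_rdistrib matrix_diff_rdistrib coordinate_projection_mult
        matrix_mul_assoc[symmetric] FC)
  have AF: "?R ** (?A ** ?F) = ?C"
    by (simp add: NC[symmetric] matrix_mul_assoc inv)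
  have PF: "?P ** ?F = ?F"
  proof -
    have "?P ** ?F = ?F ** (?R ** (?A ** ?F))"
      by (simp only: range_projection_def matrix_mul_assoc)
    then show ?thesis by (simp add: AF FC)
  qed
  have "?P ** ?P = (?P ** ?F) ** ?R ** ?A"
    by (simp only: range_projection_def matrix_mul_assoc)
  then have "?P ** ?P = ?P"
    by (simp only: PF) (simp only: range_projection_def)
  moreover have "adjoint_matrix ?N = ?N"
    by (simp add: gram_def adjoint_add adjoint_mult adjoint_diff coordinate_projection_hermitian)
  then have "adjoint_matrix ?P = ?P"
    by (simp add: range_projection_def adjoint_mult adjoint_matrix_inv[OF gram_nonsingular[OF f b]] matrix_mul_assoc)
  ultimately show P: "?P \<in> projections"
    by (simp add: projections_def hermitian_set_def)
  have im: "f ` {1..r} = (\<lambda>l. f (b l)) ` T"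
    using b by (auto simp: bij_betw_def image_image[symmetric])
  show "matrix_range ?P = frame_span r f"
  proof
    show "matrix_range ?P \<subseteq> frame_span r f"
    proof
      fix v assume "v \<in> matrix_range ?P"
      then obtain w where "v = ?P *v w" by (auto simp: matrix_range_def)
      then have "v = ?F *v ((?R ** ?A) *v w)"
        by (simp add: range_projection_def matrix_vector_mul_assoc matrix_mul_assoc)
      then have v: "v = (\<Sum>l\<in>T. ((?R ** ?A) *v w) $ l *s f (b l))"
        by (simp only: frame_matrix_vector)
      show "v \<in> frame_span r f"
        unfolding v frame_span_def im by (intro vec.span_sum vec.span_scale vec.span_base imageI)
    qed
    have "f (b l) \<in> matrix_range ?P" if l: "l \<in> T" for l
    proof -
      have e: "?F *v axis l 1 = f (b l)"
        using l by (simp add: vec_eq_iff matrix_vector_mult_def frame_matrix_def axis_def if_mult cong: if_cong)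
      have "?P *v (?F *v axis l 1) = ?F *v axis l 1"
        by (simp only: matrix_vector_mul_assoc PF)
      then have "f (b l) = ?P *v f (b l)" by (simp only: e)
      then show ?thesis unfolding matrix_range_def by (rule range_eqI)
    qed
    then show "frame_span r f \<subseteq> matrix_range ?P"
      unfolding frame_span_def im by (intro vec.span_minimal subspace_matrix_range) auto
  qed
qed

lemma coordinate_enumeration:
  assumes "r \<le> CARD('n::finite)"
  obtains b :: "'n::finite \<Rightarrow> nat" and T where "bij_betw b T {1..r}"
proof -
  obtain T :: "'n set" where T: "card T = r" "finite T"
    using obtain_subset_with_card_n[OF assms] by metis
  then show ?thesis
    using that finite_same_card_bij[of T "{1..r}"] by auto
qed

definition Gr_projection :: "(complex^'n) set \<Rightarrow> complex^'n^'n" where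
  "Gr_projection V = (THE P. P \<in> projections \<and> matrix_range P = V)"

lemma Gr_projection_eqI:
  assumes "P \<in> projections" "matrix_range P = V" shows "Gr_projection V = P"
  unfolding Gr_projection_def
proof (rule the_equality)
  show "P \<in> projections \<and> matrix_range P = V" using assms by simp
  show "Q = P" if "Q \<in> projections \<and> matrix_range Q = V" for Q
    by (rule projection_unique) (use that assms in simp_all)
qed

lemma Gr_frame:
  assumes "V \<in> Gr r"
  obtains f where "f \<in> frames r" "frame_span r f = V"
  using assms unfolding frame_span_surj[symmetric] by (elim imageE) auto

lemma Gr_projection:
  fixes V :: "(complex^'n) set"
  assumes r: "r \<le> CARD('n)" and V: "V \<in> Gr r"
  shows "Gr_projection V \<in> projections" "matrix_range (Gr_projection V) = V"
    "trace (Gr_projection V) = of_nat r"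
proof -
  obtain b :: "'n \<Rightarrow> nat" and T where b: "bij_betw b T {1..r}"
    by (rule coordinate_enumeration[OF r])
  obtain f where f: "f \<in> frames r" "frame_span r f = V"
    by (rule Gr_frame[OF V])
  have e: "Gr_projection V = range_projection T (frame_matrix b T f)"
    using range_projection_frame[OF f(1) b] f(2) by (intro Gr_projection_eqI) auto
  show p: "Gr_projection V \<in> projections" "matrix_range (Gr_projection V) = V"
    using range_projection_frame[OF f(1) b] f(2) by (simp_all add: e)
  show "trace (Gr_projection V) = of_nat r"
    using V dim_matrix_range_projection[OF p(1)] by (simp add: p(2) Gr_def)
qed

lemma continuous_map_compose_on:
  assumes "continuous_map T euclidean u" "\<And>x. x \<in> topspace T \<Longrightarrow> u x \<in> D" "continuous_on D \<phi>"
  shows "continuous_map T euclidean (\<lambda>x. \<phi> (u x))"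
proof -
  have c1: "continuous_map T (top_of_set D) u"
    using assms by (simp add: continuous_map_in_subtopology Pi_iff)
  have c2: "continuous_map (top_of_set D) euclidean \<phi>" using assms(3) by simp
  show ?thesis using continuous_map_compose[OF c1 c2] by (simp only: o_def)
qed

lemma continuous_map_frame_component:
  "i \<in> {1..r} \<Longrightarrow> continuous_map (frame_space r) euclidean (\<lambda>f. f i)"
  unfolding frame_space_def
  by (intro continuous_map_from_subtopology continuous_map_product_projection)

text \<open>The source is an abstract topology, which \<open>continuous_on_vec_lambda\<close> does not cover; the vector is written as the sum of
its components along the axes.\<close>

lemma continuous_map_vec_lambda:
  fixes f :: "'a \<Rightarrow> 'n::finite \<Rightarrow> 'b::euclidean_space"
  assumes "\<And>i. continuous_map T euclidean (\<lambda>x. f x i)"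
  shows "continuous_map T euclidean (\<lambda>x. \<chi> i. f x i)"
proof -
  have "continuous_map T euclidean (\<lambda>x. \<Sum>i\<in>UNIV. axis i (f x i))"
  proof (intro continuous_map_sum)
    fix i :: 'n
    have "continuous_on UNIV (\<lambda>y::'b. \<chi> j. if j = i then y else 0)"
    proof (intro continuous_on_vec_lambda)
      show "continuous_on UNIV (\<lambda>y::'b. if j = i then y else 0)" for j by (cases "j = i") auto
    qed
    then have "continuous_on UNIV (axis i :: 'b \<Rightarrow> 'b^'n)" by (simp add: axis_def[abs_def])
    then show "continuous_map T euclidean (\<lambda>x. axis i (f x i))"
      using continuous_map_compose_on[OF assms[of i], of UNIV "axis i"] by simp
  qed simp
  moreover have "(\<Sum>i\<in>UNIV. axis i (f x i)) = (\<chi> i. f x i)" for x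
    by (simp add: vec_eq_iff axis_def if_distrib cong: if_cong)
  ultimately show ?thesis by simp
qed

text \<open>By the quotient topology it suffices to have a continuous formula in terms of frames.\<close>

lemma continuous_map_Gr_projection:
  assumes r: "r \<le> CARD('n)"
  shows "continuous_map (Gr_space r) euclidean (Gr_projection :: (complex^'n) set \<Rightarrow> complex^'n^'n)"
proof (rule continuous_compose_quotient_map[OF quotient_map_Gr_space])
  obtain b :: "'n \<Rightarrow> nat" and T where b: "bij_betw b T {1..r}"
    by (rule coordinate_enumeration[OF r])
  let ?D = "{F :: complex^'n^'n. det (gram T F) \<noteq> 0}"
  have c1: "continuous_on ?D (range_projection T)"
    unfolding range_projection_def gram_def by (intro continuous_intros) auto
  have c2: "continuous_map (frame_space r) euclidean (frame_matrix b T)"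
    unfolding frame_matrix_def[abs_def]
  proof (intro continuous_map_vec_lambda)
    fix i l :: 'n
    show "continuous_map (frame_space r) euclidean (\<lambda>f :: nat \<Rightarrow> complex^'n. if l \<in> T then f (b l) $ i else 0)"
    proof (cases "l \<in> T")
      case True
      then have "b l \<in> {1..r}" using b by (auto simp: bij_betw_def)
      have "continuous_on UNIV (\<lambda>v :: complex^'n. v $ i)" by (intro continuous_intros)
      then show ?thesis
        using True continuous_map_compose_on[OF continuous_map_frame_component[OF \<open>b l \<in> {1..r}\<close>], of UNIV "\<lambda>v. v $ i"]
        by simp
    qed simp
  qed
  have mem: "frame_matrix b T f \<in> ?D" if "f \<in> topspace (frame_space r)" for f
    using gram_nonsingular[OF _ b, of f] that by (simp add: topspace_frame_space)
  have c: "continuous_map (frame_space r) euclidean (\<lambda>f. range_projection T (frame_matrix b T f))"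
    by (rule continuous_map_compose_on[OF c2 mem c1])
  have e: "range_projection T (frame_matrix b T f) = (Gr_projection \<circ> frame_span r) f"
    if "f \<in> topspace (frame_space r)" for f
    using that range_projection_frame[OF _ b, of f] by (simp add: topspace_frame_space Gr_projection_eqI)
  show "continuous_map (frame_space r) euclidean
      ((Gr_projection :: (complex^'n) set \<Rightarrow> complex^'n^'n) \<circ> frame_span r)"
    by (rule continuous_map_eq[OF c]) (rule e)
qed

section \<open>Continuity of the range of a projection\<close>

definition rank_projections :: "nat \<Rightarrow> (complex^'n^'n) set" where
  "rank_projections r = {P \<in> projections. trace P = of_nat r}"

lemma matrix_range_in_Gr: "P \<in> rank_projections r \<Longrightarrow> matrix_range P \<in> Gr r"
  using dim_matrix_range_projection[of P] subspace_matrix_range[of P] by (simp add: rank_projections_def Gr_def)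

text \<open>Near a projection \<open>Q\<close>, the invertible matrix \<open>P Q + (1 - P) (1 - Q)\<close> carries a frame of the range of \<open>Q\<close> to a frame of the range
of \<open>P\<close>, which depends continuously on \<open>P\<close>.\<close>

lemma continuous_map_matrix_range:
  "continuous_map (top_of_set (rank_projections r)) (Gr_space r) (matrix_range :: complex^'n^'n \<Rightarrow> _)"
proof (rule pasting_lemma)
  let ?W = "\<lambda>Q P. P ** Q + (mat 1 - P) ** (mat 1 - Q) :: complex^'n^'n"
  define N where "N Q = {P \<in> rank_projections r. det (?W Q P) \<noteq> 0}" for Q
  have open_W: "open {P. det (?W Q P) \<noteq> 0}" for Q
    by (intro open_Collect_neq continuous_intros)
  have N: "N Q = rank_projections r \<inter> {P. det (?W Q P) \<noteq> 0}" for Q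
    by (auto simp: N_def)
  show "openin (top_of_set (rank_projections r)) (N Q)" for Q
    unfolding N by (intro openin_open_Int open_W)
  show "\<exists>Q. Q \<in> rank_projections r \<and> P \<in> N Q \<and> matrix_range P = matrix_range P"
    if "P \<in> topspace (top_of_set (rank_projections r))" for P :: "complex^'n^'n"
  proof -
    have "?W P P = mat 1"
      using that by (simp add: matrix_diff_ldistrib matrix_diff_rdistrib rank_projections_def projections_def)
    then show ?thesis using that by (intro exI[of _ P]) (simp add: N_def)
  qed
  fix Q :: "complex^'n^'n" assume Q: "Q \<in> rank_projections r"
  obtain f where f: "f \<in> frames r" "frame_span r f = matrix_range Q"
    by (rule Gr_frame[OF matrix_range_in_Gr[OF Q]])
  let ?k = "\<lambda>P. \<lambda>i\<in>{1..r}. ?W Q P *v f i"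
  have kf: "?k P \<in> frames r \<and> frame_span r (?k P) = matrix_range P" if P: "P \<in> N Q" for P
  proof -
    have d: "det (?W Q P) \<noteq> 0" and PR: "P \<in> rank_projections r" using P by (auto simp: N_def)
    have inj: "inj (\<lambda>v. ?W Q P *v v)"
      using matrix_inv_mult(2)[OF d]
      by (intro inj_on_inverseI[of _ "\<lambda>v. matrix_inv (?W Q P) *v v"]) (simp add: matrix_vector_mul_assoc)
    have im: "?k P ` {1..r} = (\<lambda>v. ?W Q P *v v) ` f ` {1..r}"
      by (auto simp: image_image)
    have f': "inj_on f {1..r}" "vec.independent (f ` {1..r})"
      using f(1) by (simp_all add: frames_def)
    have "inj_on (?k P) {1..r}"
    proof (rule inj_onI)
      fix i j assume ij: "i \<in> {1..r}" "j \<in> {1..r}" "?k P i = ?k P j"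
      then have "?W Q P *v f i = ?W Q P *v f j" by (simp only: restrict_apply if_True)
      from injD[OF inj this] show "i = j" by (rule inj_onD[OF f'(1) _ ij(1,2)])
    qed
    moreover have "vec.independent (?k P ` {1..r})"
      unfolding im
      by (intro vec.linear_independent_injective_image matrix_vector_mul_linear_gen f'(2)
          inj_on_subset[OF inj] subset_UNIV)
    ultimately have k: "?k P \<in> frames r" by (simp add: frames_def)
    have "?k P i \<in> matrix_range P" if i: "i \<in> {1..r}" for i
    proof -
      have "f i \<in> matrix_range Q"
        unfolding f(2)[symmetric] frame_span_def using i by (intro vec.span_base) simp
      then have "Q *v f i = f i"
        using Q by (intro projection_fixes_range) (simp_all add: rank_projections_def)
      then have "?W Q P *v f i = P *v f i"
        by (simp add: matrix_vector_mult_add_rdistrib matrix_vector_mul_assoc[symmetric] matrix_vector_mult_diff_rdistrib)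
      then show ?thesis using i by (simp add: matrix_range_def)
    qed
    then have "frame_span r (?k P) \<subseteq> matrix_range P"
      unfolding frame_span_def by (intro vec.span_minimal subspace_matrix_range) auto
    then have "frame_span r (?k P) = matrix_range P"
      using frame_span_in_Gr[OF k] matrix_range_in_Gr[OF PR]
      by (intro vec.subspace_dim_equal) (auto simp: Gr_def)
    then show ?thesis using k by blast
  qed
  have "continuous_map (subtopology (top_of_set (rank_projections r)) (N Q)) (frame_space r) ?k"
    unfolding frame_space_def continuous_map_in_subtopology continuous_map_componentwise
  proof (intro conjI ballI)
    fix i assume i: "i \<in> {1..r}"
    have "continuous_on (N Q) (\<lambda>P. ?W Q P *v f i)" by (intro continuous_intros)
    then show "continuous_map (subtopology (top_of_set (rank_projections r)) (N Q)) euclidean (\<lambda>P. ?k P i)"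
      using i by (simp add: subtopology_subtopology N_def Int_absorb1 Collect_subset)
  qed (use kf in \<open>auto simp: frames_def\<close>)
  from continuous_map_compose[OF this quotient_imp_continuous_map[OF quotient_map_Gr_space]]
  show "continuous_map (subtopology (top_of_set (rank_projections r)) (N Q)) (Gr_space r) matrix_range"
    by (rule continuous_map_eq) (use kf in \<open>auto simp: o_def\<close>)
qed auto

lemma continuous_map_euclidean_pair:
  assumes "continuous_map T euclidean f" "continuous_map T euclidean g"
  shows "continuous_map T euclidean (\<lambda>x. (f x, g x))"
  using continuous_map_pairedI[OF assms] by simp

section \<open>Pairs and the Grassmannian\<close>

definition pair_tuple :: "complex^'n^'n \<Rightarrow> complex^'n^'n \<Rightarrow> nat \<Rightarrow> complex^'n^'n" where
  "pair_tuple H K = (\<lambda>j\<in>{1..2}. if j = 1 then cayley H else cayley K)"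

lemma pair_tuple_cayley_inv: "A \<in> X_set 2 \<Longrightarrow> pair_tuple (cayley_inv (A 1)) (cayley_inv (A 2)) = A"
proof -
  assume A: "A \<in> X_set 2"
  have "cayley (cayley_inv (A 1)) = A 1" "cayley (cayley_inv (A 2)) = A 2"
    using cayley_cayley_inv[OF X_set_E[OF A, of 1]] cayley_cayley_inv[OF X_set_E[OF A, of 2]] by simp_all
  then show ?thesis
    using A by (auto simp: pair_tuple_def X_set_def PiE_iff extensional_def fun_eq_iff numeral_2_eq_2 le_Suc_eq)
qed

lemma mat_prod_2: "mat_prod A 2 = A 1 ** A 2"
  by (simp add: numeral_2_eq_2)

lemma pair_tuple_in_X:
  assumes H: "H \<in> hermitian_set" and K: "K \<in> hermitian_set" and S: "H + K \<in> invertible_hermitian"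
  shows "pair_tuple H K \<in> X_set 2" "Delta 2 (pair_tuple H K) = signature (H + K)"
proof -
  note E = cayley_in_E[OF H] cayley_in_E[OF K]
  have P: "cayley H ** cayley K \<in> E_set"
    using product_in_E_iff[OF E] S by (simp add: cayley_inv_cayley H K invertible_hermitian_def)
  have v: "pair_tuple H K 1 = cayley H" "pair_tuple H K 2 = cayley K"
    by (simp_all add: pair_tuple_def)
  show "pair_tuple H K \<in> X_set 2"
    unfolding X_set_def mem_Collect_eq mat_prod_2 v using E P by (auto simp: pair_tuple_def)
  have "Delta 2 (pair_tuple H K) = rho (cayley H) + rho (cayley K) - rho (cayley H ** cayley K)"
  proof -
    have "(\<Sum>j=1..2. rho (pair_tuple H K j)) = rho (pair_tuple H K 1) + rho (pair_tuple H K 2)"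
      by (simp add: numeral_2_eq_2)
    then show ?thesis by (simp only: Delta_def mat_prod_2 v)
  qed
  then show "Delta 2 (pair_tuple H K) = signature (H + K)"
    using rho_product_defect[OF E P] by (simp add: cayley_inv_cayley H K)
qed

definition pair_sum :: "(nat \<Rightarrow> complex^'n^'n) \<Rightarrow> complex^'n^'n" where
  "pair_sum A = cayley_inv (A 1) + cayley_inv (A 2)"

lemma pair_sum:
  assumes A: "A \<in> X_set 2"
  shows "pair_sum A \<in> invertible_hermitian" "Delta 2 A = signature (pair_sum A)"
proof -
  have E: "A 1 \<in> E_set" "A 2 \<in> E_set" "A 1 ** A 2 \<in> E_set"
    using X_set_E[OF A] X_set_prod_E[OF A] by (auto simp: mat_prod_2)
  note H = cayley_inv_hermitian[OF E(1)] cayley_inv_hermitian[OF E(2)]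
  show S: "pair_sum A \<in> invertible_hermitian"
    using product_in_E_iff[OF E(1,2)] E(3) subspace_add[OF hermitian_subspace H]
    by (simp add: pair_sum_def invertible_hermitian_def)
  show "Delta 2 A = signature (pair_sum A)"
    using pair_tuple_in_X(2)[OF H] S unfolding pair_tuple_cayley_inv[OF A] pair_sum_def by blast
qed

text \<open>On an eigenvector the segment runs from an eigenvalue to its sign without changing the sign.\<close>

lemma herm_sign_segment:
  assumes S: "S \<in> invertible_hermitian" and t: "t \<in> {0..1}"
  shows "(1 - t) *\<^sub>R S + t *\<^sub>R herm_sign S \<in> invertible_hermitian"
    and "herm_sign ((1 - t) *\<^sub>R S + t *\<^sub>R herm_sign S) = herm_sign S"
proof -
  obtain U d where U: "U \<in> unitary_group" and d: "\<And>l. d l \<noteq> 0"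
    and SU: "S = udiag U (\<lambda>l. complex_of_real (d l))"
    using invertible_hermitian_diagonalization[OF S] by metis
  let ?e = "\<lambda>l. (1 - t) * d l + t * sgn (d l)"
  have e: "(1 - t) *\<^sub>R S + t *\<^sub>R herm_sign S = udiag U (\<lambda>l. complex_of_real (?e l))"
    by (simp add: SU herm_sign_udiag[OF U d] udiag_scaleR[OF U] udiag_add)
  \<comment> \<open>The second bounds \<open>d l + 2\<close> and \<open>d l - 2\<close> below only have to be large enough.\<close>
  have s: "sgn (?e l) = sgn (d l)" for l
  proof (cases "d l > 0")
    case True
    then have "?e l > 0"
      using convex_strict_bounds(1)[of 0 "d l" "d l + 2" 1 t] t by simp
    then show ?thesis using True by simp
  next
    case False
    then have "d l < 0" using d[of l] by simp
    then have "?e l < 0"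
      using convex_strict_bounds(2)[of "d l - 2" "d l" 0 "- 1" t] t by simp
    then show ?thesis using \<open>d l < 0\<close> by simp
  qed
  then have e0: "?e l \<noteq> 0" for l using d[of l] by (metis sgn_0_0)
  show "(1 - t) *\<^sub>R S + t *\<^sub>R herm_sign S \<in> invertible_hermitian"
    unfolding e udiag_invertible_hermitian[OF U] using e0 by blast
  show "herm_sign ((1 - t) *\<^sub>R S + t *\<^sub>R herm_sign S) = herm_sign S"
    unfolding e herm_sign_udiag[OF U e0] s by (simp add: SU herm_sign_udiag[OF U d])
qed

lemma involution_herm_sign:
  assumes J: "J \<in> hermitian_set" "J ** J = mat 1"
  shows "J \<in> invertible_hermitian" "herm_sign J = J"
proof -
  have "det J * det J = 1" using J(2) det_mul[of J J] by simp
  then show Ji: "J \<in> invertible_hermitian" using J(1) by (auto simp: invertible_hermitian_def)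
  have "mat 1 \<in> hermitian_set" by (simp add: hermitian_set_def)
  then show "herm_sign J = J"
    using J by (intro herm_sign_eqI[OF Ji]) (simp add: is_sign_def)
qed

text \<open>The orthogonal projection onto the sum of the eigenspaces for positive eigenvalues.\<close>

definition positive_projection :: "complex^'n^'n \<Rightarrow> complex^'n^'n" where
  "positive_projection S = (1 / 2) *\<^sub>R (mat 1 + herm_sign S)"

definition reflection :: "complex^'n^'n \<Rightarrow> complex^'n^'n" where
  "reflection P = 2 *\<^sub>R P - mat 1"

lemma scaleR_matrix_mult:
  fixes A B :: "complex^'n^'n"
  shows "(c *\<^sub>R A) ** (d *\<^sub>R B) = (c * d) *\<^sub>R (A ** B)"
  unfolding scaleR_eq_mat[of c A] scaleR_eq_mat[of d B] scaleR_eq_mat[of "c * d"] mat_mult_mat_mult of_real_mult ..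

lemma trace_scaleR: "trace (c *\<^sub>R (A :: complex^'n^'n)) = of_real c * trace A"
  by (simp add: trace_def sum_distrib_left) (simp add: scaleR_conv_of_real)

lemma hermitian_mat1: "mat 1 \<in> hermitian_set"
  by (simp add: hermitian_set_def)

lemma positive_projection:
  fixes S :: "complex^'n^'n"
  assumes S: "S \<in> invertible_hermitian" and sig: "signature S = 2 * real r - real CARD('n)"
  shows "positive_projection S \<in> rank_projections r" "reflection (positive_projection S) = herm_sign S"
proof -
  let ?J = "herm_sign S"
  have J: "?J \<in> hermitian_set" "?J ** ?J = mat 1"
    using herm_sign_is_sign[OF S] by (auto simp: is_sign_def)
  have "(mat 1 + ?J) ** (mat 1 + ?J) = 2 *\<^sub>R (mat 1 + ?J)"
    by (simp add: matrix_add_ldistrib matrix_add_rdistrib J scaleR_2)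
  then have "positive_projection S ** positive_projection S = positive_projection S"
    by (simp add: positive_projection_def scaleR_matrix_mult)
  moreover have "positive_projection S \<in> hermitian_set"
    unfolding positive_projection_def
    by (intro subspace_scale[OF hermitian_subspace] subspace_add[OF hermitian_subspace] hermitian_mat1 J)
  moreover have "trace (positive_projection S) = of_nat r"
  proof -
    obtain U and d :: "'n \<Rightarrow> real" where U: "U \<in> unitary_group" and d: "\<And>l. d l \<noteq> 0"
      and SU: "S = udiag U (\<lambda>l. complex_of_real (d l))"
      using invertible_hermitian_diagonalization[OF S] by metis
    have "trace ?J = complex_of_real (signature S)"
      by (simp add: SU signature_udiag[OF U d] herm_sign_udiag[OF U d] trace_udiag[OF U])
    then show ?thesis
      by (simp add: positive_projection_def trace_scaleR trace_add trace_I sig)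
  qed
  ultimately show "positive_projection S \<in> rank_projections r"
    by (simp add: rank_projections_def projections_def)
  show "reflection (positive_projection S) = ?J"
    by (simp add: reflection_def positive_projection_def)
qed

lemma reflection:
  fixes P :: "complex^'n^'n"
  assumes P: "P \<in> rank_projections r"
  shows "reflection P \<in> invertible_hermitian" "herm_sign (reflection P) = reflection P"
    "signature (reflection P) = 2 * real r - real CARD('n)" "positive_projection (reflection P) = P"
proof -
  have h: "reflection P \<in> hermitian_set"
    unfolding reflection_def
    by (intro subspace_diff[OF hermitian_subspace] subspace_scale[OF hermitian_subspace] hermitian_mat1)
      (use P in \<open>simp add: rank_projections_def projections_def\<close>)
  have sq: "reflection P ** reflection P = mat 1"
  proof -
    have "reflection P ** reflection P = 4 *\<^sub>R (P ** P) - 2 *\<^sub>R P - 2 *\<^sub>R P + mat 1"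
      using scaleR_matrix_mult[of 2 P 2 P] by (simp add: reflection_def matrix_diff_ldistrib matrix_diff_rdistrib)
    also have "\<dots> = mat 1"
      using P by (simp add: rank_projections_def projections_def vec_eq_iff)
    finally show ?thesis .
  qed
  note i = involution_herm_sign[OF h sq]
  show "reflection P \<in> invertible_hermitian" "herm_sign (reflection P) = reflection P" by (fact i)+
  have "trace (reflection P) = 2 * trace P - of_nat CARD('n)"
    unfolding reflection_def by (simp add: trace_sub trace_scaleR trace_I)
  then show "signature (reflection P) = 2 * real r - real CARD('n)"
    using P by (simp add: signature_def i rank_projections_def)
  show "positive_projection (reflection P) = P"
    by (simp add: positive_projection_def i) (simp add: reflection_def)
qed

text \<open>In Cayley coordinates a pair is \<open>(H, K)\<close> with \<open>S = H + K\<close> invertible of signature \<open>2 r - p\<close>.  The pair is sent to the positive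
spectral subspace of \<open>S\<close>, and a subspace to the pair \<open>(0, J)\<close> with \<open>J\<close> the reflection that is 1 on it.  One composite is the
identity; the other one is deformed to the identity by moving \<open>S\<close> linearly to its sign and \<open>H\<close> linearly to 0.\<close>

theorem pair_fiber_homotopy_equivalent_Gr:
  assumes r: "r \<le> CARD('n)"
  defines "F \<equiv> Delta_fiber 2 (2 * real r - real CARD('n)) :: (nat \<Rightarrow> complex^'n^'n) set"
  shows "subtopology (X_space 2) F homotopy_equivalent_space (Gr_space r :: (complex^'n) set topology)"
proof -
  let ?X = "subtopology (X_space 2) F" and ?c = "2 * real r - real CARD('n)"
  have FX: "F \<subseteq> X_set 2" by (auto simp: F_def Delta_fiber_def)
  then have top: "topspace ?X = F" by (auto simp: topspace_X_space)
  have sumF: "pair_sum A \<in> invertible_hermitian" "signature (pair_sum A) = ?c" if "A \<in> F" for A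
    using pair_sum[of A] that by (auto simp: F_def Delta_fiber_def)
  have hF: "cayley_inv (A 1) \<in> hermitian_set" "cayley_inv (A 2) \<in> hermitian_set" "A 1 \<in> E_set" "A 2 \<in> E_set"
    if "A \<in> F" for A
  proof -
    have A: "A \<in> X_set 2" using that FX by blast
    show E: "A 1 \<in> E_set" "A 2 \<in> E_set" using X_set_E[OF A] by auto
    show "cayley_inv (A 1) \<in> hermitian_set" "cayley_inv (A 2) \<in> hermitian_set" by (intro cayley_inv_hermitian E)+
  qed
  have pairF: "pair_tuple H K \<in> F"
    if "H \<in> hermitian_set" "K \<in> hermitian_set" "H + K \<in> invertible_hermitian" "signature (H + K) = ?c" for H K
    using pair_tuple_in_X[OF that(1-3)] that(4) by (simp add: F_def Delta_fiber_def)
  have comp: "continuous_map ?X euclidean (\<lambda>A. A j)" if "j \<in> {1..2}" for j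
  proof -
    have "continuous_map (X_space 2) euclidean (\<lambda>A :: nat \<Rightarrow> complex^'n^'n. A j)"
      using continuous_map_X_space_iff[of "X_space 2" 2 "\<lambda>A :: nat \<Rightarrow> complex^'n^'n. A"] that by simp
    then show ?thesis by (rule continuous_map_from_subtopology)
  qed
  have pair_cont: "continuous_map T ?X (\<lambda>x. pair_tuple (h x) (k x))"
    if c: "continuous_map T euclidean (\<lambda>x. cayley (h x))" "continuous_map T euclidean (\<lambda>x. cayley (k x))"
    and m: "\<And>x. x \<in> topspace T \<Longrightarrow> pair_tuple (h x) (k x) \<in> F"
    for T :: "'z topology" and h k
  proof -
    have "continuous_map T euclidean (\<lambda>x. pair_tuple (h x) (k x) j)" if "j \<in> {1..2}" for j
      using that c by (cases "j = 1") (simp_all add: pair_tuple_def)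
    then show ?thesis
      using m FX by (auto simp: continuous_map_in_subtopology continuous_map_X_space_iff)
  qed
  define f where "f A = matrix_range (positive_projection (pair_sum A))" for A :: "nat \<Rightarrow> complex^'n^'n"
  define g where "g V = pair_tuple 0 (reflection (Gr_projection V))" for V :: "(complex^'n) set"
  have contf: "continuous_map ?X (Gr_space r) f"
  proof -
    let ?D = "{x. fst x \<in> E_set \<and> snd x \<in> E_set \<and> cayley_inv (fst x) + cayley_inv (snd x) \<in> invertible_hermitian}"
    have c1: "continuous_map ?X euclidean (\<lambda>A. (A 1, A 2))"
      by (intro continuous_map_euclidean_pair comp) auto
    have c2: "continuous_on ?D
        (\<lambda>x :: (complex^'n^'n) \<times> (complex^'n^'n). positive_projection (cayley_inv (fst x) + cayley_inv (snd x)))"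
      unfolding positive_projection_def
      by (intro continuous_intros continuous_on_compose2[OF continuous_on_herm_sign]) auto
    have mem: "(A 1, A 2) \<in> ?D" if "A \<in> topspace ?X" for A
      using hF(3,4)[of A] sumF(1)[of A] that unfolding top by (simp add: pair_sum_def)
    have "continuous_map ?X euclidean (\<lambda>A. positive_projection (pair_sum A))"
      using continuous_map_compose_on[OF c1 mem c2] by (simp add: pair_sum_def)
    then have "continuous_map ?X (top_of_set (rank_projections r)) (\<lambda>A. positive_projection (pair_sum A))"
      using positive_projection(1)[OF sumF] by (simp add: continuous_map_in_subtopology top Pi_iff)
    from continuous_map_compose[OF this continuous_map_matrix_range] show ?thesis
      by (simp add: f_def[abs_def] o_def)
  qed
  have GrP: "Gr_projection V \<in> rank_projections r" "matrix_range (Gr_projection V) = V" if "V \<in> Gr r" for V :: "(complex^'n) set"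
    using Gr_projection[OF r that] by (simp_all add: rank_projections_def)
  have contg: "continuous_map (Gr_space r) ?X g"
    unfolding g_def
  proof (rule pair_cont)
    have c2: "continuous_on (rank_projections r) (\<lambda>P :: complex^'n^'n. cayley (reflection P))"
      using reflection(1) by (intro continuous_intros) (auto simp: reflection_def invertible_hermitian_def intro!: continuous_intros)
    have mem: "Gr_projection V \<in> rank_projections r" if "V \<in> topspace (Gr_space r)" for V :: "(complex^'n) set"
      using that GrP(1) unfolding topspace_Gr_space by blast
    show "continuous_map (Gr_space r) euclidean (\<lambda>V :: (complex^'n) set. cayley (reflection (Gr_projection V)))"
      by (rule continuous_map_compose_on[OF continuous_map_Gr_projection[OF r] mem c2])
  next
    fix V :: "(complex^'n) set" assume "V \<in> topspace (Gr_space r)"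
    then have P: "Gr_projection V \<in> rank_projections r" using GrP by (simp add: topspace_Gr_space)
    show "pair_tuple 0 (reflection (Gr_projection V)) \<in> F"
      using reflection[OF P] by (intro pairF hermitian_0) (simp_all add: invertible_hermitian_def)
  qed simp
  have fg: "f (g V) = V" if V: "V \<in> Gr r" for V
  proof -
    note R = reflection[OF GrP(1)[OF V]]
    have "pair_sum (g V) = reflection (Gr_projection V)"
      using R(1) by (simp add: pair_sum_def g_def pair_tuple_def cayley_inv_cayley cayley_inv_cayley[OF hermitian_0]
          invertible_hermitian_def)
    then show ?thesis by (simp add: f_def R(4) GrP(2)[OF V])
  qed
  have "homotopic_with (\<lambda>x. True) (Gr_space r) (Gr_space r) (f \<circ> g) id"
    using contf contg fg by (intro homotopic_with_equal continuous_map_compose) (auto simp: topspace_Gr_space)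
  moreover have "homotopic_with (\<lambda>x. True) ?X ?X id (g \<circ> f)"
  proof -
    define s where "s t A = (1 - t) *\<^sub>R pair_sum A + t *\<^sub>R herm_sign (pair_sum A)" for t :: real and A :: "nat \<Rightarrow> complex^'n^'n"
    define H where "H t A = (1 - t) *\<^sub>R cayley_inv (A 1)" for t :: real and A :: "nat \<Rightarrow> complex^'n^'n"
    let ?h = "\<lambda>x. pair_tuple (H (fst x) (snd x)) (s (fst x) (snd x) - H (fst x) (snd x))"
    let ?T = "prod_topology (top_of_set {0..1::real}) ?X"
    have topT: "x \<in> topspace ?T \<longleftrightarrow> fst x \<in> {0..1} \<and> snd x \<in> F" for x
      by (simp only: topspace_prod_topology top topspace_euclidean_subtopology mem_Times_iff)
    have sI: "s t A \<in> invertible_hermitian" "signature (s t A) = ?c" if "t \<in> {0..1}" "A \<in> F" for t A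
      using herm_sign_segment[OF sumF(1)[OF that(2)] that(1)] sumF(2)[OF that(2)]
      by (simp_all add: s_def signature_def)
    have Hh: "H t A \<in> hermitian_set" if "A \<in> F" for t A
      unfolding H_def by (rule subspace_scale[OF hermitian_subspace hF(1)[OF that]])
    have Kh: "s t A - H t A \<in> hermitian_set" if "t \<in> {0..1}" "A \<in> F" for t A
      using sI(1)[OF that] Hh[OF that(2)] subspace_diff[OF hermitian_subspace, of "s t A" "H t A"]
      by (simp add: invertible_hermitian_def)
    let ?u = "\<lambda>x :: real \<times> (nat \<Rightarrow> complex^'n^'n). (fst x, snd x 1, snd x 2)"
    have cu: "continuous_map ?T euclidean ?u"
    proof (intro continuous_map_euclidean_pair)
      have "continuous_map ?T (top_of_set {0..1}) fst" by (rule continuous_map_fst)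
      then show "continuous_map ?T euclidean fst" by (rule continuous_map_into_fulltopology)
      show "continuous_map ?T euclidean (\<lambda>x. snd x 1)" "continuous_map ?T euclidean (\<lambda>x. snd x 2)"
        using continuous_map_compose[OF continuous_map_snd comp[of 1]] continuous_map_compose[OF continuous_map_snd comp[of 2]]
        by (simp_all add: o_def)
    qed
    let ?D = "{y :: real \<times> (complex^'n^'n) \<times> (complex^'n^'n). fst y \<in> {0..1} \<and> fst (snd y) \<in> E_set \<and> snd (snd y) \<in> E_set \<and>
        cayley_inv (fst (snd y)) + cayley_inv (snd (snd y)) \<in> invertible_hermitian}"
    have uD: "?u x \<in> ?D" if "x \<in> topspace ?T" for x
      using that hF[of "snd x"] sumF(1)[of "snd x"] by (simp add: topT pair_sum_def del: topspace_prod_topology)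
    let ?HH = "\<lambda>y :: real \<times> (complex^'n^'n) \<times> (complex^'n^'n). (1 - fst y) *\<^sub>R cayley_inv (fst (snd y))"
    let ?KK = "\<lambda>y :: real \<times> (complex^'n^'n) \<times> (complex^'n^'n). ((1 - fst y) *\<^sub>R (cayley_inv (fst (snd y)) + cayley_inv (snd (snd y)))
         + fst y *\<^sub>R herm_sign (cayley_inv (fst (snd y)) + cayley_inv (snd (snd y)))) - ?HH y"
    have "?HH y \<in> hermitian_set" if "y \<in> ?D" for y
      using that by (auto intro: subspace_scale[OF hermitian_subspace] cayley_inv_hermitian)
    then have c1: "continuous_on ?D (\<lambda>y. cayley (?HH y))"
      by (intro continuous_intros) auto
    have "?KK y \<in> hermitian_set" if "y \<in> ?D" for y
    proof -
      have "((1 - fst y) *\<^sub>R (cayley_inv (fst (snd y)) + cayley_inv (snd (snd y)))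
         + fst y *\<^sub>R herm_sign (cayley_inv (fst (snd y)) + cayley_inv (snd (snd y)))) \<in> hermitian_set"
        using herm_sign_segment(1)[of "cayley_inv (fst (snd y)) + cayley_inv (snd (snd y))" "fst y"] that
        by (simp add: invertible_hermitian_def)
      moreover have "?HH y \<in> hermitian_set"
        using that by (auto intro: subspace_scale[OF hermitian_subspace] cayley_inv_hermitian)
      ultimately show ?thesis by (rule subspace_diff[OF hermitian_subspace])
    qed
    then have c2: "continuous_on ?D (\<lambda>y. cayley (?KK y))"
      by (intro continuous_on_cayley continuous_intros continuous_on_compose2[OF continuous_on_herm_sign]) auto
    have cont: "continuous_map ?T ?X ?h"
    proof (rule pair_cont)
      show "continuous_map ?T euclidean (\<lambda>x. cayley (H (fst x) (snd x)))"
        using continuous_map_compose_on[OF cu uD c1] by (simp add: H_def)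
      show "continuous_map ?T euclidean (\<lambda>x. cayley (s (fst x) (snd x) - H (fst x) (snd x)))"
        using continuous_map_compose_on[OF cu uD c2] by (simp add: H_def s_def pair_sum_def)
      show "?h x \<in> F" if "x \<in> topspace ?T" for x
        using that sI Hh Kh by (intro pairF) (auto simp: topT simp del: topspace_prod_topology)
    qed
    have h0: "?h (0, A) = id A" if A: "A \<in> topspace ?X" for A
    proof -
      have "A \<in> X_set 2" using A FX by (auto simp: top)
      then show ?thesis
        using pair_tuple_cayley_inv[of A] by (simp add: H_def s_def pair_sum_def)
    qed
    have h1: "?h (1, A) = (g \<circ> f) A" if A: "A \<in> topspace ?X" for A
    proof -
      have "A \<in> F" using A by (simp add: top)
      note P = positive_projection[OF sumF[OF this]]
      have "Gr_projection (f A) = positive_projection (pair_sum A)"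
        unfolding f_def using P(1) by (intro Gr_projection_eqI) (auto simp: rank_projections_def)
      then show ?thesis by (simp add: g_def H_def s_def P(2))
    qed
    show ?thesis
      using cont h0 h1 by (subst homotopic_with) (auto intro!: exI[of _ ?h])
  qed
  ultimately show ?thesis
    unfolding homotopy_equivalent_space_def
    using contf contg homotopic_with_symD by blast
qed

section \<open>The theorem\<close>

theorem theorem1p2:
  fixes m :: nat
  assumes "m \<ge> 1"
  shows
    "Delta m ` (X_set m :: (nat \<Rightarrow> complex^'n^'n) set) =
       {(real m - 1) * real CARD('n) - 2 * real K | K :: nat. K \<le> (m - 1) * CARD('n)}
     \<and> (\<forall>c \<in> Delta m ` (X_set m :: (nat \<Rightarrow> complex^'n^'n) set).
          path_connectedin (X_space m) (Delta_fiber m c :: (nat \<Rightarrow> complex^'n^'n) set))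
     \<and> card (connected_components_of (X_space m :: (nat \<Rightarrow> complex^'n^'n) topology)) =
          (m - 1) * CARD('n) + 1
     \<and> (\<forall>r \<le> CARD('n).
          (Delta_fiber 2 (2 * real r - real CARD('n)) :: (nat \<Rightarrow> complex^'n^'n) set)
            \<in> connected_components_of (X_space 2)
          \<and> subtopology (X_space 2)
              (Delta_fiber 2 (2 * real r - real CARD('n)) :: (nat \<Rightarrow> complex^'n^'n) set)
            homotopy_equivalent_space (Gr_space r :: (complex^'n) set topology))"
  by (intro conjI ballI allI impI Delta_image Delta_fiber_path_connected card_X_space_components
      pair_fiber_is_component pair_fiber_homotopy_equivalent_Gr assms)

end
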